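(* Let $G$ be an amply regular Terwilliger graph such that the Lin–Lu–Yau curvature $\kappa(x,y)$ is positive for every edge $xy$ of $G$. Then $G$ is isomorphic to one of the following graphs: the pentagon, the icosahedron, the line graph of the Petersen graph, the line graph of the Hoffman–Singleton graph, or the line graph of a strongly regular graph with parameters $(3250,57,0,1)$.
   Context: All graphs are finite and simple. A non-complete connected $d$-regular graph on $n$ vertices is amply regular with parameters $(n,d,\alpha,\beta)$ if any two adjacent vertices have exactly $\alpha$ common neighbours and any two vertices at distance $2$ have exactly $\beta$ common neighbours. A strongly regular graph with parameters $(n,d,\alpha,\beta)$ is an amply regular graph with these parameters of diameter $2$. A non-complete graph is Terwilliger if there is $\beta\ge1$ such that for any two vertices at distance $2$, the subgraph induced on their common neighbours is a clique of size $\beta$. Lin–Lu–Yau curvature: for a vertex $x$ and $p\in[0,1]$ let $\mu_x^p(x)=p$, $\mu_x^p(y)=(1-p)/\deg(x)$ for neighbours $y$ of $x$, and $0$ otherwise; $W_1$ is the $L^1$-Wasserstein (optimal transport) distance with respect to the graph distance $d$; $\kappa_p(x,y)=1-W_1(\mu_x^p,\mu_y^p)/d(x,y)$ and $\kappa(x,y)=\lim_{p\to1}\kappa_p(x,y)/(1-p)$. *)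

theory Defs
  imports Complex_Main "Graph_Theory.Graph_Theory"
begin

text \<open>Finite simple graphs are the graphs satisfying \<^const>\<open>pair_graph\<close>: every edge is represented
  by its two opposite arcs.\<close>

section \<open>Amply regular, strongly regular and Terwilliger graphs\<close>

definition gdist :: "'a pair_pre_digraph \<Rightarrow> 'a \<Rightarrow> 'a \<Rightarrow> ereal" where
  "gdist G x y = wf_digraph.\<mu> (with_proj G) (\<lambda>_. 1) x y"

definition diameter :: "'a pair_pre_digraph \<Rightarrow> ereal" where
  "diameter G = (SUP x\<in>pverts G. SUP y\<in>pverts G. gdist G x y)"

definition common_neighbours :: "'a pair_pre_digraph \<Rightarrow> 'a \<Rightarrow> 'a \<Rightarrow> 'a set" where
  "common_neighbours G x y = {z \<in> pverts G. (x, z) \<in> parcs G \<and> (y, z) \<in> parcs G}"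

definition complete_graph :: "'a pair_pre_digraph \<Rightarrow> bool" where
  "complete_graph G \<longleftrightarrow> (\<exists>n. complete_digraph n (with_proj G))"

definition amply_regular :: "'a pair_pre_digraph \<Rightarrow> nat \<Rightarrow> nat \<Rightarrow> nat \<Rightarrow> nat \<Rightarrow> bool" where
  "amply_regular G n d \<alpha> \<beta> \<longleftrightarrow>
     pair_graph G \<and> \<not> complete_graph G \<and> Digraph_Component.connected (with_proj G) \<and>
     card (pverts G) = n \<and>
     (\<forall>x\<in>pverts G. out_degree (with_proj G) x = d) \<and>
     (\<forall>x y. (x, y) \<in> parcs G \<longrightarrow> card (common_neighbours G x y) = \<alpha>) \<and>
     (\<forall>x\<in>pverts G. \<forall>y\<in>pverts G. gdist G x y = 2 \<longrightarrow> card (common_neighbours G x y) = \<beta>)"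

definition strongly_regular :: "'a pair_pre_digraph \<Rightarrow> nat \<Rightarrow> nat \<Rightarrow> nat \<Rightarrow> nat \<Rightarrow> bool" where
  "strongly_regular G n d \<alpha> \<beta> \<longleftrightarrow> amply_regular G n d \<alpha> \<beta> \<and> diameter G = 2"

definition terwilliger :: "'a pair_pre_digraph \<Rightarrow> bool" where
  "terwilliger G \<longleftrightarrow>
     pair_graph G \<and> \<not> complete_graph G \<and>
     (\<exists>\<beta>\<ge>1. \<forall>x\<in>pverts G. \<forall>y\<in>pverts G. gdist G x y = 2 \<longrightarrow>
        complete_digraph \<beta> (with_proj G \<restriction> common_neighbours G x y))"

section \<open>Lin--Lu--Yau curvature\<close>

definition lazy_walk_measure :: "'a pair_pre_digraph \<Rightarrow> real \<Rightarrow> 'a \<Rightarrow> 'a \<Rightarrow> real" where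
  "lazy_walk_measure G p x y =
     (if y = x then p
      else if (x, y) \<in> parcs G then (1 - p) / real (out_degree (with_proj G) x)
      else 0)"

definition transport_plan ::
  "'a pair_pre_digraph \<Rightarrow> ('a \<Rightarrow> real) \<Rightarrow> ('a \<Rightarrow> real) \<Rightarrow> ('a \<Rightarrow> 'a \<Rightarrow> real) \<Rightarrow> bool" where
  "transport_plan G m1 m2 \<pi> \<longleftrightarrow>
     (\<forall>u\<in>pverts G. \<forall>v\<in>pverts G. 0 \<le> \<pi> u v) \<and>
     (\<forall>u\<in>pverts G. (\<Sum>v\<in>pverts G. \<pi> u v) = m1 u) \<and>
     (\<forall>v\<in>pverts G. (\<Sum>u\<in>pverts G. \<pi> u v) = m2 v)"

text \<open>The next three definitions are meant for connected graphs, where all distances are finite and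
  \<^const>\<open>real_of_ereal\<close> loses nothing.\<close>

definition wasserstein1 :: "'a pair_pre_digraph \<Rightarrow> ('a \<Rightarrow> real) \<Rightarrow> ('a \<Rightarrow> real) \<Rightarrow> real" where
  "wasserstein1 G m1 m2 =
     (INF \<pi>\<in>{\<pi>. transport_plan G m1 m2 \<pi>}.
        \<Sum>u\<in>pverts G. \<Sum>v\<in>pverts G. \<pi> u v * real_of_ereal (gdist G u v))"

definition lazy_curvature :: "'a pair_pre_digraph \<Rightarrow> real \<Rightarrow> 'a \<Rightarrow> 'a \<Rightarrow> real" where
  "lazy_curvature G p x y =
     1 - wasserstein1 G (lazy_walk_measure G p x) (lazy_walk_measure G p y) /
         real_of_ereal (gdist G x y)"

definition LLY_curvature :: "'a pair_pre_digraph \<Rightarrow> 'a \<Rightarrow> 'a \<Rightarrow> real" where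
  "LLY_curvature G x y = Lim (at_left 1) (\<lambda>p. lazy_curvature G p x y / (1 - p))"

section \<open>Specific graphs\<close>

definition line_graph :: "'a pair_pre_digraph \<Rightarrow> 'a set pair_pre_digraph" where
  "line_graph G =
     (let E = {{u, v} | u v. (u, v) \<in> parcs G}
      in \<lparr>pverts = E, parcs = {(e, f). e \<in> E \<and> f \<in> E \<and> e \<noteq> f \<and> e \<inter> f \<noteq> {}}\<rparr>)"

text \<open>Below, \<^const>\<open>mk_symmetric\<close> adds the opposite arcs.\<close>

definition pentagon :: "nat pair_pre_digraph" where
  "pentagon = mk_symmetric (with_proj
     \<lparr>pverts = {..<5}, parcs = (\<Union>i<5. {(i, (i + 1) mod 5)})\<rparr>)"

text \<open>The icosahedron as a pentagonal antiprism with rings \<open>(1, i)\<close> and \<open>(2, i)\<close>, capped by the apexes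
  \<open>(0, 0)\<close> and \<open>(3, 0)\<close>.\<close>

definition icosahedron :: "(nat \<times> nat) pair_pre_digraph" where
  "icosahedron = mk_symmetric (with_proj
     \<lparr>pverts = {(0, 0), (3, 0)} \<union> {1, 2} \<times> {..<5},
      parcs = (\<Union>i<5.
        {((0, 0), (1, i)), ((1, i), (1, (i + 1) mod 5)),
         ((1, i), (2, i)), ((1, i), (2, (i + 1) mod 5)),
         ((2, i), (2, (i + 1) mod 5)), ((2, i), (3, 0))})\<rparr>)"

text \<open>The Petersen graph as the Kneser graph of the 2-subsets of a 5-set.\<close>

definition petersen :: "nat set pair_pre_digraph" where
  "petersen =
     (let V = {S. S \<subseteq> {..<5} \<and> card S = 2}
      in \<lparr>pverts = V, parcs = {(S, T). S \<in> V \<and> T \<in> V \<and> S \<inter> T = {}}\<rparr>)"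

text \<open>Robertson's construction of the Hoffman--Singleton graph: five pentagons \<open>P\<^sub>h\<close> with vertices
  \<open>(0, h, j)\<close>, five pentagrams \<open>Q\<^sub>i\<close> with vertices \<open>(1, i, j)\<close>, and vertex \<open>j\<close> of \<open>P\<^sub>h\<close> joined
  to vertex \<open>h i + j\<close> of \<open>Q\<^sub>i\<close>, all modulo 5.\<close>

definition hoffman_singleton :: "(nat \<times> nat \<times> nat) pair_pre_digraph" where
  "hoffman_singleton = mk_symmetric (with_proj
     \<lparr>pverts = {0, 1} \<times> {..<5} \<times> {..<5},
      parcs =
        (\<Union>h<5. \<Union>j<5. {((0, h, j), (0, h, (j + 1) mod 5))}) \<union>
        (\<Union>i<5. \<Union>j<5. {((1, i, j), (1, i, (j + 2) mod 5))}) \<union>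
        (\<Union>h<5. \<Union>i<5. \<Union>j<5. {((0, h, j), (1, i, (h * i + j) mod 5))})\<rparr>)"

end

theory Submission
  imports Defs "Jordan_Normal_Form.Schur_Decomposition"
begin

text \<open>
  In a Terwilliger graph there are no edges between the private neighbours of the two ends of an edge, so
  transporting the neighbours of one end to those of the other costs at least twice their number. Positive
  curvature therefore gives \<open>d \<le> 2 \<alpha> + 2\<close>, and in the case of equality all private neighbours of the two
  ends can be matched at distance two.

  For \<open>\<beta> \<ge> 2\<close> the local graphs have \<open>d\<close> vertices and degree \<open>\<alpha>\<close>, and any two nonadjacent vertices have
  \<open>\<beta> - 1\<close> common neighbours, which form a clique. All twin classes have the same size \<open>s\<close>, and counting in
  the quotient by twins and in its local graphs leaves only the pentagon. Pairs of twins of local graphs make up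
  triples that are symmetric in their vertices, which forces \<open>s = 1\<close>; the graph is locally a pentagon, hence the
  icosahedron.

  For \<open>\<beta> = 1\<close> every vertex lies in exactly two maximal cliques, and the graph is the line graph of the graph of
  its cliques, which is triangle-free, has no quadrangles, and has diameter two by the equality case above: a Moore
  graph. Its degree is 2, 3, 7 or 57, since the trace of an eigenprojection is an integer.

  In a Moore graph of degree 7 the three vertices joining the opposite pairs of a hexagon have a common neighbour,
  because the second largest eigenvalue is 2. Hence a pentagon with a further neighbour of one of its vertices
  extends to a Petersen subgraph. This splits the graph into pentagons and pentagrams as in Robertson's
  construction, where the matchings between them are translations given by orthomorphisms of \<open>\<int>/5\<close>.
\<close>

section \<open>Finite graphs and twins\<close>

text \<open>The bound \<open>d \<le> 2 * Suc \<alpha>\<close> says that a local graph, with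
  \<open>d\<close> vertices and degree \<alpha>, has at most twice as many vertices as a closed
  neighbourhood. Counting edges to nonneighbours then gives \<open>b \<le> \<mu>\<close> in its twin
  quotient, where \<open>b\<close> is the number of private neighbours at an edge, while the local
  graphs of the quotient want \<open>r\<close> large compared with \<mu>. One descent leaves \<mu> =
  1 and a single parameter set on 11 vertices with odd degree 5, which parity excludes. For \<beta>
  = 1 a neighbourhood is a disjoint union of cliques of size \<open>\<alpha> + 1\<close>: at least
  two because the graph is not complete, at most two by the bound. So equality holds in the bound,
  the equality case of the transport argument is available at every edge, and this bounds the
  diameter of the graph of cliques. The curvature is written with \<open>Lim\<close>, which says
  something only if the limit exists. Existence comes from monotonicity of
  \<open>lazy_curvature G p x y / (1 - p)\<close> in \<open>p\<close>; the easy half of Kantorovich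
  duality supplies the bound.\<close>

lemma sum_card_edges_commute:
  assumes "finite A" "finite B"
  shows "(\<Sum>a\<in>A. card {b \<in> B. R a b}) = (\<Sum>b\<in>B. card {a \<in> A. R a b})"
proof -
  have "(\<Sum>a\<in>A. card {b \<in> B. R a b}) = (\<Sum>a\<in>A. \<Sum>b\<in>B. if R a b then 1 else 0)"
    using assms by (intro sum.cong) (auto simp: sum.If_cases Int_def)
  also have "\<dots> = (\<Sum>b\<in>B. \<Sum>a\<in>A. if R a b then 1 else 0)"
    by (rule sum.swap)
  also have "\<dots> = (\<Sum>b\<in>B. card {a \<in> A. R a b})"
    using assms by (intro sum.cong) (auto simp: sum.If_cases Int_def)
  finally show ?thesis .
qed

locale finite_graph =
  fixes V :: "'a set" and E :: "'a \<Rightarrow> 'a \<Rightarrow> bool"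
  assumes fin: "finite V"
    and sym: "E u v \<Longrightarrow> E v u"
    and irrefl: "\<not> E v v"
begin

definition nb :: "'a \<Rightarrow> 'a set" where
  "nb u = {v \<in> V. E u v}"

definition cnb :: "'a \<Rightarrow> 'a set" where
  "cnb u = insert u (nb u)"

lemma E_commute: "E u v \<longleftrightarrow> E v u"
  using sym by blast

lemma in_nb [simp]: "v \<in> nb u \<longleftrightarrow> v \<in> V \<and> E u v"
  by (simp add: nb_def)

lemma in_cnb [simp]: "v \<in> cnb u \<longleftrightarrow> v = u \<or> v \<in> V \<and> E u v"
  by (simp add: cnb_def)

lemma finite_nb [simp]: "finite (nb u)"
  using fin by (simp add: nb_def)

lemma finite_cnb [simp]: "finite (cnb u)"
  by (simp add: cnb_def)

lemma nb_subset: "nb u \<subseteq> V"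
  by auto

lemma card_cnb: "card (cnb u) = Suc (card (nb u))"
  by (simp add: cnb_def irrefl)

lemma handshake: "even (\<Sum>v\<in>V. card (nb v))"
proof -
  \<comment> \<open>Generalised to the induced subgraph on any finite \<open>W\<close>: a new vertex
    then changes the sum by twice its degree.\<close>
  have "even (\<Sum>v\<in>W. card {w \<in> W. E v w})" if "finite W" for W
    using that
  proof (induction W)
    case empty
    show ?case by simp
  next
    case (insert x W)
    have "card {w \<in> insert x W. E v w} = card {w \<in> W. E v w} + (if E v x then 1 else 0)" for v
    proof -
      have "{w \<in> insert x W. E v w} = {w \<in> W. E v w} \<union> (if E v x then {x} else {})"
        by auto
      then show ?thesis
        using insert by (auto simp: card_insert_if)
    qed
    then have "(\<Sum>v\<in>insert x W. card {w \<in> insert x W. E v w})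
        = card {w \<in> W. E x w} + (\<Sum>v\<in>W. card {w \<in> W. E v w} + (if E v x then 1 else 0))"
      using insert by (simp add: irrefl)
    also have "(\<Sum>v\<in>W. card {w \<in> W. E v w} + (if E v x then 1 else 0))
        = (\<Sum>v\<in>W. card {w \<in> W. E v w}) + card {w \<in> W. E x w}"
      using insert by (simp add: sum.distrib sum.If_cases Int_def E_commute)
    finally show ?case
      using insert by simp
  qed
  from this[OF fin] show ?thesis
    by (simp add: nb_def)
qed

end

text \<open>The induced subgraph on the neighbours of a vertex of an amply regular Terwilliger graph with \<open>\<beta> = \<mu> + 1\<close>.\<close>

locale local_terwilliger = finite_graph +
  fixes r \<mu> :: nat
  assumes regular: "u \<in> V \<Longrightarrow> card (nb u) = r"
    and mu: "u \<in> V \<Longrightarrow> v \<in> V \<Longrightarrow> u \<noteq> v \<Longrightarrow> \<not> E u v \<Longrightarrow> card (nb u \<inter> nb v) = \<mu>"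
    and clique: "u \<in> V \<Longrightarrow> v \<in> V \<Longrightarrow> u \<noteq> v \<Longrightarrow> \<not> E u v \<Longrightarrow>
        x \<in> nb u \<inter> nb v \<Longrightarrow> y \<in> nb u \<inter> nb v \<Longrightarrow> x \<noteq> y \<Longrightarrow> E x y"
    and mu_pos: "\<mu> \<ge> 1"
    and noncomplete: "\<exists>u\<in>V. \<exists>v\<in>V. u \<noteq> v \<and> \<not> E u v"
begin

text \<open>Both ends have degree \<open>r\<close> and the same common neighbours, so equally many
  neighbours are left over.\<close>

lemma priv_commute:
  assumes "u \<in> V" "v \<in> V" "E u v"
  shows "card (nb u - cnb v) = card (nb v - cnb u)"
proof -
  have *: "card (nb x) = Suc (card (nb x \<inter> nb y)) + card (nb x - cnb y)"
    if "x \<in> V" "y \<in> V" "E x y" for x y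
  proof -
    have "nb x = insert y (nb x \<inter> nb y) \<union> (nb x - cnb y)"
      using that by auto
    moreover have "card (insert y (nb x \<inter> nb y) \<union> (nb x - cnb y))
        = card (insert y (nb x \<inter> nb y)) + card (nb x - cnb y)"
      by (rule card_Un_disjoint) auto
    ultimately show ?thesis
      by (simp add: irrefl)
  qed
  show ?thesis
    using *[OF assms] *[of v u] assms regular by (simp add: E_commute Int_commute)
qed

text \<open>Double counting the edges between \<open>A\<close> and \<open>B\<close> below with the weight \<open>1 / (\<mu> - |S|)\<close>, where \<open>S\<close>
  is the common trace of both ends on the clique \<open>nb u \<inter> nb v\<close>.\<close>

lemma priv_eq_at_nonadjacent:
  assumes uv: "u \<in> V" "v \<in> V" "u \<noteq> v" "\<not> E u v" and m: "m \<in> nb u \<inter> nb v"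
  shows "card (nb u - cnb m) = card (nb v - cnb m)"
proof -
  define M where "M = nb u \<inter> nb v"
  have finM: "finite M" unfolding M_def by simp
  have cM: "card M = \<mu>" unfolding M_def using mu uv by blast
  \<comment> \<open>\<open>z\<close> and \<open>b\<close> are nonadjacent and have both
    \<open>q\<close> and \<open>w\<close> as common neighbours, which \<open>clique\<close> makes
    adjacent.\<close>
  have trace: "nb z \<inter> M \<subseteq> nb w"
    if "a \<in> V" "b \<in> V" "a \<noteq> b" "\<not> E a b" "nb a \<inter> nb b = M"
      and "z \<in> nb a - M" "w \<in> nb b - M" "E z w" for a b z w
  proof
    fix q assume q: "q \<in> nb z \<inter> M"
    have nzb: "z \<noteq> b" "\<not> E z b" "z \<in> V" "b \<in> V"
      using that by (auto simp: E_commute)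
    have "q \<in> nb z \<inter> nb b" "w \<in> nb z \<inter> nb b"
      using q that by auto
    moreover have "q \<noteq> w" using q that by auto
    ultimately have "E w q" using clique[OF nzb(3,4,1,2)] by (metis)
    then show "q \<in> nb w" using q by auto
  qed
  define A where "A = nb u - cnb m"
  define B where "B = nb v - cnb m"
  have M': "nb v \<inter> nb u = M" unfolding M_def by blast
  have AM: "A \<subseteq> nb u - M" "B \<subseteq> nb v - M"
  proof -
    show "A \<subseteq> nb u - M"
      using clique[OF uv m] by (auto simp: A_def M_def)
    show "B \<subseteq> nb v - M"
      using clique[OF uv m] by (auto simp: B_def M_def)
  qed
  have tr_eq: "nb z \<inter> M = nb w \<inter> M" if "z \<in> nb u - M" "w \<in> nb v - M" "E z w" for z w
  proof -
    have "nb z \<inter> M \<subseteq> nb w" using trace[OF uv _ that] M_def by blast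
    moreover have "nb w \<inter> M \<subseteq> nb z" using trace[of v u w z] uv that M' by (auto simp: E_commute)
    ultimately show ?thesis by blast
  qed
  define f where "f z = real (\<mu> - card (nb z \<inter> M))" for z
  \<comment> \<open>The \<mu> common neighbours of \<open>z\<close> and \<open>b\<close> are the
    trace of \<open>z\<close> on \<open>M\<close> and the neighbours of \<open>z\<close> in
    \<open>nb b - cnb m\<close>. The trace misses \<open>m\<close>, so the second part is nonempty.
    The variables \<open>a\<close>, \<open>b\<close> let the argument serve both sides.\<close>
  have cnt: "real (card {w \<in> nb b - cnb m. E z w}) = f z \<and> f z > 0"
    if ab: "a \<in> V" "b \<in> V" "a \<noteq> b" "\<not> E a b" "nb a \<inter> nb b = M"
      and z: "z \<in> nb a - M" "z \<notin> cnb m" 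
      and tr: "\<And>w. w \<in> nb b - M \<Longrightarrow> E z w \<Longrightarrow> nb z \<inter> M = nb w \<inter> M" for a b z
  proof -
    have mM: "m \<in> M" using m by (simp add: M_def)
    have nzb: "z \<noteq> b" "\<not> E z b" "z \<in> V" "b \<in> V"
      using that by (auto simp: E_commute)
    have c: "card (nb z \<inter> nb b) = \<mu>" using mu nzb by blast
    have "nb z \<inter> nb b = (nb z \<inter> M) \<union> {w \<in> nb b - cnb m. E z w}"
    proof
      show "nb z \<inter> nb b \<subseteq> (nb z \<inter> M) \<union> {w \<in> nb b - cnb m. E z w}"
      proof
        fix w assume w: "w \<in> nb z \<inter> nb b"
        show "w \<in> (nb z \<inter> M) \<union> {w \<in> nb b - cnb m. E z w}"
        proof (cases "w \<in> M")
          case False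
          then have "nb z \<inter> M = nb w \<inter> M" using tr w by auto
          moreover have "m \<notin> nb z" using z by (auto simp: E_commute)
          ultimately have "m \<notin> nb w" using mM by blast
          then have "\<not> E m w" using mM M_def by (auto simp: E_commute)
          then show ?thesis using w False mM by auto
        qed (use w in auto)
      qed
    qed (use ab(5) in auto)
    moreover have "(nb z \<inter> M) \<inter> {w \<in> nb b - cnb m. E z w} = {}"
      using clique[OF uv m] by (auto simp: M_def)
    ultimately have s: "card (nb z \<inter> M) + card {w \<in> nb b - cnb m. E z w} = \<mu>"
      using c finM fin card_Un_disjoint[of "nb z \<inter> M" "{w \<in> nb b - cnb m. E z w}"] by simp
    have "m \<notin> nb z" using z(2) mM nb_subset z(1) E_commute by (metis DiffD1 in_cnb in_nb)
    then have "nb z \<inter> M \<subset> M" using mM by blast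
    then have "card (nb z \<inter> M) < \<mu>"
      using psubset_card_mono[OF finM] cM by simp
    then show ?thesis
      using s by (simp add: f_def)
  qed
  have cntA: "real (card {w \<in> B. E z w}) = f z \<and> f z > 0" if "z \<in> A" for z
    unfolding B_def
  proof (rule cnt[of u v])
    show zu: "z \<in> nb u - M" using AM(1) that by blast
    show "nb z \<inter> M = nb w \<inter> M" if "w \<in> nb v - M" "E z w" for w
      using tr_eq zu that by blast
  qed (use uv that in \<open>auto simp: A_def M_def\<close>)
  have cntB: "real (card {z \<in> A. E z w}) = f w \<and> f w > 0" if "w \<in> B" for w
  proof -
    have "real (card {z \<in> nb u - cnb m. E w z}) = f w \<and> f w > 0"
    proof (rule cnt[of v u])
      show wv: "w \<in> nb v - M" using AM(2) that by blast
      show "nb w \<inter> M = nb z \<inter> M" if "z \<in> nb u - M" "E w z" for z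
        using tr_eq[of z w] that wv sym by blast
      show "\<not> E v u" using uv sym by blast
    qed (use uv that M' in \<open>auto simp: B_def\<close>)
    then show ?thesis by (simp add: A_def E_commute)
  qed
  have finAB: "finite A" "finite B" by (auto simp: A_def B_def)
  have f_eq: "f z = f w" if "z \<in> A" "w \<in> B" "E z w" for z w
  proof -
    have "nb z \<inter> M = nb w \<inter> M" using tr_eq that AM by blast
    then show ?thesis by (simp only: f_def)
  qed
  have "real (card {w \<in> B. E z w}) / f z = 1" if "z \<in> A" for z
    using cntA[OF that] by simp
  then have "(\<Sum>z\<in>A. real (card {w \<in> B. E z w}) / f z) = (\<Sum>z\<in>A. 1)"
    by (intro sum.cong refl) blast
  then have "real (card A) = (\<Sum>z\<in>A. real (card {w \<in> B. E z w}) / f z)"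
    by simp
  also have "\<dots> = (\<Sum>z\<in>A. \<Sum>w\<in>B. if E z w then 1 / f z else 0)"
    using finAB by (intro sum.cong) (auto simp: sum.If_cases Int_def)
  also have "\<dots> = (\<Sum>z\<in>A. \<Sum>w\<in>B. if E z w then 1 / f w else 0)"
    by (intro sum.cong) (auto simp: f_eq)
  also have "\<dots> = (\<Sum>w\<in>B. \<Sum>z\<in>A. if E z w then 1 / f w else 0)"
    by (rule sum.swap)
  also have "\<dots> = (\<Sum>w\<in>B. real (card {z \<in> A. E z w}) / f w)"
    using finAB by (intro sum.cong) (auto simp: sum.If_cases Int_def)
  also have "\<dots> = (\<Sum>w\<in>B. 1)"
  proof (intro sum.cong refl)
    fix w assume "w \<in> B"
    then show "real (card {z \<in> A. E z w}) / f w = 1" using cntB[of w] by simp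
  qed
  also have "\<dots> = real (card B)"
    by simp
  finally show ?thesis by (simp add: A_def B_def)
qed

text \<open>Along edges of the complement of the graph on \<open>nb m\<close> the value agrees, by
  \<open>priv_eq_at_nonadjacent\<close> and \<open>priv_commute\<close>. Two complement edges
  \<open>x x'\<close> and \<open>y y'\<close> with no complement edge between them would make the
  nonadjacent \<open>y\<close>, \<open>y'\<close> common neighbours of the nonadjacent
  \<open>x\<close>, \<open>x'\<close>, against \<open>clique\<close>; so all vertices on complement
  edges are connected there.\<close>

lemma priv_eq_at_vertex:
  assumes m: "m \<in> V" and x: "x \<in> nb m" "nb m - cnb x \<noteq> {}" and y: "y \<in> nb m" "nb m - cnb y \<noteq> {}"
  shows "card (nb m - cnb x) = card (nb m - cnb y)"
proof -
  have nonadj: "card (nb m - cnb p) = card (nb m - cnb q)"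
    if "p \<in> nb m" "q \<in> nb m" "p \<noteq> q" "\<not> E p q" for p q
  proof -
    have "card (nb p - cnb m) = card (nb q - cnb m)"
      by (rule priv_eq_at_nonadjacent) (use that m in \<open>auto simp: E_commute\<close>)
    then show ?thesis
      using priv_commute[of m p] priv_commute[of m q] that m by auto
  qed
  obtain x' where x': "x' \<in> nb m" "x' \<noteq> x" "\<not> E x x'" using x(2) by (metis DiffE ex_in_conv in_cnb in_nb)
  obtain y' where y': "y' \<in> nb m" "y' \<noteq> y" "\<not> E y y'"
    using y(2) by (metis DiffE ex_in_conv in_cnb in_nb)
  have xx': "card (nb m - cnb x) = card (nb m - cnb x')" using nonadj x x' by metis
  have yy': "card (nb m - cnb y) = card (nb m - cnb y')" using nonadj y y' by metis
  show ?thesis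
  proof (cases "x = y \<or> \<not> E x y \<or> \<not> E x y' \<or> \<not> E y x' \<or> \<not> E x' y'")
    case True
    have eq: "card (nb m - cnb p) = card (nb m - cnb q)"
      if "p \<in> nb m" "q \<in> nb m" "\<not> E p q" for p q
      using that nonadj by (cases "p = q") auto
    consider "x = y" | "\<not> E x y" | "\<not> E x y'" | "\<not> E y x'" | "\<not> E x' y'" using True by blast
    then show ?thesis
    proof cases
      case 1
      then show ?thesis by simp
    next
      case 2
      then show ?thesis using eq x(1) y(1) by blast
    next
      case 3
      then show ?thesis using eq[OF x(1) y'(1)] yy' by simp
    next
      case 4
      then show ?thesis using eq[OF y(1) x'(1)] xx' by simp
    next
      case 5
      then show ?thesis using eq[OF x'(1) y'(1)] xx' yy' by simp
    qed
  next
    case False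
    have "y \<noteq> y'" using y' by simp
    have "y \<in> nb x \<inter> nb x'" "y' \<in> nb x \<inter> nb x'"
      using False x x' y y' by (auto simp: E_commute)
    then have "E y y'"
      using clique[of x x' y y'] x x' y' by auto
    then show ?thesis using y' by simp
  qed
qed

lemma has_nonneighbour:
  assumes "u \<in> V"
  shows "\<exists>v\<in>V. v \<noteq> u \<and> \<not> E u v"
proof (rule ccontr)
  assume "\<not> ?thesis"
  then have "nb u = V - {u}" using irrefl by auto
  then have r: "r = card V - 1" using regular[OF assms] fin assms by simp
  obtain a b where ab: "a \<in> V" "b \<in> V" "a \<noteq> b" "\<not> E a b" using noncomplete by blast
  have "nb a \<subseteq> V - {a, b}" using ab irrefl by auto
  then have "card (nb a) \<le> card (V - {a, b})" using fin by (intro card_mono) auto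
  also have "\<dots> = card V - 2" using ab fin by (simp add: card_Diff_subset)
  finally have "card V - 1 \<le> card V - 2" using r regular ab by simp
  moreover have "card V \<ge> card {a, b}" using ab fin by (intro card_mono) auto
  ultimately show False using ab by simp
qed

lemma common_neighbour:
  assumes "u \<in> V" "v \<in> V" "u \<noteq> v" "\<not> E u v"
  obtains x where "x \<in> nb u \<inter> nb v"
proof -
  have "card (nb u \<inter> nb v) > 0" using mu[OF assms] mu_pos by simp
  then have "nb u \<inter> nb v \<noteq> {}" by (metis card.empty less_irrefl)
  then show ?thesis using that by blast
qed

lemma has_nontwin_neighbour:
  assumes "u \<in> V"
  shows "\<exists>x\<in>nb u. nb u - cnb x \<noteq> {}"
proof -
  obtain v where v: "v \<in> V" "v \<noteq> u" "\<not> E u v" using has_nonneighbour[OF assms] by blast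
  obtain x where x: "x \<in> nb u \<inter> nb v" using common_neighbour[of u v] assms v by auto
  have "v \<in> nb x - cnb u" using x v by (auto simp: E_commute)
  then have "card (nb x - cnb u) \<noteq> 0" by (auto simp: card_eq_0_iff simp del: in_nb in_cnb)
  then have "card (nb u - cnb x) \<noteq> 0" using priv_commute[of u x] assms x by auto
  then have "nb u - cnb x \<noteq> {}" by (metis card.empty)
  then show ?thesis using x by blast
qed

lemma twin_iff:
  assumes "u \<in> V" "v \<in> V" "E u v"
  shows "nb u - cnb v = {} \<longleftrightarrow> cnb u = cnb v"
proof
  assume "nb u - cnb v = {}"
  then have "nb u \<subseteq> cnb v" by blast
  then have "cnb u \<subseteq> cnb v" using assms sym by (auto simp: cnb_def)
  moreover have "card (cnb u) = card (cnb v)" using assms regular by (simp add: card_cnb)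
  ultimately show "cnb u = cnb v" by (intro card_subset_eq) auto
next
  assume "cnb u = cnb v"
  then show "nb u - cnb v = {}" by (auto simp del: in_nb simp: cnb_def)
qed

text \<open>The value at a vertex is unique by \<open>has_nontwin_neighbour\<close> and passes along
  edges between non-twins. Nonadjacent vertices have a common neighbour, which is a twin of neither,
  so one value reaches every vertex; a twin of the starting vertex has the same private
  sets.\<close>

lemma priv_constant:
  obtains a where "a \<ge> 1"
    and "\<And>u v. u \<in> V \<Longrightarrow> v \<in> V \<Longrightarrow> E u v \<Longrightarrow> cnb u \<noteq> cnb v \<Longrightarrow> card (nb u - cnb v) = a"
proof -
  define P where "P m a \<longleftrightarrow> (\<forall>x\<in>nb m. nb m - cnb x \<noteq> {} \<longrightarrow> card (nb m - cnb x) = a)" for m a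
  have ex: "\<exists>a\<ge>1. P m a" if m: "m \<in> V" for m
  proof -
    obtain x where x: "x \<in> nb m" "nb m - cnb x \<noteq> {}" using has_nontwin_neighbour[OF m] by blast
    have "card (nb m - cnb x) \<noteq> 0" using x(2) by (metis card_0_eq finite_Diff finite_nb)
    moreover have "P m (card (nb m - cnb x))"
      unfolding P_def using priv_eq_at_vertex[OF m] x by blast
    ultimately show ?thesis by (metis less_one not_le)
  qed
  have uniq: "a = b" if m: "m \<in> V" and "P m a" "P m b" for m a b
    using has_nontwin_neighbour[OF m] that unfolding P_def by metis
  have step: "P m b" if m: "m \<in> V" "P m a" and x: "x \<in> V" "P x b" "E m x" "cnb m \<noteq> cnb x" for m x a b
  proof -
    have ne: "nb m - cnb x \<noteq> {}" "nb x - cnb m \<noteq> {}"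
      using twin_iff[of m x] twin_iff[of x m] m x by (auto simp: E_commute)
    have "card (nb m - cnb x) = a" "card (nb x - cnb m) = b"
      using m x ne unfolding P_def by (auto simp: E_commute simp del: in_cnb)
    then show ?thesis using priv_commute[of m x] m x by simp
  qed
  obtain o' where o: "o' \<in> V" using noncomplete by blast
  obtain a where a: "a \<ge> 1" "P o' a" using ex[OF o] by blast
  have all: "P m a" if m: "m \<in> V" for m
  proof -
    obtain b where b: "b \<ge> 1" "P m b" using ex[OF m] by blast
    show ?thesis
    proof (cases "cnb m = cnb o'")
      case True
      have "nb m - cnb x = nb o' - cnb x" if "x \<in> nb m" "x \<in> nb o'" for x
      proof -
        have "nb m - cnb x = cnb m - cnb x" "nb o' - cnb x = cnb o' - cnb x"
          using that m o by (auto simp: cnb_def E_commute simp del: in_cnb)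
        then show ?thesis using True by simp
      qed
      moreover obtain x where x: "x \<in> nb m" "nb m - cnb x \<noteq> {}"
        using has_nontwin_neighbour[OF m] by blast
      moreover have "x \<in> nb o'"
      proof -
        have "x \<in> cnb o'" using x True[symmetric] by (simp add: cnb_def del: in_cnb)
        moreover have "x \<noteq> o'"
        proof
          assume "x = o'"
          then have "nb m - cnb x = {}" using True by (auto simp: cnb_def simp del: in_cnb)
          then show False using x by simp
        qed
        ultimately show ?thesis by simp
      qed
      ultimately have "a = b" using a b unfolding P_def by metis
      then show ?thesis using b by simp
    next
      case False
      show ?thesis
      proof (cases "E m o'")
        case True
        then show ?thesis using step[of m b o' a] m o a b False by simp
      next
        case nadj: False
        have "m \<noteq> o'" using False by auto
        then obtain x where x: "x \<in> nb m \<inter> nb o'" using common_neighbour[of m o'] m o nadj by auto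
        obtain c where c: "P x c" using ex[of x] x by auto
        have "m \<in> cnb m" "m \<notin> cnb o'" "o' \<in> cnb x" "m \<in> cnb x" "o' \<notin> cnb m"
          using x nadj m o \<open>m \<noteq> o'\<close> by (auto simp: E_commute)
        then have ne: "cnb x \<noteq> cnb o'" "cnb x \<noteq> cnb m" by auto
        have "P x a" using step[of x c o' a] x c a o ne by (auto simp: E_commute)
        then show ?thesis using step[of m b x a] x c b m ne by auto
      qed
    qed
  qed
  show thesis
  proof (rule that)
    show "a \<ge> 1" by (rule a)
    fix u v assume uv: "u \<in> V" "v \<in> V" "E u v" "cnb u \<noteq> cnb v"
    then have "nb u - cnb v \<noteq> {}" using twin_iff by blast
    then show "card (nb u - cnb v) = a" using all[OF uv(1)] uv unfolding P_def by simp
  qed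
qed

definition twins :: "'a \<Rightarrow> 'a set" where
  "twins u = {v \<in> V. cnb v = cnb u}"

text \<open>Double counting of the edges that leave \<open>cnb u\<close>: each vertex outside has
  \<mu> neighbours in \<open>nb u\<close>.\<close>

lemma edges_to_nonneighbours:
  assumes u: "u \<in> V"
  shows "(\<Sum>v\<in>nb u. card (nb v - cnb u)) = (card V - Suc r) * \<mu>"
proof -
  define R where "R = V - cnb u"
  have cR: "card R = card V - Suc r"
    unfolding R_def using u fin regular by (subst card_Diff_subset) (auto simp: card_cnb)
  have "(\<Sum>v\<in>nb u. card (nb v - cnb u)) = (\<Sum>v\<in>nb u. card {w \<in> R. E v w})"
    by (intro sum.cong arg_cong[of _ _ card]) (auto simp: R_def)
  also have "\<dots> = (\<Sum>w\<in>R. card {v \<in> nb u. E v w})"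
    using fin by (intro sum_card_edges_commute) (auto simp: R_def)
  also have "\<dots> = (\<Sum>w\<in>R. \<mu>)"
  proof (intro sum.cong refl)
    fix w assume w: "w \<in> R"
    have "{v \<in> nb u. E v w} = nb u \<inter> nb w" by (auto simp: E_commute)
    then show "card {v \<in> nb u. E v w} = \<mu>" using mu[of u w] w u by (auto simp: R_def)
  qed
  finally show ?thesis using cR by simp
qed

text \<open>In \<open>edges_to_nonneighbours\<close> a twin of \<open>u\<close> contributes 0 and
  any other neighbour the constant of \<open>priv_constant\<close>. The right-hand side does not
  depend on \<open>u\<close>, so neither does the number of twins.\<close>

lemma twins_constant:
  obtains s where "s \<ge> 1" and "\<And>u. u \<in> V \<Longrightarrow> card (twins u) = s"
proof -
  obtain a where a: "a \<ge> 1"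
      "\<And>u v. u \<in> V \<Longrightarrow> v \<in> V \<Longrightarrow> E u v \<Longrightarrow> cnb u \<noteq> cnb v \<Longrightarrow> card (nb u - cnb v) = a"
    using priv_constant by blast
  have tw: "twins u \<subseteq> cnb u" "u \<in> twins u" if "u \<in> V" for u
  proof -
    have "v \<in> cnb v" for v by simp
    then show "twins u \<subseteq> cnb u" unfolding twins_def by (smt (verit) mem_Collect_eq subsetI)
    show "u \<in> twins u" using that by (simp add: twins_def)
  qed
  have fint: "finite (twins u)" for u using fin by (simp add: twins_def)
  have eq: "(Suc r - card (twins u)) * a = (card V - Suc r) * \<mu>" if u: "u \<in> V" for u
  proof -
    have "(\<Sum>v\<in>nb u. card (nb v - cnb u)) = (\<Sum>v\<in>nb u. if v \<in> twins u then 0 else a)"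
    proof (intro sum.cong refl)
      fix v assume v: "v \<in> nb u"
      show "card (nb v - cnb u) = (if v \<in> twins u then 0 else a)"
      proof (cases "v \<in> twins u")
        case True
        then have "nb v - cnb u = {}" using twin_iff[of v u] v u by (auto simp: twins_def E_commute)
        then show ?thesis using True by (metis card.empty)
      next
        case False
        then have "cnb v \<noteq> cnb u" using v by (auto simp: twins_def)
        then show ?thesis using a(2)[of v u] v u False by (auto simp: E_commute)
      qed
    qed
    also have "\<dots> = (\<Sum>v\<in>nb u - twins u. a)"
      by (rule sum.mono_neutral_cong_right) auto
    also have "nb u - twins u = cnb u - twins u"
      using tw[OF u] by (auto simp: cnb_def)
    finally have "(\<Sum>v\<in>nb u. card (nb v - cnb u)) = card (cnb u - twins u) * a" by simp
    moreover have "card (cnb u - twins u) = Suc r - card (twins u)"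
      using tw[OF u] fint regular[OF u] by (simp add: card_Diff_subset card_cnb)
    ultimately show ?thesis using edges_to_nonneighbours[OF u] by simp
  qed
  have le: "card (twins u) \<le> Suc r" "card (twins u) \<ge> 1" if "u \<in> V" for u
  proof -
    show "card (twins u) \<le> Suc r"
      using card_mono[OF finite_cnb tw(1)[OF that]] regular[OF that] by (simp add: card_cnb)
    show "card (twins u) \<ge> 1"
      using tw(2)[OF that] fint by (metis card_0_eq empty_iff less_one not_le)
  qed
  obtain o' where o: "o' \<in> V" using noncomplete by blast
  show thesis
  proof (rule that)
    show "card (twins o') \<ge> 1" by (rule le(2)[OF o])
    fix u assume u: "u \<in> V"
    have "(Suc r - card (twins u)) * a = (Suc r - card (twins o')) * a" using eq u o by simp
    then have "Suc r - card (twins u) = Suc r - card (twins o')" using a(1) by simp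
    then show "card (twins u) = card (twins o')" using le(1)[OF u] le(1)[OF o] by linarith
  qed
qed

end

text \<open>Adjacent twins would have no private neighbours, so \<open>b_pos\<close> excludes them.
  The graphs of this kind arise as quotients by twins.\<close>

locale twin_free_local_terwilliger = local_terwilliger +
  fixes b :: nat
  assumes priv: "u \<in> V \<Longrightarrow> v \<in> V \<Longrightarrow> E u v \<Longrightarrow> card (nb u - cnb v) = b"
    and b_pos: "b \<ge> 1"

section \<open>The quotient by twins\<close>

context local_terwilliger
begin

lemma twins_adjacent:
  assumes "u \<in> V" "v \<in> V" "cnb u = cnb v" "u \<noteq> v"
  shows "E u v"
proof -
  have "v \<in> cnb v" by simp
  then have "v \<in> cnb u" using assms(3) by simp
  then show ?thesis using assms(4) by simp
qed

lemma adjacent_of_twins: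
  assumes V: "u \<in> V" "v \<in> V" "u' \<in> V" "v' \<in> V"
    and tw: "cnb u' = cnb u" "cnb v' = cnb v" and ne: "cnb u \<noteq> cnb v" and E: "E u v"
  shows "E u' v'"
proof -
  have "v \<in> cnb u'" using tw(1) V E by simp
  moreover have "v \<noteq> u'" using tw ne by auto
  ultimately have "E v u'" using sym by simp
  then have "u' \<in> cnb v'" using tw(2) V by simp
  moreover have "u' \<noteq> v'" using tw ne by auto
  ultimately show ?thesis using sym by simp
qed

text \<open>The twin classes of the representatives in \<open>B\<close> partition \<open>B\<close>.
  Applied to closed neighbourhoods, common neighbourhoods and private sets, this divides all
  parameters by \<open>s\<close>.\<close>

lemma card_twin_closed:
  assumes s: "\<And>u. u \<in> V \<Longrightarrow> card (twins u) = s"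
    and X: "X \<subseteq> V" "\<And>v. v \<in> V \<Longrightarrow> \<exists>x\<in>X. cnb x = cnb v" "inj_on cnb X"
    and B: "B \<subseteq> V" "\<And>u v. u \<in> B \<Longrightarrow> v \<in> V \<Longrightarrow> cnb v = cnb u \<Longrightarrow> v \<in> B"
  shows "card B = s * card (B \<inter> X)"
proof -
  have "B = (\<Union>x\<in>B \<inter> X. twins x)"
  proof
    show "B \<subseteq> (\<Union>x\<in>B \<inter> X. twins x)"
    proof
      fix u assume u: "u \<in> B"
      then obtain x where x: "x \<in> X" "cnb x = cnb u" using X(2) B(1) by blast
      then have "x \<in> B" using B(2)[of u x] u X(1) by blast
      then show "u \<in> (\<Union>x\<in>B \<inter> X. twins x)" using x u B(1) by (auto simp: twins_def)
    qed
    show "(\<Union>x\<in>B \<inter> X. twins x) \<subseteq> B" using B(2) by (auto simp: twins_def)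
  qed
  moreover have "card (\<Union>x\<in>B \<inter> X. twins x) = (\<Sum>x\<in>B \<inter> X. card (twins x))"
  proof (rule card_UN_disjoint)
    show "finite (B \<inter> X)" using X(1) fin by (meson finite_Int finite_subset)
    show "\<forall>x\<in>B \<inter> X. finite (twins x)" using fin by (simp add: twins_def)
    show "\<forall>x\<in>B \<inter> X. \<forall>y\<in>B \<inter> X. x \<noteq> y \<longrightarrow> twins x \<inter> twins y = {}"
    proof (intro ballI impI)
      fix x y assume "x \<in> B \<inter> X" "y \<in> B \<inter> X" "x \<noteq> y"
      then have "cnb x \<noteq> cnb y" using X(3) unfolding inj_on_def by blast
      then show "twins x \<inter> twins y = {}" unfolding twins_def by auto
    qed
  qed
  ultimately have "card B = (\<Sum>x\<in>B \<inter> X. card (twins x))" by simp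
  also have "\<dots> = (\<Sum>x\<in>B \<inter> X. s)" using X(1) s by (intro sum.cong) auto
  finally show ?thesis by simp
qed

lemma twin_quotient:
  obtains X s r' \<mu>' b where "X \<subseteq> V" "s \<ge> 1" "twin_free_local_terwilliger X E r' \<mu>' b"
    "card V = s * card X" "Suc r = s * Suc r'" "\<mu> = s * \<mu>'"
    "\<And>u. u \<in> V \<Longrightarrow> card (twins u) = s"
    "\<And>v. v \<in> V \<Longrightarrow> \<exists>x\<in>X. cnb x = cnb v"
proof -
  obtain s where s: "s \<ge> 1" "\<And>u. u \<in> V \<Longrightarrow> card (twins u) = s" using twins_constant by blast
  obtain a where a: "a \<ge> 1"
      "\<And>u v. u \<in> V \<Longrightarrow> v \<in> V \<Longrightarrow> E u v \<Longrightarrow> cnb u \<noteq> cnb v \<Longrightarrow> card (nb u - cnb v) = a"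
    using priv_constant by blast
  \<comment> \<open>One representative for each closed neighbourhood: the quotient is realised as an
    induced subgraph, so that adjacency stays \<open>E\<close>.\<close>
  define X where "X = inv_into V cnb ` cnb ` V"
  have XV: "X \<subseteq> V" unfolding X_def by (auto intro: inv_into_into)
  have cov: "\<exists>x\<in>X. cnb x = cnb v" if "v \<in> V" for v
    unfolding X_def using that by (metis f_inv_into_f imageI)
  have inj: "inj_on cnb X"
    unfolding X_def by (auto intro!: inj_onI simp: f_inv_into_f)
  interpret X: finite_graph X E
    by unfold_locales (use XV fin finite_subset sym irrefl in auto)
  have Xnb: "X.nb u = nb u \<inter> X" for u using XV by auto
  note cc = card_twin_closed[OF s(2) XV cov inj]
  have tw_nb: "v \<in> cnb w" if "u \<in> cnb w" "u \<in> V" "v \<in> V" "w \<in> V" "cnb v = cnb u" for u v w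
  proof -
    have "w \<in> cnb u" using that(1,4) sym by auto
    then have "w \<in> cnb v" using that(5) by simp
    then show ?thesis using that(3) sym by auto
  qed
  have cV: "card V = s * card X"
    using cc[of V] XV by (simp add: Int_absorb1)
  have cr: "Suc r = s * Suc (card (nb u \<inter> X))" if u: "u \<in> X" for u
  proof -
    have "card (cnb u) = s * card (cnb u \<inter> X)"
    proof (rule cc)
      show "cnb u \<subseteq> V" using u XV by auto
      show "v \<in> cnb u" if "w \<in> cnb u" "v \<in> V" "cnb v = cnb w" for w v
        using tw_nb[of w u v] that u XV by auto
    qed
    moreover have "cnb u \<inter> X = insert u (nb u \<inter> X)" using u by (auto simp: cnb_def)
    moreover have "card (cnb u) = Suc r" using u XV regular by (auto simp: card_cnb)
    moreover have "card (insert u (nb u \<inter> X)) = Suc (card (nb u \<inter> X))" by (simp add: irrefl)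
    ultimately show ?thesis by simp
  qed
  have cm: "\<mu> = s * card (nb u \<inter> nb v \<inter> X)" if uv: "u \<in> X" "v \<in> X" "u \<noteq> v" "\<not> E u v" for u v
  proof -
    have "card (nb u \<inter> nb v) = s * card (nb u \<inter> nb v \<inter> X)"
    proof (rule cc)
      show "nb u \<inter> nb v \<subseteq> V" by auto
      fix x y assume x: "x \<in> nb u \<inter> nb v" and y: "y \<in> V" "cnb y = cnb x"
      have "y \<in> cnb u" "y \<in> cnb v" using tw_nb[of x u y] tw_nb[of x v y] x y uv XV by auto
      moreover have "y \<noteq> u" "y \<noteq> v"
      proof -
        have "u \<in> cnb x" "v \<in> cnb x" using x uv XV sym by auto
        then have "u \<in> cnb y" "v \<in> cnb y" using y by auto
        then show "y \<noteq> u" "y \<noteq> v" using uv sym by auto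
      qed
      ultimately show "y \<in> nb u \<inter> nb v" by auto
    qed
    then show ?thesis using mu[of u v] uv XV by auto
  qed
  have ca: "a = s * card ((nb u - cnb v) \<inter> X)" if uv: "u \<in> X" "v \<in> X" "E u v" for u v
  proof -
    have ne: "cnb u \<noteq> cnb v" using inj uv irrefl unfolding inj_on_def by metis
    have "card (nb u - cnb v) = s * card ((nb u - cnb v) \<inter> X)"
    proof (rule cc)
      show "nb u - cnb v \<subseteq> V" by auto
      fix x y assume x: "x \<in> nb u - cnb v" and y: "y \<in> V" "cnb y = cnb x"
      have "y \<notin> cnb v" using tw_nb[of y v x] x y uv XV by auto
      moreover have "y \<in> cnb u" using tw_nb[of x u y] x y uv XV by auto
      moreover have "y \<noteq> u" using calculation(1) uv XV sym by auto
      ultimately show "y \<in> nb u - cnb v" by auto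
    qed
    then show ?thesis using a(2)[of u v] uv XV ne by auto
  qed
  obtain u0 where u0: "u0 \<in> X" using cov noncomplete by blast
  obtain p q where pq: "p \<in> V" "q \<in> V" "p \<noteq> q" "\<not> E p q" using noncomplete by blast
  obtain p' where p': "p' \<in> X" "cnb p' = cnb p" using cov pq by blast
  obtain q' where q': "q' \<in> X" "cnb q' = cnb q" using cov pq by blast
  have pq': "p' \<noteq> q'" "\<not> E p' q'"
  proof -
    have ne: "cnb p \<noteq> cnb q" using twins_adjacent pq by blast
    then show "p' \<noteq> q'" using p' q' by auto
    show "\<not> E p' q'"
      using adjacent_of_twins[of p' q' p q] pq p' q' XV ne by auto
  qed
  define r' where "r' = card (nb u0 \<inter> X)"
  define \<mu>' where "\<mu>' = card (nb p' \<inter> nb q' \<inter> X)"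
  define b where "b = a div s"
  have tg: "twin_free_local_terwilliger X E r' \<mu>' b"
  proof unfold_locales
    show "card (X.nb u) = r'" if "u \<in> X" for u
      using cr[OF that] cr[OF u0] s(1) by (simp add: Xnb r'_def)
    show "card (X.nb u \<inter> X.nb v) = \<mu>'" if "u \<in> X" "v \<in> X" "u \<noteq> v" "\<not> E u v" for u v
    proof -
      have "X.nb u \<inter> X.nb v = nb u \<inter> nb v \<inter> X" using Xnb by auto
      then show ?thesis using cm[OF that] cm[OF p'(1) q'(1) pq'] s(1) by (simp add: \<mu>'_def)
    qed
    show "E x y" if "u \<in> X" "v \<in> X" "u \<noteq> v" "\<not> E u v" "x \<in> X.nb u \<inter> X.nb v"
        "y \<in> X.nb u \<inter> X.nb v" "x \<noteq> y" for u v x y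
      using clique[of u v x y] that XV by auto
    show "1 \<le> \<mu>'"
      using cm[OF p'(1) q'(1) pq'] mu_pos by (auto simp: \<mu>'_def intro: Suc_leI)
    show "\<exists>u\<in>X. \<exists>v\<in>X. u \<noteq> v \<and> \<not> E u v" using p' q' pq' by blast
    show "card (X.nb u - X.cnb v) = b" if "u \<in> X" "v \<in> X" "E u v" for u v
    proof -
      have "X.nb u - X.cnb v = (nb u - cnb v) \<inter> X" using that XV by auto
      then show ?thesis using ca[OF that] s(1) by (simp add: b_def)
    qed
    show "1 \<le> b"
    proof -
      obtain x where "x \<in> nb p' \<inter> nb q' \<inter> X"
        using cm[OF p'(1) q'(1) pq'] mu_pos by (metis card.empty ex_in_conv mult_0_right not_one_le_zero)
      then have "a = s * card ((nb p' - cnb x) \<inter> X)" using ca p' by auto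
      then show ?thesis using a(1) s(1) by (auto simp: b_def intro: Suc_leI)
    qed
  qed
  show thesis
    by (rule that[OF XV s(1) tg cV _ _ s(2) cov])
      (use cr[OF u0] cm[OF p'(1) q'(1) pq'] in \<open>auto simp: r'_def \<mu>'_def\<close>)
qed

lemma twin_quotient_params:
  "\<exists>X s r' \<mu>' b. s \<ge> 1 \<and> twin_free_local_terwilliger X E r' \<mu>' b \<and> Suc r = s * Suc r' \<and> \<mu> = s * \<mu>'"
  by (rule twin_quotient) blast

end

section \<open>Inequalities between the parameters of a twin-free graph\<close>

context twin_free_local_terwilliger
begin

lemma nonneighbour_edges: "u \<in> V \<Longrightarrow> r * b = (card V - Suc r) * \<mu>"
proof -
  assume u: "u \<in> V"
  have "(\<Sum>v\<in>nb u. card (nb v - cnb u)) = (\<Sum>v\<in>nb u. b)"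
    by (intro sum.cong refl priv) (use u sym in auto)
  then show ?thesis using edges_to_nonneighbours[OF u] regular[OF u] by simp
qed

text \<open>The \<mu> common neighbours of nonadjacent \<open>u\<close>, \<open>v\<close> form a
  clique in \<open>nb u\<close>. One of them has a nonneighbour in \<open>nb u\<close>, which
  therefore lies outside the clique.\<close>

lemma degree_ge: "Suc r \<ge> \<mu> + 2"
proof -
  obtain u v where uv: "u \<in> V" "v \<in> V" "u \<noteq> v" "\<not> E u v" using noncomplete by blast
  obtain x where x: "x \<in> nb u \<inter> nb v" using common_neighbour uv by blast
  have "card (nb u - cnb x) = b" using priv[of u x] x uv by auto
  then have "nb u - cnb x \<noteq> {}" using b_pos by (metis card.empty not_one_le_zero)
  then obtain w where w: "w \<in> nb u" "w \<notin> cnb x" by blast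
  have "w \<notin> nb u \<inter> nb v" using clique[OF uv x] w by auto
  then have "card (insert w (nb u \<inter> nb v)) = Suc \<mu>" using mu[OF uv] by simp
  moreover have "insert w (nb u \<inter> nb v) \<subseteq> nb u" using w by blast
  ultimately have "Suc \<mu> \<le> card (nb u)" using card_mono[OF finite_nb] by metis
  then show ?thesis using regular uv by simp
qed

lemma nonadjacent_in_local:
  assumes "u \<in> V"
  obtains v p where "v \<in> nb u" "p \<in> nb u" "v \<noteq> p" "\<not> E v p"
proof -
  have "r \<ge> 1" using degree_ge by simp
  then have "nb u \<noteq> {}" using regular[OF assms] by (metis card.empty not_one_le_zero)
  then obtain v where v: "v \<in> nb u" by blast
  then have "card (nb u - cnb v) = b" using priv assms by simp
  then have "nb u - cnb v \<noteq> {}" using b_pos by (metis card.empty not_one_le_zero)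
  then obtain p where "p \<in> nb u" "p \<notin> cnb v" by blast
  then show ?thesis using that v by auto
qed

lemma card_local_common:
  assumes u: "u \<in> V" and v: "v \<in> nb u" "p \<in> nb u" "v \<noteq> p" "\<not> E v p"
  shows "card (nb u \<inter> nb v \<inter> nb p) = \<mu> - 1"
proof -
  have uvp: "u \<in> nb v \<inter> nb p" using u v sym by auto
  have "nb u \<inter> nb v \<inter> nb p = nb v \<inter> nb p - {u}"
    using clique[of v p u] uvp v irrefl by auto
  then show ?thesis using mu[of v p] v uvp by simp
qed

text \<open>For nonadjacent \<open>v\<close>, \<open>p\<close> in \<open>nb u\<close>, each vertex
  of \<open>nb u\<close> lies outside \<open>cnb v\<close>, outside \<open>cnb p\<close>, or is
  adjacent to both.\<close>

lemma degree_le: "Suc r \<le> \<mu> + 2 * b"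
proof -
  obtain u where u: "u \<in> V" using noncomplete by blast
  obtain v p where vp: "v \<in> nb u" "p \<in> nb u" "v \<noteq> p" "\<not> E v p"
    using nonadjacent_in_local[OF u] by blast
  have "nb u \<subseteq> (nb u - cnb v) \<union> (nb u - cnb p) \<union> (nb u \<inter> nb v \<inter> nb p)"
    using vp sym by auto
  then have "card (nb u) \<le> card ((nb u - cnb v) \<union> (nb u - cnb p) \<union> (nb u \<inter> nb v \<inter> nb p))"
    by (intro card_mono) auto
  also have "\<dots> \<le> card (nb u - cnb v) + card (nb u - cnb p) + card (nb u \<inter> nb v \<inter> nb p)"
    by (meson card_Un_le add_right_mono order_trans)
  also have "\<dots> = 2 * b + (\<mu> - 1)"
    using priv[of u v] priv[of u p] u vp card_local_common[OF u vp] by simp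
  finally show ?thesis using regular[OF u] mu_pos by simp
qed

text \<open>Double counting of nonadjacent pairs between the common neighbours \<open>C\<close> of
  \<open>v\<close>, \<open>p\<close> in \<open>nb u\<close> and the rest \<open>W\<close>. All
  \<open>b\<close> nonneighbours of a vertex of \<open>C\<close> lie in \<open>W\<close>, while a
  vertex of \<open>W\<close> spends one of its \<open>b\<close> nonneighbours on \<open>v\<close> or
  \<open>p\<close>, which leaves \<open>b - 1\<close> for \<open>C\<close>.\<close>

lemma local_nonedges:
  "(\<mu> - 1) * b \<le> (Suc r - \<mu> - 2) * (b - 1)"
proof -
  obtain u where u: "u \<in> V" using noncomplete by blast
  obtain v p where vp: "v \<in> nb u" "p \<in> nb u" "v \<noteq> p" "\<not> E v p"
    using nonadjacent_in_local[OF u] by blast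
  define C where "C = nb u \<inter> nb v \<inter> nb p"
  define W where "W = nb u - C - {v, p}"
  have C: "C \<subseteq> nb u" "card C = \<mu> - 1" "finite C"
    using card_local_common[OF u vp] by (auto simp: C_def)
  have vpC: "v \<notin> C" "p \<notin> C" by (auto simp: C_def irrefl)
  have Wc: "card W = Suc r - \<mu> - 2"
  proof -
    have "card (nb u - C) = r - (\<mu> - 1)"
      using C regular[OF u] by (simp add: card_Diff_subset)
    moreover have "card W = card (nb u - C) - 2"
      unfolding W_def using vp vpC by (subst card_Diff_subset) auto
    ultimately show ?thesis using mu_pos by simp
  qed
  have "(\<mu> - 1) * b = (\<Sum>c\<in>C. card {z \<in> W. \<not> E c z})"
  proof -
    have "card {z \<in> W. \<not> E c z} = b" if c: "c \<in> C" for c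
    proof -
      have "{z \<in> W. \<not> E c z} = nb u - cnb c"
      proof -
        have "E c z" if "z \<in> C" "z \<noteq> c" for z
          using clique[of v p c z] c that vp by (auto simp: C_def)
        moreover have "E c v" "E c p" using c sym by (auto simp: C_def)
        ultimately show ?thesis using c by (auto simp: W_def)
      qed
      then show ?thesis using priv[of u c] u c C(1) by auto
    qed
    then show ?thesis using C by simp
  qed
  also have "\<dots> = (\<Sum>z\<in>W. card {c \<in> C. \<not> E c z})"
    by (rule sum_card_edges_commute) (auto simp: C W_def)
  also have "\<dots> \<le> (\<Sum>z\<in>W. b - 1)"
  proof (rule sum_mono)
    fix z assume z: "z \<in> W"
    obtain t where t: "t \<in> {v, p}" "\<not> E z t"
      using z sym by (auto simp: W_def C_def)
    have tz: "t \<in> nb u - cnb z" "t \<notin> C" using t vp z vpC by (auto simp: W_def)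
    have "{c \<in> C. \<not> E c z} \<subseteq> nb u - cnb z - {t}"
      using z C(1) sym t tz by (auto simp: W_def)
    then have "card {c \<in> C. \<not> E c z} \<le> card (nb u - cnb z - {t})"
      by (intro card_mono) auto
    also have "\<dots> = b - 1"
    proof -
      have "card (nb u - cnb z) = b" using priv[of u z] u z by (auto simp: W_def)
      then show ?thesis using tz(1) by (simp del: Diff_iff)
    qed
    finally show "card {c \<in> C. \<not> E c z} \<le> b - 1" .
  qed
  finally show ?thesis using Wc by simp
qed

text \<open>Otherwise the set \<open>W\<close> of the preceding proof would be no larger than
  \<open>C\<close>, which the count forbids.\<close>

lemma degree_ge_strong:
  assumes "\<mu> \<ge> 2"
  shows "Suc r \<ge> 2 * \<mu> + 2"
proof (rule ccontr)
  assume "\<not> ?thesis"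
  then have "Suc r - \<mu> - 2 \<le> \<mu> - 1" by simp
  then have "(\<mu> - 1) * b \<le> (\<mu> - 1) * (b - 1)"
    using local_nonedges by (meson le_trans mult_le_mono1)
  then show False using assms b_pos by auto
qed

text \<open>This is the descent. The vertex \<open>u\<close> is itself a common neighbour of any two
  vertices of \<open>nb u\<close>, so \<mu> drops by one.\<close>

lemma local_graph:
  assumes "\<mu> \<ge> 2" and u: "u \<in> V"
  shows "local_terwilliger (nb u) E (r - 1 - b) (\<mu> - 1)"
proof -
  interpret L: finite_graph "nb u" E by unfold_locales (auto simp: sym irrefl)
  have Lnb: "L.nb v = nb u \<inter> nb v" for v by auto
  show ?thesis
  proof unfold_locales
    fix v assume v: "v \<in> nb u"
    have "nb u = insert v (nb u \<inter> nb v) \<union> (nb u - cnb v)" using v by auto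
    moreover have "card (insert v (nb u \<inter> nb v) \<union> (nb u - cnb v))
        = card (insert v (nb u \<inter> nb v)) + card (nb u - cnb v)"
      by (rule card_Un_disjoint) auto
    moreover have "card (insert v (nb u \<inter> nb v)) = Suc (card (nb u \<inter> nb v))" by (simp add: irrefl)
    ultimately have "card (nb u) = Suc (card (nb u \<inter> nb v)) + card (nb u - cnb v)" by metis
    then show "card (L.nb v) = r - 1 - b"
      using priv[of u v] regular[OF u] u v by (simp add: Lnb)
  next
    fix v p assume "v \<in> nb u" "p \<in> nb u" "v \<noteq> p" "\<not> E v p"
    then show "card (L.nb v \<inter> L.nb p) = \<mu> - 1"
      using card_local_common[OF u, of v p] by (simp add: Lnb Int_ac)
  next
    fix v p x y assume "v \<in> nb u" "p \<in> nb u" "v \<noteq> p" "\<not> E v p"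
      "x \<in> L.nb v \<inter> L.nb p" "y \<in> L.nb v \<inter> L.nb p" "x \<noteq> y"
    then show "E x y" using clique[of v p x y] by auto
  next
    show "1 \<le> \<mu> - 1" using assms by simp
    show "\<exists>v\<in>nb u. \<exists>w\<in>nb u. v \<noteq> w \<and> \<not> E v w" using nonadjacent_in_local[OF u] by metis
  qed
qed

text \<open>The size bound gives \<open>b \<le> \<mu>\<close>, hence
  \<open>r - b \<le> 2 * \<mu> - 1\<close>. For \<open>\<mu> \<ge> 2\<close> the twin quotient of a
  local graph satisfies \<open>s * \<mu>' = \<mu> - 1\<close> and \<open>s * Suc r' = r - b\<close>,
  and its own degree bounds contradict this unless \<mu>' = 1 and \<mu> = 2.\<close>

lemma small_is_pentagon:
  assumes small: "card V \<le> 2 * Suc r"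
  shows "\<mu> = 1 \<and> r = 2 \<and> b = 1 \<and> card V = 5"
proof -
  obtain u where u: "u \<in> V" using noncomplete by blast
  have eq: "r * b = (card V - Suc r) * \<mu>" using nonneighbour_edges[OF u] .
  also have "\<dots> \<le> Suc r * \<mu>" using small by (intro mult_le_mono1) simp
  finally have le: "r * b \<le> Suc r * \<mu>" .
  have bm: "b \<le> \<mu>"
  proof (rule ccontr)
    assume "\<not> b \<le> \<mu>"
    then have "r * Suc \<mu> \<le> r * b" by (intro mult_le_mono2) simp
    then have "r * Suc \<mu> \<le> Suc r * \<mu>" using le by linarith
    then have "r \<le> \<mu>" by simp
    then show False using degree_ge by simp
  qed
  show ?thesis
  proof (cases "\<mu> \<ge> 2")
    case False
    then have "\<mu> = 1" "b = 1" using bm b_pos mu_pos by auto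
    moreover have "r = 2" using degree_le degree_ge calculation by simp
    ultimately show ?thesis using eq by simp
  next
    case True
    interpret L: local_terwilliger "nb u" E "r - 1 - b" "\<mu> - 1" by (rule local_graph[OF True u])
    obtain X s r' \<mu>' b' where X: "s \<ge> 1" "twin_free_local_terwilliger X E r' \<mu>' b'"
        "Suc (r - 1 - b) = s * Suc r'" "\<mu> - 1 = s * \<mu>'"
      using L.twin_quotient_params by blast
    interpret X: twin_free_local_terwilliger X E r' \<mu>' b' by (rule X(2))
    have r: "Suc (r - 1 - b) = r - b"
    proof -
      obtain v p where "v \<in> nb u" "p \<in> nb u" "v \<noteq> p" "\<not> E v p"
        using nonadjacent_in_local[OF u] by blast
      then have "insert v (nb u - cnb v) \<subseteq> nb u" "card (insert v (nb u - cnb v)) = Suc b"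
        using priv[of u v] u by auto
      then have "Suc b \<le> r" using card_mono[OF finite_nb] regular[OF u] by metis
      then show ?thesis by simp
    qed
    have "\<mu>' = 1"
    proof (rule ccontr)
      assume "\<mu>' \<noteq> 1"
      then have "\<mu>' \<ge> 2" using X.mu_pos by simp
      then have "s * (2 * \<mu>' + 2) \<le> s * Suc r'" using X.degree_ge_strong by (intro mult_le_mono2)
      then have "2 * (s * \<mu>') + 2 * s \<le> s * Suc r'" by (simp add: algebra_simps)
      then have "2 * (\<mu> - 1) + 2 * s \<le> r - b" using X(3,4) r by simp
      then show False using X(1) degree_le bm True by linarith
    qed
    then have s: "s = \<mu> - 1" using X(4) by simp
    have "s * (\<mu>' + 2) \<le> s * Suc r'" using X.degree_ge by (intro mult_le_mono2)
    then have "s * 3 \<le> r - b" using X(3) r \<open>\<mu>' = 1\<close> by simp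
    then have "3 * (\<mu> - 1) \<le> r - b" using s by simp
    \<comment> \<open>From \<open>3 * (\<mu> - 1) \<le> r - b \<le> \<mu> + b - 1\<close> and
      \<open>b \<le> \<mu>\<close>. The surviving graph would be 5-regular on 11 vertices.\<close>
    then have "\<mu> = 2" "b = 2" "r = 5" using degree_le bm True by linarith+
    then have "card V = 11" using eq by simp
    moreover have "(\<Sum>v\<in>V. card (nb v)) = (\<Sum>v\<in>V. 5)"
      using regular \<open>r = 5\<close> by (intro sum.cong) auto
    ultimately show ?thesis using handshake by simp
  qed
qed

end

section \<open>Small local graphs are blown-up pentagons\<close>

context local_terwilliger
begin

text \<open>The quotient by twins inherits the size bound, so it is a pentagon, each vertex of which
  has been replaced by a clique of \<mu> twins. A triangle of pairwise non-twins would project to a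
  triangle of the pentagon.\<close>

lemma small_is_blown_up_pentagon:
  assumes "card V \<le> 2 * Suc r"
  shows "card V = 5 * \<mu>" "Suc r = 3 * \<mu>" "\<And>u. u \<in> V \<Longrightarrow> card (twins u) = \<mu>"
    "\<And>u v w. u \<in> V \<Longrightarrow> v \<in> V \<Longrightarrow> w \<in> V \<Longrightarrow> E u v \<Longrightarrow> E v w \<Longrightarrow> E u w \<Longrightarrow>
       cnb u = cnb v \<or> cnb v = cnb w \<or> cnb u = cnb w"
proof -
  obtain X s r' \<mu>' b where X: "X \<subseteq> V" "s \<ge> 1" "twin_free_local_terwilliger X E r' \<mu>' b"
      "card V = s * card X" "Suc r = s * Suc r'" "\<mu> = s * \<mu>'"
      "\<And>u. u \<in> V \<Longrightarrow> card (twins u) = s"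
      "\<And>v. v \<in> V \<Longrightarrow> \<exists>x\<in>X. cnb x = cnb v"
    using twin_quotient by blast
  interpret X: twin_free_local_terwilliger X E r' \<mu>' b by (rule X(3))
  have "s * card X \<le> s * (2 * Suc r')" using assms X(4,5) by simp
  then have "card X \<le> 2 * Suc r'" using X(2) by (metis mult_le_cancel1 not_one_le_zero neq0_conv)
  then have p: "\<mu>' = 1" "r' = 2" "b = 1" "card X = 5" using X.small_is_pentagon by auto
  show "card V = 5 * \<mu>" "Suc r = 3 * \<mu>" "\<And>u. u \<in> V \<Longrightarrow> card (twins u) = \<mu>"
    using X p by auto
  fix u v w assume V: "u \<in> V" "v \<in> V" "w \<in> V" and E: "E u v" "E v w" "E u w"
  show "cnb u = cnb v \<or> cnb v = cnb w \<or> cnb u = cnb w"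
  proof (rule ccontr)
    assume ne: "\<not> ?thesis"
    obtain u' where u': "u' \<in> X" "cnb u' = cnb u" using X(8) V by blast
    obtain v' where v': "v' \<in> X" "cnb v' = cnb v" using X(8) V by blast
    obtain w' where w': "w' \<in> X" "cnb w' = cnb w" using X(8) V by blast
    have E': "E u' v'" "E v' w'" "E u' w'"
      using adjacent_of_twins[of u v u' v'] adjacent_of_twins[of v w v' w']
        adjacent_of_twins[of u w u' w'] V E ne u' v' w' X(1) by auto
    have d: "v' \<noteq> w'" using ne v' w' by auto
    have "{v', w'} \<subseteq> X.nb u'" using E' v' w' by auto
    moreover have "card (X.nb u') = 2" using X.regular u' p by simp
    ultimately have "X.nb u' = {v', w'}" using d card_subset_eq[of "X.nb u'" "{v', w'}"] by simp
    \<comment> \<open>The only neighbours of \<open>u'\<close> are \<open>v'\<close> and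
      \<open>w'\<close>, both in the closed neighbourhood of \<open>v'\<close>, whereas
      \<open>b = 1\<close> asks for a private neighbour.\<close>
    then have "X.nb u' - X.cnb v' = {}" using E' w' by auto
    then have "card (X.nb u' - X.cnb v') = 0" by (simp only: card.empty)
    then show False using X.priv[of u' v'] u' v' E' p by simp
  qed
qed

end

section \<open>Amply regular Terwilliger graphs\<close>

text \<open>Connectedness is expressed by the absence of proper nonempty subsets closed under adjacency.\<close>

locale terwilliger_graph = finite_graph +
  fixes d \<alpha> \<beta> :: nat
  assumes deg: "u \<in> V \<Longrightarrow> card (nb u) = d"
    and alpha: "u \<in> V \<Longrightarrow> v \<in> V \<Longrightarrow> E u v \<Longrightarrow> card (nb u \<inter> nb v) = \<alpha>"
    and beta: "u \<in> V \<Longrightarrow> v \<in> V \<Longrightarrow> u \<noteq> v \<Longrightarrow> \<not> E u v \<Longrightarrow> nb u \<inter> nb v \<noteq> {} \<Longrightarrow>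
        card (nb u \<inter> nb v) = \<beta>"
    and terw: "u \<in> V \<Longrightarrow> v \<in> V \<Longrightarrow> u \<noteq> v \<Longrightarrow> \<not> E u v \<Longrightarrow>
        x \<in> nb u \<inter> nb v \<Longrightarrow> y \<in> nb u \<inter> nb v \<Longrightarrow> x \<noteq> y \<Longrightarrow> E x y"
    and connected: "S \<subseteq> V \<Longrightarrow> S \<noteq> {} \<Longrightarrow> (\<And>u v. u \<in> S \<Longrightarrow> v \<in> nb u \<Longrightarrow> v \<in> S) \<Longrightarrow> S = V"
    and not_complete: "\<exists>u\<in>V. \<exists>v\<in>V. u \<noteq> v \<and> \<not> E u v"
begin

lemma card_nb_split:
  assumes "u \<in> V" "v \<in> V" "E u v"
  shows "d = Suc \<alpha> + card (nb u - cnb v)"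
proof -
  have "nb u = insert v (nb u \<inter> nb v) \<union> (nb u - cnb v)" using assms by auto
  moreover have "card (insert v (nb u \<inter> nb v) \<union> (nb u - cnb v))
      = card (insert v (nb u \<inter> nb v)) + card (nb u - cnb v)"
    by (rule card_Un_disjoint) auto
  moreover have "card (insert v (nb u \<inter> nb v)) = Suc (card (nb u \<inter> nb v))" by (simp add: irrefl)
  ultimately have "card (nb u) = Suc (card (nb u \<inter> nb v)) + card (nb u - cnb v)" by metis
  then show ?thesis using deg alpha assms by simp
qed

lemma nb_nonempty:
  assumes "u \<in> V"
  shows "nb u \<noteq> {}"
proof
  assume "nb u = {}"
  then have "{u} = V" using connected[of "{u}"] assms by auto
  then show False using not_complete by auto
qed

text \<open>Without private neighbours at edges a closed neighbourhood is closed under adjacency,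
  hence all of \<open>V\<close>, which fails for a vertex with a nonneighbour.\<close>

lemma alpha_less: "Suc \<alpha> < d"
proof (rule ccontr)
  assume le: "\<not> Suc \<alpha> < d"
  have cl: "nb u - cnb v = {}" if "u \<in> V" "v \<in> V" "E u v" for u v
    using card_nb_split[OF that] le by (metis card_0_eq finite_Diff finite_nb less_add_same_cancel1 neq0_conv)
  obtain u v where uv: "u \<in> V" "v \<in> V" "u \<noteq> v" "\<not> E u v" using not_complete by blast
  have "cnb u = V"
  proof (rule connected)
    fix x y assume x: "x \<in> cnb u" and y: "y \<in> nb x"
    show "y \<in> cnb u"
    proof (cases "x = u")
      case False
      then have "nb x - cnb u = {}" using cl[of x u] x uv sym by auto
      then show ?thesis using y by blast
    qed (use y in auto)
  qed (use uv in auto)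
  then have "v \<in> cnb u" using uv by simp
  then show False using uv by auto
qed

text \<open>\<open>x\<close> is a common neighbour of any two of its neighbours and lies outside
  \<open>nb x\<close>, which turns \<beta> into \<open>\<beta> - 1\<close>.\<close>

lemma local_graph:
  assumes x: "x \<in> V" and b: "\<beta> \<ge> 2"
  shows "local_terwilliger (nb x) E \<alpha> (\<beta> - 1)"
proof -
  interpret L: finite_graph "nb x" E by unfold_locales (auto simp: sym irrefl)
  have Lnb: "L.nb v = nb x \<inter> nb v" for v by auto
  show ?thesis
  proof unfold_locales
    fix v assume "v \<in> nb x"
    then show "card (L.nb v) = \<alpha>" using alpha[of x v] x by (simp add: Lnb)
  next
    fix v p assume vp: "v \<in> nb x" "p \<in> nb x" "v \<noteq> p" "\<not> E v p"
    have xvp: "x \<in> nb v \<inter> nb p" using x vp sym by auto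
    have "L.nb v \<inter> L.nb p = nb v \<inter> nb p - {x}"
      using terw[of v p x] xvp vp irrefl by (auto simp: Lnb)
    moreover have "card (nb v \<inter> nb p) = \<beta>" using beta[of v p] vp xvp nb_subset by (metis empty_iff subsetD)
    ultimately show "card (L.nb v \<inter> L.nb p) = \<beta> - 1" using xvp by simp
  next
    fix v p a c assume "v \<in> nb x" "p \<in> nb x" "v \<noteq> p" "\<not> E v p"
      "a \<in> L.nb v \<inter> L.nb p" "c \<in> L.nb v \<inter> L.nb p" "a \<noteq> c"
    then show "E a c" using terw[of v p a c] by auto
  next
    show "1 \<le> \<beta> - 1" using b by simp
    obtain v where v: "v \<in> nb x" using nb_nonempty[OF x] by blast
    then have "d = Suc \<alpha> + card (nb x - cnb v)" using card_nb_split[of x v] x by simp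
    then have "card (nb x - cnb v) \<noteq> 0" using alpha_less by linarith
    then have "nb x - cnb v \<noteq> {}" by (metis card.empty)
    then obtain p where "p \<in> nb x" "p \<notin> cnb v" by blast
    then show "\<exists>v\<in>nb x. \<exists>w\<in>nb x. v \<noteq> w \<and> \<not> E v w"
      using v by (intro bexI[of _ v] bexI[of _ p]) auto
  qed
qed

text \<open>Two neighbours of \<open>x\<close> are twins in the local graph at \<open>x\<close> iff they form a special triple with \<open>x\<close>,
  and that notion is symmetric in the three vertices.\<close>

definition special :: "'a \<Rightarrow> 'a \<Rightarrow> 'a \<Rightarrow> bool" where
  "special x y z \<longleftrightarrow> E x y \<and> E y z \<and> E x z \<and> Suc (card (nb x \<inter> nb y \<inter> nb z)) = \<alpha>"

lemma special_perm: "special x y z \<Longrightarrow> special y x z" "special x y z \<Longrightarrow> special x z y"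
  using sym by (auto simp: special_def Int_ac)

text \<open>\<open>insert y (nb x \<inter> nb y)\<close> is the closed neighbourhood of
  \<open>y\<close> in the local graph at \<open>x\<close>. For adjacent \<open>y\<close>,
  \<open>z\<close> the two neighbourhoods have \<alpha> elements each, so they agree up to
  \<open>y\<close> and \<open>z\<close> exactly when they share \<open>\<alpha> - 1\<close>.\<close>

lemma special_iff_twins:
  assumes V: "x \<in> V" and y: "y \<in> nb x" and z: "z \<in> nb x" and ne: "y \<noteq> z"
  shows "special x y z \<longleftrightarrow> insert y (nb x \<inter> nb y) = insert z (nb x \<inter> nb z)"
proof
  assume s: "special x y z"
  have *: "nb x \<inter> nb y \<inter> nb z = nb x \<inter> nb p - {q}"
    if pq: "{p, q} = {y, z}" for p q
  proof (rule card_subset_eq)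
    have pq': "p \<in> nb x" "q \<in> nb x" "E p q" "nb p \<inter> nb q = nb y \<inter> nb z"
      using pq y z s sym by (auto simp: special_def doubleton_eq_iff Int_commute)
    show "nb x \<inter> nb y \<inter> nb z \<subseteq> nb x \<inter> nb p - {q}"
      using pq irrefl by (auto simp: doubleton_eq_iff)
    have "card (nb x \<inter> nb p) = \<alpha>" using alpha[of x p] V pq' by auto
    moreover have "q \<in> nb x \<inter> nb p" using pq' by auto
    ultimately have "card (nb x \<inter> nb p - {q}) = \<alpha> - 1" by simp
    then show "card (nb x \<inter> nb y \<inter> nb z) = card (nb x \<inter> nb p - {q})"
      using s unfolding special_def by linarith
  qed simp
  have yz: "E y z" "E z y" using s sym by (auto simp: special_def)
  have "nb x \<inter> nb y - {z} = nb x \<inter> nb z - {y}" using *[of y z] *[of z y] by auto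
  moreover have "z \<in> nb x \<inter> nb y" "y \<in> nb x \<inter> nb z" using y z yz by auto
  ultimately show "insert y (nb x \<inter> nb y) = insert z (nb x \<inter> nb z)" by blast
next
  assume eq: "insert y (nb x \<inter> nb y) = insert z (nb x \<inter> nb z)"
  have "z \<in> insert y (nb x \<inter> nb y)" unfolding eq by simp
  then have yz: "E y z" using ne by auto
  have "y \<notin> nb x \<inter> nb y" "z \<notin> nb x \<inter> nb z" using irrefl by auto
  then have "nb x \<inter> nb y \<inter> nb z = nb x \<inter> nb y - {z}" using eq irrefl by blast
  moreover have "z \<in> nb x \<inter> nb y" using z yz by auto
  moreover have "card (nb x \<inter> nb y) = \<alpha>" using alpha[of x y] V y by auto
  ultimately have "Suc (card (nb x \<inter> nb y \<inter> nb z)) = \<alpha>"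
    by (metis card_Suc_Diff1 finite_Int finite_nb)
  then show "special x y z" using y z yz by (simp add: special_def)
qed

lemma locally_pentagon:
  assumes b: "\<beta> \<ge> 2" and small: "d \<le> 2 * Suc \<alpha>"
  shows "d = 5" "\<alpha> = 2" "\<beta> = 2"
proof -
  define s where "s = \<beta> - 1"
  have tw: "insert v (nb x \<inter> nb v) = finite_graph.cnb (nb x) E v" for x v
  proof -
    interpret L: finite_graph "nb x" E by unfold_locales (auto simp: sym irrefl)
    show ?thesis by (auto simp: L.cnb_def)
  qed
  have loc: "card (nb x) = 5 * s" "Suc \<alpha> = 3 * s"
    "\<And>u. u \<in> nb x \<Longrightarrow> card {v \<in> nb x. insert v (nb x \<inter> nb v) = insert u (nb x \<inter> nb u)} = s"
    "\<And>u v w. u \<in> nb x \<Longrightarrow> v \<in> nb x \<Longrightarrow> w \<in> nb x \<Longrightarrow> E u v \<Longrightarrow> E v w \<Longrightarrow> E u w \<Longrightarrow>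
        special x u v \<or> special x v w \<or> special x u w"
    if x: "x \<in> V" for x
  proof -
    interpret L: local_terwilliger "nb x" E \<alpha> "\<beta> - 1" by (rule local_graph[OF x b])
    have "card (nb x) \<le> 2 * Suc \<alpha>" using deg[OF x] small by simp
    note L = L.small_is_blown_up_pentagon[OF this]
    show "card (nb x) = 5 * s" "Suc \<alpha> = 3 * s" using L(1,2) by (auto simp: s_def)
    show "card {v \<in> nb x. insert v (nb x \<inter> nb v) = insert u (nb x \<inter> nb u)} = s" if "u \<in> nb x" for u
      using L(3)[OF that] unfolding tw L.twins_def s_def .
    show "special x u v \<or> special x v w \<or> special x u w"
      if "u \<in> nb x" "v \<in> nb x" "w \<in> nb x" "E u v" "E v w" "E u w" for u v w
    proof -
      have "u \<noteq> v" "v \<noteq> w" "u \<noteq> w" using that irrefl by auto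
      then show ?thesis
        using L(4)[OF that] special_iff_twins[OF x that(1,2)] special_iff_twins[OF x that(2,3)]
          special_iff_twins[OF x that(1,3)] unfolding tw by simp
    qed
  qed
  \<comment> \<open>If \<open>s \<ge> 2\<close>, take \<open>y\<close>, \<open>z\<close> in
    \<open>nb x\<close> adjacent but not twins at \<open>x\<close>, and a twin \<open>z'\<close> of
    \<open>z\<close> at \<open>x\<close>. In the triangle \<open>x\<close>, \<open>z\<close>,
    \<open>z'\<close> of the local graph at \<open>y\<close> two vertices are twins; symmetry of
    \<open>special\<close> leaves only \<open>z\<close> and \<open>z'\<close>. At \<open>z\<close>,
    then, both \<open>x\<close> and \<open>y\<close> are twins of \<open>z'\<close>, hence of each
    other, which makes \<open>y\<close> and \<open>z\<close> twins at \<open>x\<close>.\<close>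
  have "s = 1"
  proof (rule ccontr)
    assume "s \<noteq> 1"
    then have s2: "s \<ge> 2" using b by (simp add: s_def)
    obtain x where x: "x \<in> V" using not_complete by blast
    obtain y where y: "y \<in> nb x" using nb_nonempty[OF x] by blast
    let ?T = "\<lambda>u. {v \<in> nb x. insert v (nb x \<inter> nb v) = insert u (nb x \<inter> nb u)}"
    have "card (nb x \<inter> nb y) = \<alpha>" using alpha[of x y] x y by auto
    then have lt: "card (?T y) < card (nb x \<inter> nb y)"
      using loc(2)[OF x] loc(3)[OF x y] s2 by simp
    have fT: "finite (?T y)" by (rule finite_subset[of _ "nb x"]) auto
    have "\<not> nb x \<inter> nb y \<subseteq> ?T y"
    proof
      assume "nb x \<inter> nb y \<subseteq> ?T y"
      then have "card (nb x \<inter> nb y) \<le> card (?T y)" by (rule card_mono[OF fT])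
      then show False using lt by simp
    qed
    then obtain z where z: "z \<in> nb x" "z \<in> nb y" "z \<notin> ?T y" by blast
    have yz: "y \<noteq> z" "E y z" "E x y" "E x z" "y \<in> V" "z \<in> V" using z irrefl y by auto
    have nsp: "\<not> special x y z"
      using special_iff_twins[OF x y z(1) yz(1)] z by auto
    have "\<exists>z'\<in>?T z. z' \<noteq> z"
    proof (rule ccontr)
      assume "\<not> ?thesis"
      then have "?T z \<subseteq> {z}" by blast
      then have "card (?T z) \<le> card {z}" by (intro card_mono) auto
      then show False using loc(3)[OF x z(1)] s2 by simp
    qed
    then obtain z' where z': "z' \<in> nb x" "z' \<noteq> z" "insert z' (nb x \<inter> nb z') = insert z (nb x \<inter> nb z)"
      by blast
    have sxzz: "special x z z'" using special_iff_twins[OF x z(1) z'(1)] z' by auto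
    have "z' \<noteq> y" using nsp sxzz special_perm by blast
    have "y \<in> insert z' (nb x \<inter> nb z')" unfolding z'(3) using y yz sym by auto
    then have "y \<in> nb z'" using \<open>z' \<noteq> y\<close> by blast
    then have yz': "E y z'" "E z z'" "z' \<in> V" "E x z'"
      using sxzz z'(1) sym by (auto simp: special_def)
    have nsp': "\<not> special x y z'"
    proof
      assume "special x y z'"
      then have "insert y (nb x \<inter> nb y) = insert z' (nb x \<inter> nb z')"
        using special_iff_twins[OF x y z'(1)] \<open>z' \<noteq> y\<close> by auto
      then have "special x y z" using special_iff_twins[OF x y z(1) yz(1)] z'(3) by simp
      then show False using nsp by simp
    qed
    have "special y x z \<or> special y z z' \<or> special y x z'"
      by (rule loc(4)) (use x yz yz' sym in auto)
    then have syzz: "special y z z'" using nsp nsp' special_perm by blast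
    have a: "special z x z'" "special z y z'" using sxzz syzz special_perm by blast+
    have zV: "x \<in> nb z" "y \<in> nb z" "z' \<in> nb z" using x yz yz' sym by auto
    have "insert x (nb z \<inter> nb x) = insert z' (nb z \<inter> nb z')"
      using special_iff_twins[of z x z'] a zV yz yz' irrefl by metis
    moreover have "insert y (nb z \<inter> nb y) = insert z' (nb z \<inter> nb z')"
      using special_iff_twins[of z y z'] a zV yz yz' irrefl by metis
    ultimately have "special z x y"
      using special_iff_twins[of z x y] zV yz irrefl by metis
    then show False using nsp special_perm by blast
  qed
  obtain x where x: "x \<in> V" using not_complete by blast
  show "d = 5" "\<alpha> = 2" "\<beta> = 2"
    using loc(1,2)[OF x] \<open>s = 1\<close> deg[OF x] by (auto simp: s_def)
qed

end

section \<open>Pentagons and the icosahedron\<close>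

lemma less_5_cases: "(i::nat) < 5 \<Longrightarrow> i = 0 \<or> i = 1 \<or> i = 2 \<or> i = 3 \<or> i = 4"
  by linarith

lemma mod_5_cancel:
  fixes i a b :: nat
  shows "(i + a) mod 5 = (i + b) mod 5 \<longleftrightarrow> a mod 5 = b mod 5"
    and "(i + a) mod 5 = i mod 5 \<longleftrightarrow> a mod 5 = 0"
    and "i mod 5 = (i + a) mod 5 \<longleftrightarrow> a mod 5 = 0"
proof -
  have *: "x mod 5 = y mod 5 \<longleftrightarrow> (5::int) dvd int x - int y" for x y :: nat
  proof -
    have "int x mod 5 = int (x mod 5)" "int y mod 5 = int (y mod 5)" by (simp_all add: zmod_int)
    then show ?thesis using mod_eq_dvd_iff[of "int x" 5 "int y"] by simp
  qed
  show 1: "(i + a) mod 5 = (i + b) mod 5 \<longleftrightarrow> a mod 5 = b mod 5" for a b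
    unfolding * by simp
  show "(i + a) mod 5 = i mod 5 \<longleftrightarrow> a mod 5 = 0" "i mod 5 = (i + a) mod 5 \<longleftrightarrow> a mod 5 = 0"
    using 1[of a 0] 1[of 0 a] by auto
qed

text \<open>A pentagon contains no triangle: \<open>j\<close> would be adjacent to both
  \<open>i\<close> and \<open>i + 1\<close>.\<close>

lemma mod_5_no_common_neighbour:
  fixes i j :: nat
  assumes "(i + 1) mod 5 = j mod 5 \<or> (j + 1) mod 5 = i mod 5"
    and "(i + 1 + 1) mod 5 = j mod 5 \<or> (j + 1) mod 5 = (i + 1) mod 5"
  shows False
proof -
  have "\<not> (((a + 1) mod 5 = b \<or> (b + 1) mod 5 = a) \<and> ((a + 2) mod 5 = b \<or> (b + 1) mod 5 = (a + 1) mod 5))"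
    if "a < 5" "b < 5" for a b :: nat
    using less_5_cases[OF that(1)] less_5_cases[OF that(2)] by (elim disjE) simp_all
  from this[of "i mod 5" "j mod 5"] assms show False by (auto simp: mod_simps)
qed

text \<open>The edge of the pentagon from \<open>i\<close> to \<open>i + 1\<close> determines
  \<open>i\<close>.\<close>

lemma mod_5_edge_eq:
  fixes i j :: nat
  assumes "i mod 5 = j mod 5 \<or> i mod 5 = (j + 1) mod 5"
    and "(i + 1) mod 5 = j mod 5 \<or> (i + 1) mod 5 = (j + 1) mod 5"
  shows "i mod 5 = j mod 5"
proof -
  have "a = b" if "a < 5" "b < 5"
    "(a = b \<or> a = (b + 1) mod 5) \<and> ((a + 1) mod 5 = b \<or> (a + 1) mod 5 = (b + 1) mod 5)" for a b :: nat
    using less_5_cases[OF that(1)] less_5_cases[OF that(2)] that(3) by (elim disjE) simp_all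
  from this[of "i mod 5" "j mod 5"] assms show ?thesis by (auto simp: mod_simps)
qed

context finite_graph
begin

text \<open>Labellings by residues modulo 5 are functions on \<open>nat\<close> of period 5.\<close>

definition pentagon_labelling :: "(nat \<Rightarrow> 'a) \<Rightarrow> bool" where
  "pentagon_labelling p \<longleftrightarrow> (\<forall>i. p i \<in> V) \<and> (\<forall>i j. p i = p j \<longleftrightarrow> i mod 5 = j mod 5) \<and>
     (\<forall>i j. E (p i) (p j) \<longleftrightarrow> (i + 1) mod 5 = j mod 5 \<or> (j + 1) mod 5 = i mod 5)"

lemma pentagon_labellingI:
  assumes V: "a0 \<in> V" "a1 \<in> V" "a2 \<in> V" "a3 \<in> V" "a4 \<in> V"
    and E: "E a0 a1" "E a1 a2" "E a2 a3" "E a3 a4" "E a4 a0"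
    and nE: "\<not> E a0 a2" "\<not> E a0 a3" "\<not> E a1 a3" "\<not> E a1 a4" "\<not> E a2 a4"
  shows "pentagon_labelling (\<lambda>i. [a0, a1, a2, a3, a4] ! (i mod 5))"
proof -
  let ?p = "\<lambda>i. [a0, a1, a2, a3, a4] ! i"
  have ne: "a0 \<noteq> a1" "a0 \<noteq> a2" "a0 \<noteq> a3" "a0 \<noteq> a4" "a1 \<noteq> a2" "a1 \<noteq> a3" "a1 \<noteq> a4" "a2 \<noteq> a3"
    "a2 \<noteq> a4" "a3 \<noteq> a4"
    using E nE irrefl sym by metis+
  have E': "E a1 a0" "E a2 a1" "E a3 a2" "E a4 a3" "E a0 a4"
      "\<not> E a2 a0" "\<not> E a3 a0" "\<not> E a3 a1" "\<not> E a4 a1" "\<not> E a4 a2"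
    using E nE sym by blast+
  have inV: "?p i \<in> V" if "i < 5" for i
    using less_5_cases[OF that] V by (elim disjE) simp_all
  have eq: "?p i = ?p j \<longleftrightarrow> i = j" if "i < 5" "j < 5" for i j
    using less_5_cases[OF that(1)] less_5_cases[OF that(2)] ne ne[symmetric]
    by (elim disjE) (simp_all add: nth_Cons_numeral)
  have adj: "E (?p i) (?p j) \<longleftrightarrow> (i + 1) mod 5 = j \<or> (j + 1) mod 5 = i" if "i < 5" "j < 5" for i j
    using less_5_cases[OF that(1)] less_5_cases[OF that(2)] E nE E' irrefl
    by (elim disjE) (simp_all add: nth_Cons_numeral)
  show ?thesis
    unfolding pentagon_labelling_def
  proof (intro conjI allI)
    show "[a0, a1, a2, a3, a4] ! (i mod 5) \<in> V" for i by (rule inV) simp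
    show "([a0, a1, a2, a3, a4] ! (i mod 5) = [a0, a1, a2, a3, a4] ! (j mod 5)) = (i mod 5 = j mod 5)" for i j
      by (rule eq) simp_all
    show "E ([a0, a1, a2, a3, a4] ! (i mod 5)) ([a0, a1, a2, a3, a4] ! (j mod 5)) =
        ((i + 1) mod 5 = j mod 5 \<or> (j + 1) mod 5 = i mod 5)" for i j
      using adj[of "i mod 5" "j mod 5"] by (simp add: mod_simps)
  qed
qed

text \<open>At least \<open>d\<close> neighbours of \<open>w\<close> go to distinct neighbours of
  \<open>g w\<close>, which has only \<open>d\<close>. So nonadjacency is preserved automatically,
  and in the model graphs a lower bound on the degrees suffices.\<close>

lemma regular_embedding:
  assumes W: "finite W" "g ` W \<subseteq> V" "inj_on g W"
    and deg: "\<And>w. w \<in> W \<Longrightarrow> card (nb (g w)) = d"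
    and degW: "\<And>w. w \<in> W \<Longrightarrow> card {w' \<in> W. F w w'} \<ge> d"
    and hom: "\<And>w w'. w \<in> W \<Longrightarrow> w' \<in> W \<Longrightarrow> F w w' \<Longrightarrow> E (g w) (g w')"
    and w: "w \<in> W"
  shows "nb (g w) = g ` {w' \<in> W. F w w'}"
proof (rule card_subset_eq[symmetric])
  show sub: "g ` {w' \<in> W. F w w'} \<subseteq> nb (g w)" using W(2) hom w by auto
  have "card (g ` {w' \<in> W. F w w'}) = card {w' \<in> W. F w w'}"
    by (rule card_image) (use W(3) in \<open>auto simp: inj_on_def\<close>)
  then have "d \<le> card (g ` {w' \<in> W. F w w'})" using degW[OF w] by simp
  moreover have "card (g ` {w' \<in> W. F w w'}) \<le> d"
    using card_mono[OF finite_nb sub] deg[OF w] by simp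
  ultimately show "card (g ` {w' \<in> W. F w w'}) = card (nb (g w))" using deg[OF w] by simp
qed simp

lemma regular_embedding_iff:
  assumes W: "finite W" "g ` W \<subseteq> V" "inj_on g W"
    and deg: "\<And>w. w \<in> W \<Longrightarrow> card (nb (g w)) = d"
    and degW: "\<And>w. w \<in> W \<Longrightarrow> card {w' \<in> W. F w w'} \<ge> d"
    and hom: "\<And>w w'. w \<in> W \<Longrightarrow> w' \<in> W \<Longrightarrow> F w w' \<Longrightarrow> E (g w) (g w')"
    and w: "w \<in> W" "w' \<in> W"
  shows "E (g w) (g w') \<longleftrightarrow> F w w'"
proof
  assume "E (g w) (g w')"
  then have "g w' \<in> nb (g w)" using W(2) w by auto
  then have "g w' \<in> g ` {w' \<in> W. F w w'}"
    using regular_embedding[of W g d F w, OF W deg degW hom w(1)] by simp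
  then show "F w w'" using W(3) w by (auto simp: inj_on_def)
qed (use hom w in auto)

end

text \<open>Follow the two neighbours of \<open>a0\<close> one step further; the five vertices found
  exhaust \<open>V\<close>. This serves the local graphs for \<beta> = 2 as well as the Moore graph
  of degree 2.\<close>

lemma (in local_terwilliger) pentagon_labelling_exists:
  assumes r: "r = 2" and m: "\<mu> = 1" and c: "card V = 5"
  obtains p where "pentagon_labelling p" "range p = V"
proof -
  obtain a0 where a0: "a0 \<in> V" using noncomplete by blast
  have deg2: "\<exists>x y. nb u = {x, y} \<and> x \<noteq> y" if "u \<in> V" for u
    using regular[OF that] r by (simp add: card_2_iff)
  have uniq: "x = y" if "u \<in> V" "v \<in> V" "u \<noteq> v" "\<not> E u v" "x \<in> nb u \<inter> nb v" "y \<in> nb u \<inter> nb v" for u v x y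
    using mu[OF that(1-4)] m that(5,6) by (metis card_1_singletonE singletonD)
  obtain a1 a4 where n0: "nb a0 = {a1, a4}" "a1 \<noteq> a4" using deg2[OF a0] by blast
  have V14: "a1 \<in> V" "a4 \<in> V" "E a0 a1" "E a0 a4" using n0 nb_subset by (auto simp: set_eq_iff)
  then have E10: "E a1 a0" "E a4 a0" using sym by auto
  have other: "\<exists>x. nb u = {z, x} \<and> x \<noteq> z" if "u \<in> V" "z \<in> V" "E u z" for u z
  proof -
    obtain x y where "nb u = {x, y}" "x \<noteq> y" using deg2[OF \<open>u \<in> V\<close>] by blast
    moreover have "z \<in> nb u" using that by simp
    ultimately show ?thesis by (metis insert_commute insertE singletonD)
  qed
  obtain a2 where n1: "nb a1 = {a0, a2}" "a2 \<noteq> a0" using other[OF V14(1) a0 E10(1)] by blast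
  obtain a3 where n4: "nb a4 = {a0, a3}" "a3 \<noteq> a0" using other[OF V14(2) a0 E10(2)] by blast
  \<comment> \<open>Otherwise \<open>{a0, a1, a4}\<close> would be closed under adjacency, and a
    nonneighbour of \<open>a0\<close> would have no common neighbour with it.\<close>
  have n14: "\<not> E a1 a4"
  proof
    assume "E a1 a4"
    then have "a4 \<in> nb a1" "a1 \<in> nb a4" using V14 sym by auto
    then have nn: "nb a1 = {a0, a4}" "nb a4 = {a0, a1}"
      using n1 n4 V14 irrefl E10 by auto
    obtain v where v: "v \<in> V" "v \<noteq> a0" "\<not> E a0 v" using has_nonneighbour[OF a0] by blast
    obtain x where x: "x \<in> nb a0 \<inter> nb v" using common_neighbour[OF a0 v(1)] v by metis
    then have "x = a1 \<or> x = a4" using n0 by auto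
    moreover have "v \<in> nb x" using x v sym by auto
    ultimately have "v \<in> {a0, a4} \<or> v \<in> {a0, a1}" using nn by metis
    then have "v = a0 \<or> v = a4 \<or> v = a1" by blast
    then show False using v V14 by auto
  qed
  have V23: "a2 \<in> V" "a3 \<in> V" "E a1 a2" "E a4 a3" using n1 n4 by (auto simp: set_eq_iff)
  have ne23: "a2 \<noteq> a3"
  proof
    assume "a2 = a3"
    then have "a2 \<in> nb a1 \<inter> nb a4" using n1 n4 by auto
    moreover have "a0 \<in> nb a1 \<inter> nb a4" using n1 n4 by auto
    ultimately show False using uniq[OF V14(1,2) n0(2) n14] n1 by blast
  qed
  have ne: "a2 \<noteq> a4" "a3 \<noteq> a1" "a2 \<noteq> a1" "a3 \<noteq> a4" using n14 V23 sym irrefl by auto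
  have VV: "V = {a0, a1, a2, a3, a4}"
  proof (rule card_subset_eq[OF fin, symmetric])
    show "{a0, a1, a2, a3, a4} \<subseteq> V" using a0 V14 V23 by auto
    have "a0 \<noteq> a1" "a0 \<noteq> a4" using V14 irrefl by auto
    then show "card {a0, a1, a2, a3, a4} = card V"
      using ne ne23 n0 n1 n4 c by simp
  qed
  have nE: "\<not> E a0 a2" "\<not> E a0 a3" "\<not> E a1 a3" "\<not> E a2 a4"
  proof -
    have "a2 \<notin> nb a0" "a3 \<notin> nb a0" "a3 \<notin> nb a1" "a2 \<notin> nb a4" using n0 n1 n4 ne ne23 by auto
    then show "\<not> E a0 a2" "\<not> E a0 a3" "\<not> E a1 a3" "\<not> E a2 a4" using V23 sym by auto
  qed
  have E23: "E a2 a3"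
  proof -
    obtain x where x: "nb a2 = {a1, x}" "x \<noteq> a1" using other[of a2 a1] V23 V14 sym by blast
    then have "x \<in> V" "E a2 x" by (auto simp: set_eq_iff)
    then have "x \<in> {a0, a2, a3, a4}" using VV x by blast
    then show ?thesis using \<open>E a2 x\<close> nE sym irrefl by auto
  qed
  let ?p = "\<lambda>i. [a0, a1, a2, a3, a4] ! (i mod 5)"
  have "pentagon_labelling ?p"
    by (rule pentagon_labellingI) (use a0 V14 V23 E10 E23 nE n14 sym in auto)
  moreover have "range ?p = V"
  proof
    show "range ?p \<subseteq> V" using calculation by (auto simp: pentagon_labelling_def)
    have "?p 0 = a0" "?p 1 = a1" "?p 2 = a2" "?p 3 = a3" "?p 4 = a4" by (simp_all add: nth_Cons_numeral)
    then show "V \<subseteq> range ?p" unfolding VV by (metis (no_types, lifting) empty_subsetI insert_subset rangeI)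
  qed
  ultimately show ?thesis using that by blast
qed

section \<open>The icosahedron as the locally pentagonal graph\<close>

definition icosahedron_adj :: "nat \<times> nat \<Rightarrow> nat \<times> nat \<Rightarrow> bool" where
  "icosahedron_adj u v \<longleftrightarrow> (\<exists>i<5. \<exists>(a, b) \<in> {((0, 0), (1, i)), ((1, i), (1, (i + 1) mod 5)),
         ((1, i), (2, i)), ((1, i), (2, (i + 1) mod 5)),
         ((2, i), (2, (i + 1) mod 5)), ((2, i), (3, 0))}. (u, v) = (a, b) \<or> (u, v) = (b, a))"

abbreviation (input) icosahedron_verts :: "(nat \<times> nat) set" where
  "icosahedron_verts \<equiv> {(0, 0), (3, 0)} \<union> {1, 2} \<times> {..<5}"

lemma icosahedron_adjI:
  assumes "i < 5"
  shows "icosahedron_adj (0, 0) (1, i)" "icosahedron_adj (1, i) (0, 0)"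
    "icosahedron_adj (1, i) (1, (i + 1) mod 5)" "icosahedron_adj (1, (i + 1) mod 5) (1, i)"
    "icosahedron_adj (1, i) (2, i)" "icosahedron_adj (2, i) (1, i)"
    "icosahedron_adj (1, i) (2, (i + 1) mod 5)" "icosahedron_adj (2, (i + 1) mod 5) (1, i)"
    "icosahedron_adj (2, i) (2, (i + 1) mod 5)" "icosahedron_adj (2, (i + 1) mod 5) (2, i)"
    "icosahedron_adj (2, i) (3, 0)" "icosahedron_adj (3, 0) (2, i)"
  using assms unfolding icosahedron_adj_def by (blast+)

lemma icosahedron_degree:
  assumes "w \<in> icosahedron_verts"
  shows "card {w' \<in> icosahedron_verts. icosahedron_adj w w'} \<ge> 5"
proof -
  have *: "5 \<le> card {w' \<in> icosahedron_verts. icosahedron_adj w w'}"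
    if "S \<subseteq> icosahedron_verts" "card S = 5" "\<And>w'. w' \<in> S \<Longrightarrow> icosahedron_adj w w'" for S
  proof -
    have "card S \<le> card {w' \<in> icosahedron_verts. icosahedron_adj w w'}"
      by (rule card_mono) (use that in auto)
    then show ?thesis using that by simp
  qed
  consider "w = (0, 0)" | "w = (3, 0)" | i where "w = (1, i)" "i < 5" | i where "w = (2, i)" "i < 5"
    using assms by auto
  then show ?thesis
  proof cases
    case 1
    show ?thesis
      by (rule *[of "{1} \<times> {..<5}"]) (use 1 icosahedron_adjI in auto)
  next
    case 2
    show ?thesis
      by (rule *[of "{2} \<times> {..<5}"]) (use 2 icosahedron_adjI in auto)
  next
    case (3 i)
    define k where "k = (i + 4) mod 5"
    have k: "k < 5" "(k + 1) mod 5 = i" "k \<noteq> (i + 1) mod 5" "(i + 1) mod 5 \<noteq> i"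
      using less_5_cases[OF 3(2)] unfolding k_def by auto
    show ?thesis
      by (rule *[of "{(0, 0), (1, (i + 1) mod 5), (1, k), (2, i), (2, (i + 1) mod 5)}"])
        (use 3 k k(3,4)[symmetric] icosahedron_adjI[OF 3(2)] icosahedron_adjI[OF k(1)] in auto)
  next
    case (4 i)
    define k where "k = (i + 4) mod 5"
    have k: "k < 5" "(k + 1) mod 5 = i" "k \<noteq> (i + 1) mod 5" "k \<noteq> i"
      using less_5_cases[OF 4(2)] unfolding k_def by auto
    show ?thesis
      by (rule *[of "{(3, 0), (2, (i + 1) mod 5), (2, k), (1, i), (1, k)}"])
        (use 4 k k(3,4)[symmetric] icosahedron_adjI[OF 4(2)] icosahedron_adjI[OF k(1)] in auto)
  qed
qed

context terwilliger_graph
begin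

text \<open>The layers around \<open>z\<close> are forced: its neighbours \<open>p i\<close>, the
  vertices \<open>q i\<close> opposite \<open>z\<close> across the edges of that pentagon, and a
  last vertex \<open>T\<close>. Connectedness excludes further vertices.\<close>

lemma icosahedron_iso:
  assumes d: "d = 5" and a: "\<alpha> = 2" and b: "\<beta> = 2"
  obtains g where "bij_betw g icosahedron_verts V"
    "\<And>w w'. w \<in> icosahedron_verts \<Longrightarrow> w' \<in> icosahedron_verts \<Longrightarrow>
       E (g w) (g w') \<longleftrightarrow> icosahedron_adj w w'"
proof -
  have two: "S = {x, y}" if "card S = 2" "x \<in> S" "y \<in> S" "x \<noteq> y" for S :: "'a set" and x y
    using that by (metis (no_types, lifting) card_2_iff insertE insert_commute singletonD)
  have beta2: "card (nb u \<inter> nb v) = 2"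
    if "u \<in> V" "v \<in> V" "u \<noteq> v" "\<not> E u v" "x \<in> nb u \<inter> nb v" for u v x
    using beta[of u v] that b by (metis empty_iff)
  have alpha2: "card (nb u \<inter> nb v) = 2" if "u \<in> V" "v \<in> V" "E u v" for u v
    using alpha[OF that] a by simp
  obtain z where z: "z \<in> V" using not_complete by blast
  interpret L: local_terwilliger "nb z" E 2 1
    using local_graph[OF z] a b by simp
  obtain p where p: "L.pentagon_labelling p" "range p = nb z"
    using L.pentagon_labelling_exists deg[OF z] d by auto
  have pV: "p i \<in> V" "E z (p i)" "E (p i) z" for i
    using p(2) sym by (metis in_nb rangeI)+
  have peq: "p i = p j \<longleftrightarrow> i mod 5 = j mod 5" for i j
    using p(1) by (simp add: L.pentagon_labelling_def)
  have padj: "E (p i) (p j) \<longleftrightarrow> (i + 1) mod 5 = j mod 5 \<or> (j + 1) mod 5 = i mod 5" for i j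
    using p(1) by (simp add: L.pentagon_labelling_def)
  \<comment> \<open>As \<alpha> = 2, the edge from \<open>p i\<close> to \<open>p (i + 1)\<close>
    has exactly one common neighbour besides \<open>z\<close>.\<close>
  define q where "q i = (SOME x. x \<in> nb (p i) \<inter> nb (p (i + 1)) \<and> x \<noteq> z)" for i
  have per: "q i = q j" if "p i = p j" for i j
  proof -
    have "i mod 5 = j mod 5" using that peq by simp
    then have "(i + 1) mod 5 = (j + 1) mod 5" by (rule mod_add_cong) simp
    then have "p (i + 1) = p (j + 1)" unfolding peq .
    then show ?thesis unfolding q_def using that by simp
  qed
  have ppq: "q i \<in> nb (p i) \<inter> nb (p (i + 1))" "q i \<noteq> z" for i
  proof -
    have "card (nb (p i) \<inter> nb (p (i + 1))) = 2" using alpha2 pV padj by simp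
    then have "\<exists>x. x \<in> nb (p i) \<inter> nb (p (i + 1)) \<and> x \<noteq> z"
      by (metis card_2_iff insertI1 insert_iff)
    from someI_ex[OF this] show "q i \<in> nb (p i) \<inter> nb (p (i + 1))" "q i \<noteq> z"
      unfolding q_def by auto
  qed
  have qV: "q i \<in> V" "E (p i) (q i)" "E (p (i + 1)) (q i)" "E (q i) (p i)" "E (q i) (p (i + 1))" for i
    using ppq sym by auto
  have zp: "z \<noteq> p i" for i using pV(2)[of i] irrefl by auto
  have qnp: "q i \<noteq> p j" for i j
  proof
    assume "q i = p j"
    then have "E (p i) (p j)" "E (p (i + 1)) (p j)" using qV[of i] by auto
    then show False
      unfolding padj using mod_5_no_common_neighbour[of i j] by simp
  qed
  have qz: "\<not> E z (q i)" "\<not> E (q i) z" for i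
  proof -
    show "\<not> E z (q i)" using qnp[of i] p(2) qV(1)[of i] by (metis in_nb rangeE)
    then show "\<not> E (q i) z" using sym by blast
  qed
  \<comment> \<open>\<open>z\<close> and \<open>q i\<close> have \<beta> = 2 common neighbours, and
    \<open>p i\<close>, \<open>p (i + 1)\<close> are two.\<close>
  have qp: "E (q i) (p j) \<longleftrightarrow> j mod 5 = i mod 5 \<or> j mod 5 = (i + 1) mod 5" for i j
  proof -
    have "card (nb z \<inter> nb (q i)) = 2"
      by (rule beta2[of _ _ "p i"]) (use z qV[of i] pV[of i] qz[of i] ppq(2)[of i] in auto)
    moreover have "p i \<noteq> p (i + 1)" unfolding peq by (simp only: add.assoc mod_5_cancel) simp
    ultimately have "nb z \<inter> nb (q i) = {p i, p (i + 1)}"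
      using two[of "nb z \<inter> nb (q i)" "p i" "p (i + 1)"] pV qV by auto
    then have "E (q i) (p j) \<longleftrightarrow> p j = p i \<or> p j = p (i + 1)" using pV[of j] by (auto simp: set_eq_iff)
    then show ?thesis unfolding peq .
  qed
  have qeq: "q i = q j \<longleftrightarrow> i mod 5 = j mod 5" for i j
  proof
    assume "q i = q j"
    then have "i mod 5 = j mod 5 \<or> i mod 5 = (j + 1) mod 5" "(i + 1) mod 5 = j mod 5 \<or> (i + 1) mod 5 = (j + 1) mod 5"
      using qp[of j i] qp[of j "i + 1"] qV by metis+
    then show "i mod 5 = j mod 5" by (rule mod_5_edge_eq)
  next
    assume "i mod 5 = j mod 5"
    then show "q i = q j" using per peq by blast
  qed
  have five: "S = {x1, x2, x3, x4, x5}"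
    if "card S = 5" "{x1, x2, x3, x4, x5} \<subseteq> S" "distinct [x1, x2, x3, x4, x5]" for S :: "'a set" and x1 x2 x3 x4 x5
  proof -
    have "finite S" using that(1) by (metis card.infinite zero_neq_numeral)
    moreover have "card {x1, x2, x3, x4, x5} = 5" using that(3) by simp
    ultimately show ?thesis using that card_subset_eq by metis
  qed
  have nbp: "nb (p (i + 1)) = {z, p i, p (i + 2), q i, q (i + 1)}" for i
  proof (rule five)
    show "card (nb (p (i + 1))) = 5" using deg pV d by simp
    have "E (p (i + 1)) (p i)" "E (p (i + 1)) (p (i + 2))" unfolding padj by (simp_all only: add.assoc mod_5_cancel) simp_all
    then show "{z, p i, p (i + 2), q i, q (i + 1)} \<subseteq> nb (p (i + 1))"
      using z pV qV by (auto simp: add.commute)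
    have "p i \<noteq> p (i + 2)" "q i \<noteq> q (i + 1)" unfolding peq qeq by (simp_all only: add.assoc mod_5_cancel) simp_all
    then show "distinct [z, p i, p (i + 2), q i, q (i + 1)]"
      using zp qnp[symmetric] ppq(2)[symmetric] by simp
  qed
  \<comment> \<open>The edge from \<open>p (i + 1)\<close> to \<open>q i\<close> has a second common
    neighbour besides \<open>p i\<close>; among the five neighbours of \<open>p (i + 1)\<close> only
    \<open>q (i + 1)\<close> is possible.\<close>
  have qq: "E (q i) (q (i + 1))" for i
  proof -
    have "card (nb (p (i + 1)) \<inter> nb (q i)) = 2" using alpha2 pV qV by simp
    then have "\<exists>x. x \<in> nb (p (i + 1)) \<inter> nb (q i) \<and> x \<noteq> p i"
      by (metis card_2_iff insertI1 insert_iff)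
    then obtain x where x: "x \<in> {z, p i, p (i + 2), q i, q (i + 1)}" "E (q i) x" "x \<noteq> p i"
      unfolding nbp by auto
    moreover have "\<not> E (q i) (p (i + 2))" unfolding qp by (simp only: add.assoc mod_5_cancel) simp
    ultimately show ?thesis using qz irrefl by auto
  qed
  \<comment> \<open>Such an edge would give the nonadjacent \<open>p (i + 1)\<close> and
    \<open>q (i + 2)\<close> three common neighbours.\<close>
  have nqq: "\<not> E (q i) (q (i + 2))" for i
  proof
    assume e: "E (q i) (q (i + 2))"
    have n: "\<not> E (q (i + 2)) (p (i + 1))" unfolding qp by (simp only: add.assoc mod_5_cancel) simp
    have "E (q (i + 2)) (p (i + 2))" "E (p (i + 1)) (p (i + 2))" unfolding qp padj by (simp_all only: add.assoc mod_5_cancel) simp_all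
    moreover have "E (q (i + 1)) (q (i + 2))" using qq[of "i + 1"] by simp
    ultimately have sub: "{p (i + 2), q (i + 1), q i} \<subseteq> nb (p (i + 1)) \<inter> nb (q (i + 2))"
      using e sym pV qV by auto
    have "card (nb (p (i + 1)) \<inter> nb (q (i + 2))) = 2"
      by (rule beta2[of _ _ "q i"]) (use sub n sym pV qV qnp[symmetric] in auto)
    moreover have "q (i + 1) \<noteq> q i" unfolding qeq by (simp only: add.assoc mod_5_cancel) simp
    then have "card {p (i + 2), q (i + 1), q i} = 3" using qnp[symmetric] by simp
    ultimately show False using card_mono[OF _ sub] by simp
  qed
  have "\<exists>t. t \<in> V \<and> nb (q i) = {p i, p (i + 1), q (i + 1), q (i + 4), t} \<and>
      t \<notin> {p i, p (i + 1), q (i + 1), q (i + 4)}" for i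
  proof -
    have "E (q (i + 4)) (q (i + 4 + 1))" by (rule qq)
    moreover have "q (i + 4 + 1) = q i" unfolding qeq by (simp only: add.assoc mod_5_cancel) simp
    ultimately have e: "E (q i) (q (i + 4))" using sym by simp
    let ?S = "{p i, p (i + 1), q (i + 1), q (i + 4)}"
    have "p i \<noteq> p (i + 1)" "q (i + 1) \<noteq> q (i + 4)" unfolding qeq peq by (simp_all only: add.assoc mod_5_cancel) simp_all
    then have S4: "card ?S = 4" using qnp[symmetric] by simp
    have sub: "?S \<subseteq> nb (q i)" using qV pV qq e by auto
    have "card (nb (q i) - ?S) = 1"
      using card_Diff_subset[OF _ sub] deg[OF qV(1)] S4 d by simp
    then obtain t where "nb (q i) - ?S = {t}" using card_1_singletonE by blast
    moreover from this have "t \<in> V" using nb_subset by blast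
    ultimately show ?thesis using sub by (intro exI[of _ t]) blast
  qed
  then obtain t where t: "t i \<in> V" "nb (q i) = {p i, p (i + 1), q (i + 1), q (i + 4), t i}"
      "t i \<notin> {p i, p (i + 1), q (i + 1), q (i + 4)}" for i
    by metis
  have tq: "E (q i) (t i)" for i using t(2)[of i] in_nb by blast
  \<comment> \<open>The second common neighbour of \<open>q i\<close> and \<open>q (i + 1)\<close>,
    besides \<open>p (i + 1)\<close>, can only be \<open>t i\<close>, which is then also the fifth
    neighbour of \<open>q (i + 1)\<close>.\<close>
  have step: "t i = t (i + 1)" for i
  proof -
    have "card (nb (q i) \<inter> nb (q (i + 1))) = 2" using alpha2 qV qq by simp
    then have "\<exists>x. x \<in> nb (q i) \<inter> nb (q (i + 1)) \<and> x \<noteq> p (i + 1)"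
      by (metis card_2_iff insertI1 insert_iff)
    then obtain x where "x \<in> nb (q i)" and x': "E (q (i + 1)) x" "x \<noteq> p (i + 1)" by auto
    then have x: "x \<in> {p i, p (i + 1), q (i + 1), q (i + 4), t i}" "E (q (i + 1)) x" "x \<noteq> p (i + 1)"
      unfolding t(2) by blast+
    moreover have "\<not> E (q (i + 1)) (p i)" unfolding qp by (simp only: add.assoc mod_5_cancel) simp
    moreover have "\<not> E (q (i + 1)) (q (i + 4))"
    proof -
      have "q (i + 4 + 2) = q (i + 1)" unfolding qeq by (simp only: add.assoc mod_5_cancel) simp
      then show ?thesis using nqq[of "i + 4"] sym by metis
    qed
    ultimately have e: "E (q (i + 1)) (t i)" using irrefl by auto
    then have "t i \<in> nb (q (i + 1))" using t(1) by simp
    then have "t i \<in> {p (i + 1), p (i + 1 + 1), q (i + 1 + 1), q (i + 1 + 4), t (i + 1)}"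
      unfolding t(2) .
    moreover have "t i \<noteq> p (i + 1 + 1)"
    proof -
      have "\<not> E (q i) (p (i + 1 + 1))" unfolding qp by (simp only: add.assoc mod_5_cancel) simp
      then show ?thesis using tq[of i] by auto
    qed
    moreover have "t i \<noteq> q (i + 1 + 1)" using nqq[of i] tq[of i] by auto
    moreover have "t i \<noteq> q (i + 1 + 4)"
    proof -
      have "q (i + 1 + 4) = q i" unfolding qeq by (simp only: add.assoc mod_5_cancel) simp
      then show ?thesis using tq[of i] irrefl by auto
    qed
    ultimately show ?thesis using t(3)[of i] by auto
  qed
  define T where "T = t 0"
  have tT: "t i = T" for i by (induction i) (use step in \<open>auto simp: T_def\<close>)
  have Tq: "E (q i) T" "T \<in> V" for i using tq t(1) tT by metis+
  have TS: "T \<noteq> z" "T \<noteq> p i" "T \<noteq> q i" for i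
  proof -
    show "T \<noteq> z" using Tq qz by auto
    show "T \<noteq> q i" using Tq(1)[of i] irrefl by auto
    show "T \<noteq> p i" using t(3)[of i] tT by auto
  qed
  \<comment> \<open>In \<open>icosahedron\<close> vertex \<open>(1, i)\<close> is joined to
    \<open>(2, i)\<close> and \<open>(2, i + 1)\<close>, whereas \<open>p i\<close> is joined to
    \<open>q (i - 1)\<close> and \<open>q i\<close>; adding 4 is the shift by -1.\<close>
  define g where "g w = (if fst w = 0 then z else if fst w = 1 then p (snd w)
      else if fst w = 2 then q (snd w + 4) else T)" for w :: "nat \<times> nat"
  have g: "g (0, 0) = z" "g (1, i) = p i" "g (Suc 0, i) = p i" "g (2, i) = q (i + 4)" "g (3, 0) = T" for i
    by (auto simp: g_def)
  have inj: "inj_on g icosahedron_verts"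
  proof (rule inj_onI)
    fix u v assume uv: "u \<in> icosahedron_verts" "v \<in> icosahedron_verts" "g u = g v"
    have zp: "p i \<noteq> z" for i using pV irrefl by metis
    have qq4: "i = j" if "i < 5" "j < 5" "q (i + 4) = q (j + 4)" for i j
      using that mod_5_cancel(1)[where i = 4 and a = i and b = j] unfolding qeq by (simp add: add.commute)
    have pp: "i = j" if "i < 5" "j < 5" "p i = p j" for i j
      using that unfolding peq by simp
    show "u = v"
      using uv zp zp[symmetric] qnp qnp[symmetric] ppq(2) ppq(2)[symmetric] TS TS[symmetric]
      by (auto simp: g intro: qq4 pp)
  qed
  have sub: "g ` icosahedron_verts \<subseteq> V" using z pV qV Tq by (auto simp: g)
  have hom: "E (g w) (g w')" if "icosahedron_adj w w'" for w w'
  proof -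
    have *: "E (p i) (p (Suc i mod 5))" "E (p i) (q (i + 4))" "E (p i) (q (Suc i mod 5 + 4))"
      "E (q (i + 4)) (q (Suc i mod 5 + 4))" for i
    proof -
      show "E (p i) (p (Suc i mod 5))" unfolding padj by simp
      have "i mod 5 = (Suc i mod 5 + 4) mod 5" "i mod 5 = (i + 4 + 1) mod 5"
        using mod_5_cancel(3)[of i 5] by (simp_all add: mod_simps)
      then have "E (q (i + 4)) (p i)" "E (q (Suc i mod 5 + 4)) (p i)" unfolding qp by blast+
      then show "E (p i) (q (i + 4))" "E (p i) (q (Suc i mod 5 + 4))" using sym by blast+
      have "q (Suc i mod 5 + 4) = q (i + 4 + 1)" unfolding qeq by (simp add: mod_simps)
      then show "E (q (i + 4)) (q (Suc i mod 5 + 4))" using qq[of "i + 4"] by metis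
    qed
    show ?thesis
      using that * *[THEN sym] pV Tq Tq(1)[THEN sym] unfolding icosahedron_adj_def by (auto simp: g)
  qed
  define W where "W = icosahedron_verts"
  have W: "finite W" "g ` W \<subseteq> V" "inj_on g W" using sub inj by (simp_all add: W_def)
  have degV: "card (nb (g w)) = 5" if "w \<in> W" for w using deg W(2) that d by blast
  have degW: "5 \<le> card {w' \<in> W. icosahedron_adj w w'}" if "w \<in> W" for w
    using icosahedron_degree that unfolding W_def by blast
  note emb = regular_embedding[of W g 5 icosahedron_adj, OF W degV degW hom]
  have img: "g ` W = V"
  proof (rule connected)
    show "g ` W \<noteq> {}" by (simp add: W_def)
    show "v \<in> g ` W" if "u \<in> g ` W" "v \<in> nb u" for u v
      using that emb by blast
  qed (use W in auto)
  show thesis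
  proof (rule that)
    show "bij_betw g icosahedron_verts V" using W img unfolding W_def by (simp add: bij_betw_def)
    show "E (g w) (g w') \<longleftrightarrow> icosahedron_adj w w'"
      if "w \<in> icosahedron_verts" "w' \<in> icosahedron_verts" for w w'
      using regular_embedding_iff[of W g 5 icosahedron_adj, OF W degV degW hom] that
      unfolding W_def by blast
  qed
qed

end

section \<open>Moore graphs of diameter two\<close>

locale moore = finite_graph +
  fixes k :: nat
  assumes deg: "u \<in> V \<Longrightarrow> card (nb u) = k"
    and tri: "u \<in> V \<Longrightarrow> v \<in> V \<Longrightarrow> E u v \<Longrightarrow> nb u \<inter> nb v = {}"
    and quad: "u \<in> V \<Longrightarrow> v \<in> V \<Longrightarrow> u \<noteq> v \<Longrightarrow> \<not> E u v \<Longrightarrow> card (nb u \<inter> nb v) = 1"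
    and k_ge: "k \<ge> 2"
    and nonempty: "V \<noteq> {}"
begin

lemma no_tri: "a \<in> V \<Longrightarrow> b \<in> V \<Longrightarrow> c \<in> V \<Longrightarrow> E a b \<Longrightarrow> E b c \<Longrightarrow> E a c \<Longrightarrow> False"
  using tri[of a c] sym by (metis IntI emptyE in_nb)

lemma uniq:
  assumes "u \<in> V" "v \<in> V" "x \<in> V" "y \<in> V" "u \<noteq> v" "E u x" "E v x" "E u y" "E v y"
  shows "x = y"
proof -
  have "\<not> E u v" using no_tri[of u v x] assms by blast
  then have "card (nb u \<inter> nb v) = 1" using quad assms by blast
  moreover have "x \<in> nb u \<inter> nb v" "y \<in> nb u \<inter> nb v" using assms by auto
  ultimately show ?thesis by (metis card_1_singletonE singletonD)
qed

lemma common: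
  assumes "u \<in> V" "v \<in> V" "u \<noteq> v" "\<not> E u v"
  obtains x where "x \<in> V" "E u x" "E v x"
proof -
  have "card (nb u \<inter> nb v) = 1" using quad assms by blast
  then obtain x where "nb u \<inter> nb v = {x}" using card_1_singletonE by blast
  then have "x \<in> nb u \<inter> nb v" by blast
  then show ?thesis using that by auto
qed

text \<open>Gives Moore graphs access to \<open>edges_to_nonneighbours\<close> and
  \<open>pentagon_labelling_exists\<close>.\<close>

lemma moore_local_terwilliger: "local_terwilliger V E k 1"
proof unfold_locales
  show "u \<in> V \<Longrightarrow> card (nb u) = k" for u by (rule deg)
  show "u \<in> V \<Longrightarrow> v \<in> V \<Longrightarrow> u \<noteq> v \<Longrightarrow> \<not> E u v \<Longrightarrow> card (nb u \<inter> nb v) = 1" for u v by (rule quad)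
  show "E x y" if "u \<in> V" "v \<in> V" "u \<noteq> v" "\<not> E u v" "x \<in> nb u \<inter> nb v" "y \<in> nb u \<inter> nb v" "x \<noteq> y" for u v x y
    using uniq[of u v x y] that by auto
  obtain u where u: "u \<in> V" using nonempty by blast
  then obtain x y where "x \<in> nb u" "y \<in> nb u" "x \<noteq> y"
    using deg[OF u] k_ge by (metis card_le_Suc0_iff_eq finite_nb not_less_eq_eq numeral_2_eq_2)
  then show "\<exists>u\<in>V. \<exists>v\<in>V. u \<noteq> v \<and> \<not> E u v" using no_tri[of u x y] u by auto
qed simp

lemma card_V: "card V = k * k + 1"
proof -
  interpret W: local_terwilliger V E k 1 by (rule moore_local_terwilliger)
  obtain u where u: "u \<in> V" using nonempty by blast
  have "card (nb v - cnb u) = k - 1" if v: "v \<in> nb u" for v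
  proof -
    have "nb u \<inter> nb v = {}" using tri[of u v] u v by simp
    then have "nb v - cnb u = nb v - {u}" unfolding cnb_def by blast
    moreover have "u \<in> nb v" using u v sym by auto
    ultimately show ?thesis using deg[of v] v by simp
  qed
  then have "k * (k - 1) = card V - Suc k"
    using W.edges_to_nonneighbours[OF u] deg[OF u] by simp
  moreover have "card V \<ge> card (cnb u)" using u fin by (intro card_mono) auto
  then have "Suc k \<le> card V" using deg[OF u] by (simp add: card_cnb)
  moreover have "k * (k - 1) = k * k - k" by (simp add: diff_mult_distrib2)
  moreover have "k \<le> k * k" by simp
  ultimately show ?thesis by linarith
qed

lemma pentagon_exists:
  obtains p where "pentagon_labelling p"
proof -
  obtain a0 where a0: "a0 \<in> V" using nonempty by blast
  have two: "\<exists>y. y \<in> V \<and> E u y \<and> y \<noteq> z" if "u \<in> V" for u z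
  proof (rule ccontr)
    assume "\<not> ?thesis"
    then have "nb u \<subseteq> {z}" by auto
    then have "card (nb u) \<le> card {z}" by (intro card_mono) auto
    then show False using deg[OF that] k_ge by simp
  qed
  obtain a1 where a1: "a1 \<in> V" "E a0 a1" using two[OF a0] by blast
  obtain a4 where a4: "a4 \<in> V" "E a0 a4" "a4 \<noteq> a1" using two[OF a0] by blast
  obtain a2 where a2: "a2 \<in> V" "E a1 a2" "a2 \<noteq> a0" using two[OF a1(1)] by blast
  have n14: "\<not> E a1 a4" using no_tri[of a0 a1 a4] a0 a1 a4 by blast
  have n02: "\<not> E a0 a2" using no_tri[of a0 a1 a2] a0 a1 a2 by blast
  have n24: "\<not> E a2 a4"
    using uniq[of a1 a4 a0 a2] a0 a1 a2 a4 sym by blast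
  have "a2 \<noteq> a4" using n02 a4 by auto
  then obtain a3 where a3: "a3 \<in> V" "E a2 a3" "E a4 a3" using common[OF a2(1) a4(1)] n24 by metis
  have n13: "\<not> E a1 a3" using no_tri[of a1 a2 a3] a1 a2 a3 by blast
  have n03: "\<not> E a0 a3" using no_tri[of a0 a4 a3] a0 a4 a3 by blast
  have "pentagon_labelling (\<lambda>i. [a0, a1, a2, a3, a4] ! (i mod 5))"
    by (rule pentagon_labellingI) (use a0 a1 a2 a3 a4 n14 n02 n24 n13 n03 sym in auto)
  then show ?thesis using that by blast
qed

section \<open>Hexagons and Petersen subgraphs in degree 7\<close>

text \<open>The adjacency matrix \<open>A\<close> of a Moore graph of degree 7 satisfies \<open>(2 - A)\<^sup>2 = 5 (2 - A) + J\<close>.\<close>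

lemma quadratic_form_nonneg:
  fixes f :: "'a \<Rightarrow> real"
  assumes k: "k = 7" and s: "(\<Sum>v\<in>V. f v) = 0"
  shows "0 \<le> (\<Sum>v\<in>V. f v * (2 * f v - (\<Sum>w\<in>nb v. f w)))"
proof -
  define a where "a v w = (if E v w then 1 else 0 :: real)" for v w
  define S where "S v = (\<Sum>w\<in>V. a v w * f w)" for v
  have S: "(\<Sum>w\<in>nb v. f w) = S v" for v
    unfolding S_def a_def nb_def using fin
    by (simp add: sum.inter_filter if_distrib[of "\<lambda>x. x * _"] cong: if_cong)
  \<comment> \<open>The square of the adjacency matrix, whose entries count common neighbours; it
    equals 6 - A + J.\<close>
  define c where "c w w' = (\<Sum>v\<in>V. a v w * a v w')" for w w'
  have c: "c w w' = (if w = w' then 6 else 0) - a w w' + 1" if ww: "w \<in> V" "w' \<in> V" for w w'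
  proof -
    have "c w w' = (\<Sum>v\<in>V. if v \<in> nb w \<inter> nb w' then 1 else 0)"
      unfolding c_def by (intro sum.cong) (auto simp: a_def E_commute)
    also have "\<dots> = (\<Sum>v\<in>nb w \<inter> nb w'. 1)"
      by (rule sum.mono_neutral_cong_right) (use fin in auto)
    also have "\<dots> = real (card (nb w \<inter> nb w'))" by simp
    finally have *: "c w w' = real (card (nb w \<inter> nb w'))" .
    consider "w = w'" | "E w w'" | "w \<noteq> w'" "\<not> E w w'" by blast
    then show ?thesis
    proof cases
      case 1
      then show ?thesis using * deg ww k by (simp add: a_def irrefl)
    next
      case 2
      then show ?thesis using * tri[OF ww] irrefl by (auto simp: a_def)
    next
      case 3
      then show ?thesis using * quad[OF ww] by (simp add: a_def)
    qed
  qed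
  have "(\<Sum>v\<in>V. S v * S v) = (\<Sum>v\<in>V. \<Sum>w\<in>V. \<Sum>w'\<in>V. a v w * f w * (a v w' * f w'))"
    unfolding S_def by (simp add: sum_product)
  also have "\<dots> = (\<Sum>w\<in>V. \<Sum>v\<in>V. \<Sum>w'\<in>V. a v w * f w * (a v w' * f w'))"
    by (rule sum.swap)
  also have "\<dots> = (\<Sum>w\<in>V. \<Sum>w'\<in>V. \<Sum>v\<in>V. a v w * f w * (a v w' * f w'))"
    by (intro sum.cong refl sum.swap)
  also have "\<dots> = (\<Sum>w\<in>V. \<Sum>w'\<in>V. f w * f w' * c w w')"
    unfolding c_def by (intro sum.cong refl) (simp add: sum_distrib_left mult_ac)
  also have "\<dots> = (\<Sum>w\<in>V. \<Sum>w'\<in>V. (if w = w' then 6 * (f w * f w') else 0) - f w * (a w w' * f w') + f w * f w')"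
    by (intro sum.cong refl) (auto simp: c algebra_simps)
  also have "\<dots> = (\<Sum>w\<in>V. 6 * (f w * f w) - f w * S w + f w * (\<Sum>w'\<in>V. f w'))"
    unfolding S_def by (intro sum.cong refl) (use fin in \<open>simp add: sum.distrib sum_subtractf sum_distrib_left\<close>)
  also have "\<dots> = 6 * (\<Sum>w\<in>V. f w * f w) - (\<Sum>w\<in>V. f w * S w)"
    using s by (simp add: sum.distrib sum_subtractf sum_distrib_left)
  finally have SS: "(\<Sum>v\<in>V. S v * S v) = 6 * (\<Sum>w\<in>V. f w * f w) - (\<Sum>w\<in>V. f w * S w)" .
  \<comment> \<open>The term J vanishes since \<open>f\<close> sums to 0, so this sum of squares is
    5 times the quadratic form.\<close>
  have "0 \<le> (\<Sum>v\<in>V. (2 * f v - S v)\<^sup>2)" by (intro sum_nonneg) auto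
  also have "\<dots> = (\<Sum>v\<in>V. 4 * (f v * f v) - 4 * (f v * S v) + S v * S v)"
    by (intro sum.cong) (auto simp: power2_eq_square algebra_simps)
  also have "\<dots> = 10 * (\<Sum>w\<in>V. f w * f w) - 5 * (\<Sum>w\<in>V. f w * S w)"
    by (simp add: sum.distrib sum_subtractf SS flip: sum_distrib_left)
  finally have "0 \<le> 2 * (\<Sum>w\<in>V. f w * f w) - (\<Sum>w\<in>V. f w * S w)" by simp
  also have "\<dots> = (\<Sum>v\<in>V. f v * (2 * f v - S v))"
    by (simp add: sum_subtractf sum_distrib_left algebra_simps)
  finally show ?thesis by (simp add: S)
qed

text \<open>Any further adjacency would close a triangle or a quadrangle; in particular the other
  neighbours of \<open>w\<close> see nothing of the hexagon. Stated from the viewpoint of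
  \<open>u0\<close> and used in all six rotations.\<close>

lemma hexagon_facts:
  assumes V: "u0 \<in> V" "u1 \<in> V" "u2 \<in> V" "u3 \<in> V" "u4 \<in> V" "u5 \<in> V" "w \<in> V"
    and d: "distinct [u0, u1, u2, u3, u4, u5]"
    and E: "E u0 u1" "E u1 u2" "E u2 u3" "E u3 u4" "E u4 u5" "E u5 u0" and w: "E w u0" "E w u3"
  shows "\<not> E u0 u2" "\<not> E u0 u3" "\<not> E u0 u4" "w \<notin> {u0, u1, u2, u3, u4, u5}"
    "\<not> E w u1" "\<not> E w u2" "\<not> E w u4" "\<not> E w u5"
    "\<And>z. z \<in> V \<Longrightarrow> E w z \<Longrightarrow> z \<noteq> u0 \<Longrightarrow> z \<noteq> u3 \<Longrightarrow> nb z \<inter> {u0, u1, u2, u3, u4, u5} = {} \<and> z \<notin> {u0, u1, u2, u3, u4, u5}"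
proof -
  have E': "E u1 u0" "E u2 u1" "E u3 u2" "E u4 u3" "E u5 u4" "E u0 u5" "E u0 w" "E u3 w"
    using E w sym by blast+
  show n: "\<not> E u0 u2" "\<not> E u0 u4" using no_tri[of u0 u1 u2] no_tri[of u0 u5 u4] V E E' by blast+
  show n03: "\<not> E u0 u3"
  proof
    assume "E u0 u3"
    then have "u1 = u3" using uniq[of u0 u2 u1 u3] V E E' d by auto
    then show False using d by simp
  qed
  have n13: "\<not> E u1 u3" "\<not> E u3 u5" using no_tri[of u1 u2 u3] no_tri[of u3 u4 u5] V E E' by blast+
  show wn: "\<not> E w u1" "\<not> E w u2" "\<not> E w u4" "\<not> E w u5"
    using no_tri[of w u0 u1] no_tri[of w u3 u2] no_tri[of w u3 u4] no_tri[of w u0 u5] V E E' w by blast+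
  show wU: "w \<notin> {u0, u1, u2, u3, u4, u5}" using w n n03 n13 irrefl sym by auto
  fix z assume z: "z \<in> V" "E w z" "z \<noteq> u0" "z \<noteq> u3"
  have zw: "E z w" using z sym by blast
  have z0: "\<not> E z u0" "\<not> E z u3" using no_tri[of z w u0] no_tri[of z w u3] V z zw w by blast+
  have "\<not> E z u1" using uniq[of z u0 w u1] V z zw E E' wU by blast
  moreover have "\<not> E z u5" using uniq[of z u0 w u5] V z zw E E' wU by blast
  moreover have "\<not> E z u2" using uniq[of z u3 w u2] V z zw E E' wU by blast
  moreover have "\<not> E z u4" using uniq[of z u3 w u4] V z zw E E' wU by blast
  moreover have "z \<notin> {u0, u1, u2, u3, u4, u5}" using z wn by auto
  ultimately show "nb z \<inter> {u0, u1, u2, u3, u4, u5} = {} \<and> z \<notin> {u0, u1, u2, u3, u4, u5}"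
    using z0 by auto
qed

text \<open>The vertices \<open>Y\<close> without neighbours on the hexagon induce a subgraph with largest eigenvalue at most 2,
  since otherwise a positive vector on \<open>Y\<close>, made orthogonal to the constants by a constant on the hexagon,
  would contradict the lemma on the quadratic form. If \<open>w0\<close>, \<open>w1\<close>, \<open>w2\<close> had no common neighbour, then
  \<open>Y\<close> would have five leaves, and the vector with value 1 on the leaves and 2 elsewhere would do that.\<close>

lemma hexagon_special:
  assumes k: "k = 7" and V: "u0 \<in> V" "u1 \<in> V" "u2 \<in> V" "u3 \<in> V" "u4 \<in> V" "u5 \<in> V"
    and W: "w0 \<in> V" "w1 \<in> V" "w2 \<in> V"
    and d: "distinct [u0, u1, u2, u3, u4, u5]"
    and E: "E u0 u1" "E u1 u2" "E u2 u3" "E u3 u4" "E u4 u5" "E u5 u0"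
    and w: "E w0 u0" "E w0 u3" "E w1 u1" "E w1 u4" "E w2 u2" "E w2 u5"
  shows "\<exists>a\<in>V. E a w0 \<and> E a w1 \<and> E a w2"
proof (rule ccontr)
  assume no: "\<not> ?thesis"
  have E': "E u1 u0" "E u2 u1" "E u3 u2" "E u4 u3" "E u5 u4" "E u0 u5"
     "E u0 w0" "E u3 w0" "E u1 w1" "E u4 w1" "E u2 w2" "E u5 w2"
    using E w sym by blast+
  define U where "U = {u0, u1, u2, u3, u4, u5}"
  define Ws where "Ws = {w0, w1, w2}"
  have Uperm: "{u1, u2, u3, u4, u5, u0} = U" "{u2, u3, u4, u5, u0, u1} = U" "{u3, u4, u5, u0, u1, u2} = U"
    "{u4, u5, u0, u1, u2, u3} = U" "{u5, u0, u1, u2, u3, u4} = U"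
    by (auto simp: U_def)
  note h0 = hexagon_facts[of u0 u1 u2 u3 u4 u5 w0, OF V W(1) d E w(1,2), folded U_def]
  have d1: "distinct [u1, u2, u3, u4, u5, u0]" "distinct [u2, u3, u4, u5, u0, u1]"
    "distinct [u3, u4, u5, u0, u1, u2]" "distinct [u4, u5, u0, u1, u2, u3]" "distinct [u5, u0, u1, u2, u3, u4]"
    using d by auto
  note h1 = hexagon_facts[of u1 u2 u3 u4 u5 u0 w1, OF V(2,3,4,5,6,1) W(2) d1(1) E(2,3,4,5,6,1) w(3,4), unfolded Uperm]
  note h2 = hexagon_facts[of u2 u3 u4 u5 u0 u1 w2, OF V(3,4,5,6,1,2) W(3) d1(2) E(3,4,5,6,1,2) w(5,6), unfolded Uperm]
  note h3 = hexagon_facts[of u3 u4 u5 u0 u1 u2 w0, OF V(4,5,6,1,2,3) W(1) d1(3) E(4,5,6,1,2,3) w(2,1), unfolded Uperm]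
  note h4 = hexagon_facts[of u4 u5 u0 u1 u2 u3 w1, OF V(5,6,1,2,3,4) W(2) d1(4) E(5,6,1,2,3,4) w(4,3), unfolded Uperm]
  note h5 = hexagon_facts[of u5 u0 u1 u2 u3 u4 w2, OF V(6,1,2,3,4,5) W(3) d1(5) E(6,1,2,3,4,5) w(6,5), unfolded Uperm]
  have UV: "U \<subseteq> V" "finite U" "card U = 6" using V d by (auto simp: U_def)
  have WV: "Ws \<subseteq> V" "finite Ws" using W by (auto simp: Ws_def)
  have wne: "w0 \<noteq> w1" "w0 \<noteq> w2" "w1 \<noteq> w2" using w h0 h1 h2 by auto
  then have cW: "card Ws = 3" by (simp add: Ws_def)
  have WU: "Ws \<inter> U = {}" using h0(4) h1(4) h2(4) by (auto simp: Ws_def)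
  have wU: "nb w0 \<inter> U = {u0, u3}" "nb w1 \<inter> U = {u1, u4}" "nb w2 \<inter> U = {u2, u5}"
    using w V h0(5-8) h1(5-8) h2(5-8) by (auto simp: U_def)
  have uU: "card (nb u \<inter> U) = 2" if "u \<in> U" for u
  proof -
    have "nb u0 \<inter> U = {u1, u5}" "nb u1 \<inter> U = {u0, u2}" "nb u2 \<inter> U = {u1, u3}"
      "nb u3 \<inter> U = {u2, u4}" "nb u4 \<inter> U = {u3, u5}" "nb u5 \<inter> U = {u0, u4}"
      using E E' V h0(1-3) h1(1-3) h2(1-3) h3(1-3) h4(1-3) h5(1-3) irrefl by (auto simp: U_def)
    then have c2: "card (nb u0 \<inter> U) = 2" "card (nb u1 \<inter> U) = 2" "card (nb u2 \<inter> U) = 2"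
      "card (nb u3 \<inter> U) = 2" "card (nb u4 \<inter> U) = 2" "card (nb u5 \<inter> U) = 2"
      using d by simp_all
    have "u = u0 \<or> u = u1 \<or> u = u2 \<or> u = u3 \<or> u = u4 \<or> u = u5" using that by (simp add: U_def)
    then show ?thesis using c2 by blast
  qed
  \<comment> \<open>Two vertices of the hexagon are adjacent, or two apart and joined on it, or
    opposite and joined by a vertex of \<open>Ws\<close>. Hence a vertex elsewhere has at most one
    neighbour on the hexagon.\<close>
  have pairs: "E x y \<or> (\<exists>m\<in>U. E x m \<and> E y m) \<or> (\<exists>z\<in>Ws. E x z \<and> E y z)"
    if "x \<in> U" "y \<in> U" "x \<noteq> y" for x y
    using that E E' unfolding U_def Ws_def by blast
  define c where "c z = card (nb z \<inter> U)" for z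
  have c1: "c z \<le> 1" if z: "z \<in> V" "z \<notin> U" "z \<notin> Ws" for z
  proof (rule ccontr)
    assume "\<not> c z \<le> 1"
    then obtain x y where xy: "x \<in> nb z \<inter> U" "y \<in> nb z \<inter> U" "x \<noteq> y"
      unfolding c_def by (metis One_nat_def card_le_Suc0_iff_eq finite_Int finite_nb)
    then have E2: "E x z" "E y z" "x \<in> V" "y \<in> V" using sym by auto
    consider "E x y" | m where "m \<in> U" "E x m" "E y m" | t where "t \<in> Ws" "E x t" "E y t"
      using pairs[of x y] xy by blast
    then show False
    proof cases
      case 1
      then show False using no_tri[of x y z] E2 z by blast
    next
      case 2
      then have "z = m" using uniq[of x y z m] E2 xy(3) z UV by blast
      then show False using 2 z by blast
    next
      case 3
      then have "z = t" using uniq[of x y z t] E2 xy(3) z WV by blast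
      then show False using 3 z by blast
    qed
  qed
  have cWs: "c z = 2" if "z \<in> Ws" for z
    using that wU d by (auto simp: Ws_def c_def)
  define Y where "Y = {z \<in> V. z \<notin> U \<and> c z = 0}"
  define X where "X = {z \<in> V. z \<notin> U \<and> z \<notin> Ws \<and> c z = 1}"
  have YV: "Y \<subseteq> V" "finite Y" using fin by (auto simp: Y_def)
  have XV: "X \<subseteq> V" "finite X" using fin by (auto simp: X_def)
  have YW: "Y \<inter> Ws = {}" using cWs by (auto simp: Y_def)
  have Vsplit: "V = U \<union> Ws \<union> X \<union> Y"
  proof -
    have "c z = 0 \<or> c z = 1" if "z \<in> V" "z \<notin> U" "z \<notin> Ws" for z using c1[OF that] by linarith
    then show ?thesis using UV(1) WV(1) unfolding X_def Y_def by blast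
  qed
  have disj: "U \<inter> Ws = {}" "(U \<union> Ws) \<inter> X = {}" "(U \<union> Ws \<union> X) \<inter> Y = {}"
    using WU YW by (auto simp: X_def Y_def)
  have nbY: "nb y \<inter> U = {}" if "y \<in> Y" for y
    using that by (auto simp: Y_def c_def)
  \<comment> \<open>Of the 6 * 7 = 42 edge ends at the hexagon, 12 come from itself and 6 from
    \<open>Ws\<close>, so \<open>X\<close> has 24 vertices, and 50 - 6 - 3 - 24 = 17 remain for
    \<open>Y\<close>.\<close>
  have "(\<Sum>v\<in>V. c v) = (\<Sum>v\<in>U. card (nb v))"
  proof -
    have "(\<Sum>v\<in>V. c v) = (\<Sum>v\<in>V. card {u \<in> U. E v u})"
      unfolding c_def using UV by (intro sum.cong arg_cong[of _ _ card]) auto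
    also have "\<dots> = (\<Sum>u\<in>U. card {v \<in> V. E v u})"
      by (rule sum_card_edges_commute) (use fin UV in auto)
    also have "\<dots> = (\<Sum>u\<in>U. card (nb u))"
      by (intro sum.cong arg_cong[of _ _ card]) (auto simp: E_commute)
    finally show ?thesis .
  qed
  also have "\<dots> = (\<Sum>v\<in>U. 7)" using deg UV k by (intro sum.cong) auto
  finally have "(\<Sum>v\<in>V. c v) = 42" using UV by simp
  moreover have "(\<Sum>v\<in>V. c v) = (\<Sum>v\<in>U. c v) + (\<Sum>v\<in>Ws. c v) + (\<Sum>v\<in>X. c v) + (\<Sum>v\<in>Y. c v)"
    unfolding Vsplit using disj UV WV XV YV by (simp add: sum.union_disjoint)
  moreover have "(\<Sum>v\<in>U. c v) = 12" using uU UV by (simp add: c_def)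
  moreover have "(\<Sum>v\<in>Ws. c v) = 6" using cWs cW by simp
  moreover have "(\<Sum>v\<in>X. c v) = card X" by (simp add: X_def)
  moreover have "(\<Sum>v\<in>Y. c v) = 0" by (simp add: Y_def)
  ultimately have cX: "card X = 24" by simp
  have "card V = card U + card Ws + card X + card Y"
    unfolding Vsplit using disj UV WV XV YV by (simp add: card_Un_disjoint)
  then have cY: "card Y = 17" using card_V k UV cW cX by simp
  define e where "e y = card (nb y \<inter> Ws)" for y
  \<comment> \<open>\<open>y\<close> has one common neighbour with each of the six hexagon vertices;
    a neighbour in \<open>Ws\<close> accounts for two of them and one in \<open>X\<close> for one.
    As the degree is 7, this leaves \<open>1 + e y\<close> neighbours in \<open>Y\<close>.\<close>
  have degY: "card (nb y \<inter> Y) = 1 + e y" if y: "y \<in> Y" for y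
  proof -
    have yV: "y \<in> V" "y \<notin> U" using y by (auto simp: Y_def)
    have "(\<Sum>z\<in>nb y. c z) = (\<Sum>z\<in>nb y. card {u \<in> U. E z u})"
      unfolding c_def using UV by (intro sum.cong arg_cong[of _ _ card]) auto
    also have "\<dots> = (\<Sum>u\<in>U. card {z \<in> nb y. E z u})"
      by (rule sum_card_edges_commute) (use UV in auto)
    also have "\<dots> = (\<Sum>u\<in>U. 1)"
    proof (intro sum.cong refl)
      fix u assume u: "u \<in> U"
      have "{z \<in> nb y. E z u} = nb y \<inter> nb u" by (auto simp: E_commute)
      moreover have "\<not> E y u" using nbY[OF y] u UV(1) by (metis IntI empty_iff in_nb subsetD)
      moreover have "y \<noteq> u" using yV u by auto
      ultimately show "card {z \<in> nb y. E z u} = 1" using quad[of y u] yV u UV by auto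
    qed
    finally have s6: "(\<Sum>z\<in>nb y. c z) = 6" using UV by simp
    have split: "nb y = (nb y \<inter> Ws) \<union> (nb y \<inter> X) \<union> (nb y \<inter> Y)"
      using nbY[OF y] Vsplit nb_subset[of y] by blast
    have dj: "(nb y \<inter> Ws) \<inter> (nb y \<inter> X) = {}" "((nb y \<inter> Ws) \<union> (nb y \<inter> X)) \<inter> (nb y \<inter> Y) = {}"
      using disj by blast+
    have "(\<Sum>z\<in>nb y. c z) = (\<Sum>z\<in>nb y \<inter> Ws. c z) + (\<Sum>z\<in>nb y \<inter> X. c z) + (\<Sum>z\<in>nb y \<inter> Y. c z)"
      by (subst split, subst sum.union_disjoint, simp, simp, rule dj(2), subst sum.union_disjoint, simp, simp, rule dj(1), rule refl)
    moreover have "(\<Sum>z\<in>nb y \<inter> Ws. c z) = 2 * e y" using cWs by (simp add: e_def)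
    moreover have "(\<Sum>z\<in>nb y \<inter> X. c z) = card (nb y \<inter> X)" by (simp add: X_def)
    moreover have "(\<Sum>z\<in>nb y \<inter> Y. c z) = 0" by (simp add: Y_def)
    moreover have "card (nb y) = e y + card (nb y \<inter> X) + card (nb y \<inter> Y)"
      unfolding e_def by (subst split, subst card_Un_disjoint, simp, simp, rule dj(2), subst card_Un_disjoint, simp, simp, rule dj(1), rule refl)
    ultimately show ?thesis using s6 deg[OF yV(1)] k by simp
  qed
  have nbW: "nb z - U \<subseteq> Y" if z: "z \<in> Ws" for z
  proof
    fix x assume x: "x \<in> nb z - U"
    have "nb x \<inter> U = {}"
      using z x h0(9)[of x] h1(9)[of x] h2(9)[of x] by (auto simp: Ws_def U_def)
    then show "x \<in> Y" using x by (auto simp: Y_def c_def)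
  qed
  have wY: "card (nb z \<inter> Y) = 5" if z: "z \<in> Ws" for z
  proof -
    have "nb z \<inter> Y = nb z - (nb z \<inter> U)" using nbW[OF z] disj by blast
    moreover have "card (nb z - (nb z \<inter> U)) = card (nb z) - card (nb z \<inter> U)"
      by (rule card_Diff_subset) auto
    ultimately show ?thesis using cWs[OF z] deg[of z] z WV k by (auto simp: c_def)
  qed
  have ww1: "card (nb z \<inter> Y \<inter> (nb z' \<inter> Y)) = 1"
    if z: "z \<in> Ws" "z' \<in> Ws" "z \<noteq> z'" for z z'
  proof -
    have "(nb w0 \<inter> U) \<inter> (nb w1 \<inter> U) = {}" "(nb w0 \<inter> U) \<inter> (nb w2 \<inter> U) = {}" "(nb w1 \<inter> U) \<inter> (nb w2 \<inter> U) = {}"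
      unfolding wU using d by auto
    then have dU: "nb z \<inter> nb z' \<inter> U = {}" using z unfolding Ws_def by blast
    have zV: "z \<in> V" "z' \<in> V" using z WV by auto
    note nY = nbW[OF z(1)]
    have "\<not> E z z'"
    proof
      assume "E z z'"
      then have "z' \<in> nb z - U" using zV z WU by auto
      then show False using nY z YW by blast
    qed
    then have "card (nb z \<inter> nb z') = 1" using quad zV z(3) by blast
    moreover have "nb z \<inter> Y \<inter> (nb z' \<inter> Y) = nb z \<inter> nb z'" using nY dU by blast
    ultimately show ?thesis by simp
  qed
  define N where "N = nb w0 \<inter> Y \<union> nb w1 \<inter> Y \<union> nb w2 \<inter> Y"
  \<comment> \<open>Each vertex of \<open>Ws\<close> has 5 neighbours in \<open>Y\<close> and any
    two share one. Without a vertex common to all three, the union has 15 - 3 = 12 elements.\<close>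
  have cN: "card N = 12"
  proof -
    have "nb w0 \<inter> Y \<inter> (nb w1 \<inter> Y) \<inter> (nb w2 \<inter> Y) = {}"
    proof (rule equals0I)
      fix x assume "x \<in> nb w0 \<inter> Y \<inter> (nb w1 \<inter> Y) \<inter> (nb w2 \<inter> Y)"
      then have "x \<in> V" "E x w0" "E x w1" "E x w2" using sym by auto
      then show False using no by blast
    qed
    then have "card ((nb w0 \<inter> Y \<union> nb w1 \<inter> Y) \<inter> (nb w2 \<inter> Y))
        = card (nb w0 \<inter> Y \<inter> (nb w2 \<inter> Y)) + card (nb w1 \<inter> Y \<inter> (nb w2 \<inter> Y))"
      unfolding Int_Un_distrib2 by (intro card_Un_disjoint) (use YV in auto)
    also have "\<dots> = 2" using ww1[of w0 w2] ww1[of w1 w2] wne by (simp add: Ws_def)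
    finally have i2: "card ((nb w0 \<inter> Y \<union> nb w1 \<inter> Y) \<inter> (nb w2 \<inter> Y)) = 2" .
    have "card (nb w0 \<inter> Y) + card (nb w1 \<inter> Y) = card (nb w0 \<inter> Y \<union> nb w1 \<inter> Y) + 1"
      using card_Un_Int[of "nb w0 \<inter> Y" "nb w1 \<inter> Y"] ww1[of w0 w1] wne YV by (simp add: Ws_def)
    moreover have "card (nb w0 \<inter> Y \<union> nb w1 \<inter> Y) + card (nb w2 \<inter> Y) = card N + 2"
      using card_Un_Int[of "nb w0 \<inter> Y \<union> nb w1 \<inter> Y" "nb w2 \<inter> Y"] i2 YV by (simp add: N_def)
    ultimately show ?thesis using wY by (simp add: Ws_def)
  qed
  define L where "L = Y - N"
  have NY: "N \<subseteq> Y" "finite N" using YV by (auto simp: N_def)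
  have cL: "card L = 5" using cY cN NY by (simp add: L_def card_Diff_subset)
  have LV: "L \<subseteq> Y" "finite L" using YV by (auto simp: L_def)
  have eL: "e y = 0" if "y \<in> L" for y
  proof -
    have "nb y \<inter> Ws = {}" using that sym LV YV by (auto simp: L_def N_def Ws_def)
    then show ?thesis by (simp add: e_def)
  qed
  have se: "(\<Sum>y\<in>Y. e y) = 15"
  proof -
    have "(\<Sum>y\<in>Y. e y) = (\<Sum>y\<in>Y. card {z \<in> Ws. E y z})"
      unfolding e_def using WV by (intro sum.cong arg_cong[of _ _ card]) auto
    also have "\<dots> = (\<Sum>z\<in>Ws. card {y \<in> Y. E y z})"
      by (rule sum_card_edges_commute) (use WV YV in auto)
    also have "\<dots> = (\<Sum>z\<in>Ws. card (nb z \<inter> Y))"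
      using YV by (intro sum.cong arg_cong[of _ _ card]) (auto simp: E_commute)
    finally show ?thesis using wY cW by simp
  qed
  define m where "m y = card (nb y \<inter> L)" for y
  have sm: "(\<Sum>y\<in>Y. m y) = 5"
  proof -
    have "(\<Sum>y\<in>Y. m y) = (\<Sum>y\<in>Y. card {z \<in> L. E y z})"
      unfolding m_def using LV YV by (intro sum.cong arg_cong[of _ _ card]) auto
    also have "\<dots> = (\<Sum>z\<in>L. card {y \<in> Y. E y z})"
      by (rule sum_card_edges_commute) (use LV YV in auto)
    also have "\<dots> = (\<Sum>z\<in>L. card (nb z \<inter> Y))"
      using YV by (intro sum.cong arg_cong[of _ _ card]) (auto simp: E_commute)
    also have "\<dots> = (\<Sum>z\<in>L. 1)" using degY eL LV by (intro sum.cong) auto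
    finally show ?thesis using cL by simp
  qed
  \<comment> \<open>Five leaves of value 1 and twelve vertices of value 2 give 29; the value on the
    six hexagon vertices makes the sum vanish.\<close>
  define f :: "'a \<Rightarrow> real" where
    "f v = (if v \<in> U then - 29 / 6 else if v \<in> L then 1 else if v \<in> Y then 2 else 0)" for v
  have fU: "f v = - 29 / 6" if "v \<in> U" for v using that by (simp add: f_def)
  have fL: "f v = 1" if "v \<in> L" for v using that LV disj by (auto simp: f_def)
  have fN: "f v = 2" if "v \<in> N" for v using that NY disj by (auto simp: f_def L_def)
  have f0: "f v = 0" if "v \<notin> U" "v \<notin> Y" for v using that LV by (auto simp: f_def)
  have YLN: "Y = L \<union> N" "L \<inter> N = {}" using NY by (auto simp: L_def)
  have sumV: "(\<Sum>v\<in>V. g v) = (\<Sum>v\<in>U. g v) + (\<Sum>v\<in>Y. g v)"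
    if "\<And>v. v \<in> V \<Longrightarrow> v \<notin> U \<Longrightarrow> v \<notin> Y \<Longrightarrow> g v = 0" for g :: "'a \<Rightarrow> real"
  proof -
    have "(\<Sum>v\<in>V. g v) = (\<Sum>v\<in>U \<union> Y. g v)"
      by (rule sum.mono_neutral_right) (use fin UV YV that in auto)
    also have "\<dots> = (\<Sum>v\<in>U. g v) + (\<Sum>v\<in>Y. g v)"
      by (rule sum.union_disjoint) (use UV YV disj in auto)
    finally show ?thesis .
  qed
  have "(\<Sum>v\<in>Y. f v) = (\<Sum>v\<in>L. f v) + (\<Sum>v\<in>N. f v)"
    unfolding YLN(1) by (rule sum.union_disjoint) (use LV NY YLN in auto)
  also have "\<dots> = 29" using fL fN cL cN by simp
  finally have fs: "(\<Sum>v\<in>V. f v) = 0"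
    using sumV[of f] f0 fU UV by simp
  define T where "T v = (\<Sum>z\<in>nb v. f z)" for v
  \<comment> \<open>A hexagon vertex has two neighbours on the hexagon and none in \<open>Y\<close>,
    so the hexagon contributes 0 to the form.\<close>
  have TU: "T v = 2 * f v" if v: "v \<in> U" for v
  proof -
    have "T v = (\<Sum>z\<in>nb v \<inter> U. f z)"
      unfolding T_def
    proof (rule sum.mono_neutral_right)
      show "\<forall>z\<in>nb v - nb v \<inter> U. f z = 0"
      proof
        fix z assume z: "z \<in> nb v - nb v \<inter> U"
        have "v \<in> nb z \<inter> U" using z v UV sym by auto
        then have "z \<notin> Y" using nbY by blast
        then show "f z = 0" using z f0 by auto
      qed
    qed auto
    also have "\<dots> = (\<Sum>z\<in>nb v \<inter> U. - 29 / 6)" using fU by (intro sum.cong) auto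
    finally show ?thesis using uU[OF v] fU[OF v] by simp
  qed
  have TY: "T v = 2 + 2 * real (e v) - real (m v)" if v: "v \<in> Y" for v
  proof -
    have "T v = (\<Sum>z\<in>nb v \<inter> Y. f z)"
      unfolding T_def by (rule sum.mono_neutral_right) (use nbY[OF v] f0 in auto)
    also have "\<dots> = (\<Sum>z\<in>nb v \<inter> Y. 2 - (if z \<in> L then 1 else 0))"
      by (intro sum.cong) (use fL fN YLN in auto)
    also have "\<dots> = 2 * real (card (nb v \<inter> Y)) - real (card (nb v \<inter> Y \<inter> L))"
      by (simp add: sum_subtractf sum.If_cases)
    also have "nb v \<inter> Y \<inter> L = nb v \<inter> L" using LV by auto
    finally show ?thesis using degY[OF v] by (simp add: m_def)
  qed
  have "0 \<le> (\<Sum>v\<in>V. f v * (2 * f v - T v))"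
    unfolding T_def by (rule quadratic_form_nonneg[OF k fs])
  also have "\<dots> = (\<Sum>v\<in>Y. f v * (2 * f v - T v))"
    using sumV[of "\<lambda>v. f v * (2 * f v - T v)"] f0 TU by simp
  also have "\<dots> \<le> (\<Sum>v\<in>Y. (if v \<in> L then 0 else 4) - 4 * real (e v) + 2 * real (m v))"
  proof (rule sum_mono)
    fix v assume v: "v \<in> Y"
    show "f v * (2 * f v - T v) \<le> (if v \<in> L then 0 else 4) - 4 * real (e v) + 2 * real (m v)"
    proof (cases "v \<in> L")
      case True
      then show ?thesis using TY[OF v] fL eL by simp
    next
      case False
      then have "f v = 2" using fN v YLN by blast
      then show ?thesis using TY[OF v] False by (simp add: algebra_simps)
    qed
  qed
  also have "\<dots> = (\<Sum>v\<in>Y. if v \<in> L then 0 else 4) - 4 * real (\<Sum>v\<in>Y. e v) + 2 * real (\<Sum>v\<in>Y. m v)"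
    by (simp add: sum.distrib sum_subtractf sum_distrib_left)
  also have "(\<Sum>v\<in>Y. if v \<in> L then 0 else 4 :: real) = 4 * real (card (Y - L))"
    using YV by (simp add: sum.If_cases Diff_eq)
  also have "Y - L = N" using YLN by blast
  \<comment> \<open>The total is 4 * 12 - 4 * 15 + 2 * 5 = -2.\<close>
  finally show False using se sm cN by simp
qed

text \<open>A pentagon \<open>p0, \<dots>, p4\<close> together with a further neighbour \<open>a\<close> of \<open>p0\<close> extends to a Petersen subgraph.
  The path \<open>p1, p2, p3, p4\<close> lies on five hexagons, and the map sending such a hexagon to the vertex \<open>a\<close>
  provided by the preceding lemma is injective, hence onto the five possible vertices \<open>a\<close>.\<close>

lemma petersen_completion:
  assumes k: "k = 7" and V: "p0 \<in> V" "p1 \<in> V" "p2 \<in> V" "p3 \<in> V" "p4 \<in> V"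
    and E: "E p0 p1" "E p1 p2" "E p2 p3" "E p3 p4" "E p4 p0"
    and a: "a \<in> V" "E p0 a" "a \<noteq> p1" "a \<noteq> p4"
  obtains y1 y2 y3 y4 where "y1 \<in> V" "y2 \<in> V" "y3 \<in> V" "y4 \<in> V"
    "E p1 y1" "E p2 y2" "E p3 y3" "E p4 y4" "E a y2" "E a y3" "E y2 y4" "E y1 y3" "E y4 y1"
proof -
  have E': "E p1 p0" "E p2 p1" "E p3 p2" "E p4 p3" "E p0 p4" using E sym by blast+
  have n: "\<not> E p0 p2" "\<not> E p0 p3" "\<not> E p1 p3" "\<not> E p1 p4" "\<not> E p2 p4"
    using no_tri[of p0 p1 p2] no_tri[of p0 p4 p3] no_tri[of p1 p2 p3] no_tri[of p1 p0 p4] no_tri[of p2 p3 p4]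
      V E E' by blast+
  have ne: "p0 \<noteq> p2" "p0 \<noteq> p3" "p1 \<noteq> p3" "p1 \<noteq> p4" "p2 \<noteq> p4" "p1 \<noteq> p2" "p2 \<noteq> p3" "p3 \<noteq> p4"
    using n E E' irrefl by metis+
  define A where "A = nb p0 - {p1, p4}"
  define B where "B = nb p4 - {p0, p3}"
  have cA: "card A = 5" "finite A"
    using deg[of p0] k V E E' ne by (auto simp: A_def card_Diff_subset)
  have cB: "card B = 5" "finite B"
    using deg[of p4] k V E E' ne by (auto simp: B_def card_Diff_subset)
  \<comment> \<open>The hexagon is \<open>p1, p2, p3, p4, v, u\<close>. Its opposite pairs
    \<open>p1, p4\<close> and \<open>p2, v\<close> and \<open>p3, u\<close> are joined by
    \<open>p0\<close>, \<open>y2\<close> and \<open>y3\<close>.\<close>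
  define P where "P v a' \<longleftrightarrow> (\<exists>u\<in>V. \<exists>y2\<in>V. \<exists>y3\<in>V. E v u \<and> E u p1 \<and> E v y2 \<and> E y2 p2 \<and> E u y3 \<and> E y3 p3 \<and>
      E a' y2 \<and> E a' y3)" for v a'
  have ex: "\<exists>a'\<in>A. P v a'" if v: "v \<in> B" for v
  proof -
    have vV: "v \<in> V" "E p4 v" "E v p4" "v \<noteq> p0" "v \<noteq> p3" using v sym by (auto simp: B_def)
    have v1: "\<not> E v p1" using uniq[of v p0 p1 p4] uniq[of p1 p4 p0 v] V E E' vV sym ne by metis
    have "v \<noteq> p1" using vV n sym by auto
    then obtain u where u: "u \<in> V" "E v u" "E p1 u" using common[OF vV(1) V(2)] v1 by metis
    have u4: "u \<noteq> p4" using u n by auto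
    have v2: "\<not> E v p2"
    proof
      assume "E v p2"
      then have "v = p3" using uniq[of p2 p4 v p3] V E E' vV ne sym by blast
      then show False using vV by simp
    qed
    have v2': "v \<noteq> p2" using vV n sym by auto
    have u2: "u \<noteq> p2" using u v2 by auto
    have u3: "u \<noteq> p3" using u n by auto
    have u0: "u \<noteq> p0"
    proof
      assume "u = p0"
      then show False using no_tri[of v p4 p0] vV V E u by blast
    qed
    have nu3: "\<not> E u p3"
    proof
      assume "E u p3"
      then have "u = p2" using uniq[of p1 p3 u p2] V E E' u ne sym by blast
      then show False using u2 by simp
    qed
    obtain y2 where y2: "y2 \<in> V" "E v y2" "E p2 y2" using common[OF vV(1) V(3) v2' v2] by blast
    obtain y3 where y3: "y3 \<in> V" "E u y3" "E p3 y3" using common[OF u(1) V(4) u3 nu3] by blast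
    have uv: "u \<noteq> v" using u irrefl by auto
    have u1: "u \<noteq> p1" using u irrefl by auto
    have "\<exists>a'\<in>V. E a' p0 \<and> E a' y2 \<and> E a' y3"
    proof (rule hexagon_special[of p1 p2 p3 p4 v u])
      show "distinct [p1, p2, p3, p4, v, u]"
        using ne u1 u2 u3 u4 uv vV v2' \<open>v \<noteq> p1\<close> irrefl by auto
      show "E p0 p1" "E p0 p4" "E y2 p2" "E y2 v" "E y3 p3" "E y3 u"
        using E E' y2 y3 sym by auto
    qed (use k V E E' vV u y2 y3 sym in auto)
    then obtain a' where a': "a' \<in> V" "E a' p0" "E a' y2" "E a' y3" by blast
    have "a' \<noteq> p1" using no_tri[of p1 y2 p2] V y2 a' E sym by blast
    moreover have "a' \<noteq> p4" using no_tri[of p4 y3 p3] V y3 a' E' sym by blast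
    ultimately have "a' \<in> A" using a' sym by (auto simp: A_def)
    moreover have "P v a'"
      unfolding P_def using u y2 y3 a' sym by blast
    ultimately show ?thesis by blast
  qed
  then obtain \<phi> where phi: "\<And>v. v \<in> B \<Longrightarrow> \<phi> v \<in> A \<and> P v (\<phi> v)" by metis
  \<comment> \<open>\<open>\<phi> v\<close> determines \<open>y\<close> as its common neighbour with
    \<open>p2\<close>, and \<open>y\<close> determines \<open>v\<close> as its common neighbour with
    \<open>p4\<close>.\<close>
  have "inj_on \<phi> B"
  proof (rule inj_onI)
    fix v v' assume vv: "v \<in> B" "v' \<in> B" "\<phi> v = \<phi> v'"
    obtain y where y: "y \<in> V" "E v y" "E y p2" "E (\<phi> v) y" using phi[OF vv(1)] unfolding P_def by blast
    obtain y' where y': "y' \<in> V" "E v' y'" "E y' p2" "E (\<phi> v') y'" using phi[OF vv(2)] unfolding P_def by blast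
    have AV: "\<phi> v \<in> V" "E p0 (\<phi> v)" "\<phi> v \<noteq> p1" "\<phi> v \<noteq> p4" using phi[OF vv(1)] by (auto simp: A_def)
    have "\<phi> v \<noteq> p2" using AV n by auto
    then have "y = y'" using uniq[of "\<phi> v" p2 y y'] AV V y y' vv(3) sym by metis
    moreover have "y \<noteq> p4" using y n sym by blast
    ultimately show "v = v'" using uniq[of y p4 v v'] y y' V vv(1,2) sym unfolding B_def
      by (metis DiffD1 in_nb)
  qed
  then have "card (\<phi> ` B) = 5" using cB by (simp add: card_image)
  moreover have "\<phi> ` B \<subseteq> A" using phi by blast
  ultimately have "\<phi> ` B = A" using card_subset_eq[OF cA(2)] cA(1) by simp
  moreover have "a \<in> A" using a by (auto simp: A_def)
  ultimately obtain v where v: "v \<in> B" "\<phi> v = a" by blast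
  then obtain u y2 y3 where "u \<in> V" "y2 \<in> V" "y3 \<in> V" "E v u" "E u p1" "E v y2" "E y2 p2" "E u y3" "E y3 p3"
      "E a y2" "E a y3"
    using phi[OF v(1)] unfolding P_def by blast
  moreover have "v \<in> V" "E p4 v" using v(1) by (auto simp: B_def)
  ultimately show ?thesis using that[of u y2 y3 v] sym by blast
qed

end

section \<open>Pentagons with matched pentagrams, and the Petersen graph\<close>

lemma mod_5_trichotomy:
  fixes i j :: nat
  shows "i mod 5 = j mod 5 \<or> (i + 1) mod 5 = j mod 5 \<or> (j + 1) mod 5 = i mod 5 \<or>
    (i + 2) mod 5 = j mod 5 \<or> (j + 2) mod 5 = i mod 5"
proof -
  have "a = b \<or> (a + 1) mod 5 = b \<or> (b + 1) mod 5 = a \<or> (a + 2) mod 5 = b \<or> (b + 2) mod 5 = a"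
    if "a < 5" "b < 5" for a b :: nat
    using less_5_cases[OF that(1)] less_5_cases[OF that(2)] by (elim disjE) simp_all
  from this[of "i mod 5" "j mod 5"] show ?thesis by (simp add: mod_simps)
qed

lemma mod_5_double: "(2 * i) mod 5 = (2 * j) mod 5 \<longleftrightarrow> i mod 5 = j mod 5" for i j :: nat
proof
  assume "(2 * i) mod 5 = (2 * j) mod 5"
  then have "(3 * (2 * i)) mod 5 = (3 * (2 * j)) mod 5" by (metis mod_mult_right_eq)
  then show "i mod 5 = j mod 5" using mod_5_cancel(2)[of i "5 * i"] mod_5_cancel(2)[of j "5 * j"] by simp
next
  assume "i mod 5 = j mod 5"
  then show "(2 * i) mod 5 = (2 * j) mod 5" by (metis mod_mult_right_eq)
qed

context moore
begin

lemma pentagonD: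
  assumes "pentagon_labelling p"
  shows "p i \<in> V" "p i = p j \<longleftrightarrow> i mod 5 = j mod 5"
    "E (p i) (p j) \<longleftrightarrow> (i + 1) mod 5 = j mod 5 \<or> (j + 1) mod 5 = i mod 5"
  using assms by (auto simp: pentagon_labelling_def)

text \<open>Two vertices of a pentagon are adjacent or have a common neighbour on it, so a vertex
  outside joined to both would close a triangle or a quadrangle.\<close>

lemma pentagon_outside:
  assumes p: "pentagon_labelling p" and v: "v \<in> V" "v \<notin> range p" "E v (p i)" "E v (p j)"
  shows "i mod 5 = j mod 5"
proof (rule ccontr)
  assume ne: "i mod 5 \<noteq> j mod 5"
  have pne: "p i \<noteq> p j" using pentagonD(2)[OF p] ne by simp
  have via: False if "E (p i) (p l)" "E (p j) (p l)" for l
  proof -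
    have "v = p l"
      using uniq[of "p i" "p j" v "p l"] pentagonD(1)[OF p] v pne that sym by blast
    then show False using v by blast
  qed
  have n: "\<not> E (p i) (p j)" using no_tri[of v "p i" "p j"] v pentagonD(1)[OF p] by blast
  consider "(i + 2) mod 5 = j mod 5" | "(j + 2) mod 5 = i mod 5"
    using mod_5_trichotomy[of i j] ne n unfolding pentagonD(3)[OF p] by blast
  then show False
  proof cases
    case 1
    then show False
      by (intro via[of "i + 1"]) (simp_all add: pentagonD(3)[OF p])
  next
    case 2
    then show False
      by (intro via[of "j + 1"]) (simp_all add: pentagonD(3)[OF p])
  qed
qed

text \<open>\<open>p\<close> and \<open>q\<close> form a Petersen graph: pentagon, inner pentagram
  and spokes. Only \<open>q 0\<close> is asked to lie off the pentagon, since
  \<open>partner_outside\<close> carries this along the pentagram.\<close>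

definition partner :: "(nat \<Rightarrow> 'a) \<Rightarrow> (nat \<Rightarrow> 'a) \<Rightarrow> bool" where
  "partner p q \<longleftrightarrow> pentagon_labelling p \<and> q 0 \<notin> range p \<and> (\<forall>i. q i \<in> V) \<and>
     (\<forall>i j. i mod 5 = j mod 5 \<longrightarrow> q i = q j) \<and> (\<forall>i. E (p i) (q i)) \<and> (\<forall>i. E (q i) (q (i + 2)))"

lemma partnerD:
  assumes "partner p q"
  shows "pentagon_labelling p" "q i \<in> V" "i mod 5 = j mod 5 \<Longrightarrow> q i = q j" "E (p i) (q i)" "E (q i) (p i)"
    "E (q i) (q (i + 2))" "E (q (i + 2)) (q i)"
  using assms sym unfolding partner_def by blast+

text \<open>2 generates the residues modulo 5, so induction can follow the pentagram.\<close>

lemma mod_5_induct_by_2: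
  assumes "Q (0::nat)" and step: "\<And>i. Q i \<Longrightarrow> Q (i + 2)" and per: "\<And>i j. i mod 5 = j mod 5 \<Longrightarrow> Q i \<Longrightarrow> Q j"
  shows "Q i"
proof -
  have "Q (2 * n)" for n by (induction n) (use assms(1) step in \<open>auto simp: add.commute\<close>)
  moreover have "(2 * (3 * i)) mod 5 = i mod 5"
    using mod_5_cancel(2)[of i "5 * i"] by simp
  ultimately show ?thesis using per by blast
qed

text \<open>If \<open>q (i + 2)\<close> were on the pentagon, it would be \<open>p i\<close>, the
  only neighbour of \<open>q i\<close> there; but \<open>p i\<close> is not adjacent to
  \<open>p (i + 2)\<close>.\<close>

lemma partner_outside:
  assumes pq: "partner p q"
  shows "q i \<notin> range p"
proof (rule mod_5_induct_by_2[of "\<lambda>i. q i \<notin> range p"])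
  show "q 0 \<notin> range p" using pq by (simp add: partner_def)
  show "q j \<notin> range p" if "i mod 5 = j mod 5" "q i \<notin> range p" for i j
    using partnerD(3)[OF pq that(1)] that(2) by simp
  fix i assume i: "q i \<notin> range p"
  show "q (i + 2) \<notin> range p"
  proof
    assume "q (i + 2) \<in> range p"
    then obtain l where l: "q (i + 2) = p l" by blast
    have "E (q i) (p l)" "E (q i) (p i)" using partnerD[OF pq] l by metis+
    then have "l mod 5 = i mod 5" using pentagon_outside[OF partnerD(1)[OF pq] _ i] partnerD(2)[OF pq] by blast
    then have "p l = p i" using pentagonD(2)[OF partnerD(1)[OF pq]] by blast
    then have "E (p (i + 2)) (p i)" using partnerD(4)[OF pq, of "i + 2"] l by simp
    then show False
      unfolding pentagonD(3)[OF partnerD(1)[OF pq]] by (simp only: add.assoc mod_5_cancel) simp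
  qed
qed

lemma partner_eqD:
  assumes pq: "partner p q" "partner p q'" and eq: "q i = q' j"
  shows "i mod 5 = j mod 5"
  using pentagon_outside[OF partnerD(1)[OF pq(1)] partnerD(2)[OF pq(1)] partner_outside[OF pq(1)], of i i j]
    partnerD(5)[OF pq(1), of i] partnerD(5)[OF pq(2), of j] eq by simp

text \<open>\<open>q (n + 2)\<close> is the common neighbour of \<open>q n\<close> and
  \<open>p (n + 2)\<close>, so agreement spreads along the pentagram.\<close>

lemma partner_unique:
  assumes pq: "partner p q" "partner p q'" and eq: "q i = q' i"
  shows "q j = q' j"
proof -
  have step: "q (n + 2) = q' (n + 2)" if n: "q n = q' n" for n
  proof (rule uniq[of "q n" "p (n + 2)"])
    show "q n \<noteq> p (n + 2)" using partner_outside[OF pq(1)] by blast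
    show "E (q n) (q' (n + 2))" using partnerD(6)[OF pq(2), of n] n by simp
  qed (use partnerD(2,4,6)[OF pq(1)] partnerD(2,4)[OF pq(2)] pentagonD(1)[OF partnerD(1)[OF pq(1)]] in blast)+
  have "q (i + n) = q' (i + n)" for n
  proof (rule mod_5_induct_by_2[of "\<lambda>n. q (i + n) = q' (i + n)"])
    show "q (i + 0) = q' (i + 0)" using eq by simp
    show "q (i + (n + 2)) = q' (i + (n + 2))" if "q (i + n) = q' (i + n)" for n
      using step[OF that] by (simp add: add.assoc)
    show "q (i + m) = q' (i + m)" if "n mod 5 = m mod 5" "q (i + n) = q' (i + n)" for n m
    proof -
      have "(i + m) mod 5 = (i + n) mod 5" using that(1) mod_5_cancel(1)[of i m n] by simp
      then show ?thesis using partnerD(3)[OF pq(1)] partnerD(3)[OF pq(2)] that(2) by metis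
    qed
  qed
  \<comment> \<open>\<open>i + 4 * i\<close> vanishes modulo 5, so this is the value at
    \<open>j\<close>.\<close>
  from this[of "4 * i + j"] have "q (i + (4 * i + j)) = q' (i + (4 * i + j))" .
  moreover have "(i + (4 * i + j)) mod 5 = j mod 5" by (simp add: mod_simps flip: add.assoc)
  ultimately show ?thesis using partnerD(3)[OF pq(1)] partnerD(3)[OF pq(2)] by metis
qed

text \<open>\<open>q i\<close> and \<open>p j\<close> have only one common neighbour: it is
  \<open>q j\<close> if \<open>i\<close>, \<open>j\<close> are adjacent on the pentagram and
  \<open>p i\<close> if they are adjacent on the pentagon. Equal indices would give a
  triangle.\<close>

lemma partner_neighbour:
  assumes pq: "partner p q" and z: "z \<in> V" "z \<notin> range p" "E z (p j)" "E (q i) z"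
  shows "z = q j \<and> ((i + 2) mod 5 = j mod 5 \<or> (j + 2) mod 5 = i mod 5)"
proof -
  note p = partnerD(1)[OF pq]
  have qp: "q i \<noteq> p j" using partner_outside[OF pq] by blast
  have zq: "E z (q i)" "E (p j) z" using z sym by blast+
  have far: "z = q j" if "E (q i) (q j)"
    using uniq[of "q i" "p j" z "q j"] pentagonD(1)[OF p] partnerD[OF pq] z zq qp that by blast
  have near: False if "E (p i) (p j)"
  proof -
    have "z = p i"
      using uniq[of "q i" "p j" z "p i"] pentagonD(1)[OF p] partnerD[OF pq] z zq qp that sym by blast
    then show False using z by blast
  qed
  have same: False if "i mod 5 = j mod 5"
  proof -
    have "E (q i) (p j)" using partnerD(5)[OF pq, of i] that pentagonD(2)[OF p, of i j] by simp
    then show False using no_tri[of "q i" z "p j"] z zq pentagonD(1)[OF p] partnerD(2)[OF pq] by blast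
  qed
  consider "(i + 2) mod 5 = j mod 5" | "(j + 2) mod 5 = i mod 5"
    using mod_5_trichotomy[of i j] near same unfolding pentagonD(3)[OF p] by blast
  then show ?thesis
  proof cases
    case 1
    then have "q j = q (i + 2)" using partnerD(3)[OF pq] by metis
    then show ?thesis using far partnerD(6)[OF pq, of i] 1 by simp
  next
    case 2
    then have "q i = q (j + 2)" using partnerD(3)[OF pq] by metis
    then show ?thesis using far partnerD(7)[OF pq, of j] 2 by simp
  qed
qed

text \<open>Doubling the index turns steps of 2 into steps of 1, so pentagon and pentagram can
  exchange roles.\<close>

lemma partner_pentagon:
  assumes pq: "partner p q"
  shows "pentagon_labelling (\<lambda>i. q (2 * i))"
  unfolding pentagon_labelling_def
proof (intro conjI allI)
  show "q (2 * i) \<in> V" for i by (rule partnerD[OF pq])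
  show "q (2 * i) = q (2 * j) \<longleftrightarrow> i mod 5 = j mod 5" for i j
    using partner_eqD[OF pq pq, of "2 * i" "2 * j"] partnerD(3)[OF pq, of "2 * i" "2 * j"] mod_5_double[of i j]
    by blast
  show "E (q (2 * i)) (q (2 * j)) \<longleftrightarrow> (i + 1) mod 5 = j mod 5 \<or> (j + 1) mod 5 = i mod 5" for i j
  proof
    assume "E (q (2 * i)) (q (2 * j))"
    then have "(2 * i + 2) mod 5 = (2 * j) mod 5 \<or> (2 * j + 2) mod 5 = (2 * i) mod 5"
      using partner_neighbour[OF pq partnerD(2)[OF pq] partner_outside[OF pq] partnerD(5)[OF pq]] by blast
    then show "(i + 1) mod 5 = j mod 5 \<or> (j + 1) mod 5 = i mod 5"
      using mod_5_double[of "i + 1" j] mod_5_double[of "j + 1" i] by simp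
  next
    assume "(i + 1) mod 5 = j mod 5 \<or> (j + 1) mod 5 = i mod 5"
    then have "(2 * i + 2) mod 5 = (2 * j) mod 5 \<or> (2 * j + 2) mod 5 = (2 * i) mod 5"
      using mod_5_double[of "i + 1" j] mod_5_double[of "j + 1" i] by simp
    then show "E (q (2 * i)) (q (2 * j))"
      using partnerD(3)[OF pq] partnerD(6)[OF pq, of "2 * i"] partnerD(7)[OF pq, of "2 * j"] by metis
  qed
qed

lemma partner_exists_7:
  assumes k: "k = 7" and p: "pentagon_labelling p" and a: "a \<in> V" "E (p 0) a" "a \<notin> range p"
  obtains q where "partner p q" "q 0 = a"
proof -
  have e: "E (p 0) (p 1)" "E (p 1) (p 2)" "E (p 2) (p 3)" "E (p 3) (p 4)" "E (p 4) (p 0)"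
    by (simp_all add: pentagonD(3)[OF p])
  have ne: "a \<noteq> p 1" "a \<noteq> p 4" using a(3) by blast+
  obtain y1 y2 y3 y4 where y: "y1 \<in> V" "y2 \<in> V" "y3 \<in> V" "y4 \<in> V"
    "E (p 1) y1" "E (p 2) y2" "E (p 3) y3" "E (p 4) y4" "E a y2" "E a y3" "E y2 y4" "E y1 y3" "E y4 y1"
    using petersen_completion[OF k pentagonD(1)[OF p] pentagonD(1)[OF p] pentagonD(1)[OF p] pentagonD(1)[OF p]
        pentagonD(1)[OF p] e a(1,2) ne] by blast
  define q where "q i = [a, y1, y2, y3, y4] ! (i mod 5)" for i :: nat
  have q: "q i \<in> V \<and> E (p i) (q i) \<and> E (q i) (q (i + 2))" for i
  proof -
    have pm: "p i = p (i mod 5)" using pentagonD(2)[OF p] by simp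
    have qm: "q i = [a, y1, y2, y3, y4] ! (i mod 5)" "q (i + 2) = [a, y1, y2, y3, y4] ! ((i mod 5 + 2) mod 5)"
      by (simp_all add: q_def mod_simps)
    have "i mod 5 < 5" by simp
    from less_5_cases[OF this] show ?thesis
      unfolding pm qm by (elim disjE) (use a y sym in \<open>simp_all add: nth_Cons_numeral\<close>)
  qed
  have "partner p q" unfolding partner_def using p a q by (auto simp: q_def)
  moreover have "q 0 = a" by (simp add: q_def)
  ultimately show ?thesis using that by blast
qed

lemma outside_neighbours:
  assumes p: "pentagon_labelling p"
  shows "card (nb (p i) - range p) = k - 2"
proof -
  have "nb (p i) \<inter> range p = {p (i + 1), p (i + 4)}"
  proof
    show "{p (i + 1), p (i + 4)} \<subseteq> nb (p i) \<inter> range p"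
    proof -
      have "(i + 4 + 1) mod 5 = i mod 5" by (simp only: add.assoc mod_5_cancel) simp
      then show ?thesis using pentagonD(1,3)[OF p] by auto
    qed
    show "nb (p i) \<inter> range p \<subseteq> {p (i + 1), p (i + 4)}"
    proof
      fix x assume x: "x \<in> nb (p i) \<inter> range p"
      then obtain j where j: "x = p j" by blast
      then have "(i + 1) mod 5 = j mod 5 \<or> (j + 1) mod 5 = i mod 5" using x pentagonD(3)[OF p] by simp
      moreover have "(i + 4) mod 5 = j mod 5" if "(j + 1) mod 5 = i mod 5"
      proof -
        have "(i + 4) mod 5 = (j + 1 + 4) mod 5" using that by (metis mod_add_left_eq)
        also have "\<dots> = j mod 5" by (simp only: add.assoc mod_5_cancel) simp
        finally show ?thesis .
      qed
      ultimately show "x \<in> {p (i + 1), p (i + 4)}" using j pentagonD(2)[OF p] by auto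
    qed
  qed
  moreover have "p (i + 1) \<noteq> p (i + 4)"
    unfolding pentagonD(2)[OF p] by (simp only: add.assoc mod_5_cancel) simp
  ultimately have "card (nb (p i) \<inter> range p) = 2" by simp
  moreover have "card (nb (p i) - range p) = card (nb (p i)) - card (nb (p i) \<inter> range p)"
    by (rule card_Diff_subset_Int) auto
  ultimately show ?thesis using deg pentagonD(1)[OF p] by simp
qed

text \<open>In degree 3 each \<open>p i\<close> has one neighbour \<open>q i\<close> off the
  pentagon. The common neighbour of \<open>q i\<close> and \<open>p (i + 2)\<close> cannot be on the
  pentagon, so it is \<open>q (i + 2)\<close>.\<close>

lemma partner_exists_3:
  assumes k: "k = 3" and p: "pentagon_labelling p"
  obtains q where "partner p q"
proof -
  have "\<exists>y. nb (p i) - range p = {y}" for i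
    using outside_neighbours[OF p, of i] k by (simp add: card_1_singleton_iff)
  then obtain y where y: "nb (p i) - range p = {y i}" for i by metis
  define q where "q i = y (i mod 5)" for i :: nat
  have pm: "p i = p (i mod 5)" for i using pentagonD(2)[OF p] by simp
  have q: "nb (p i) - range p = {q i}" for i unfolding q_def y[symmetric] pm[of i, symmetric] ..
  have qV: "q i \<in> V" "E (p i) (q i)" "E (q i) (p i)" "q i \<notin> range p" for i
  proof -
    have "q i \<in> nb (p i) - range p" using q[of i] by blast
    then show "q i \<in> V" "E (p i) (q i)" "E (q i) (p i)" "q i \<notin> range p" using sym by auto
  qed
  have per: "q i = q j" if "i mod 5 = j mod 5" for i j using that by (simp add: q_def)
  have "E (q i) (q (i + 2))" for i
  proof -
    have n: "\<not> E (q i) (p (i + 2))"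
    proof
      assume "E (q i) (p (i + 2))"
      then have "(i + 2) mod 5 = i mod 5" using pentagon_outside[OF p] qV by blast
      then show False by (simp only: mod_5_cancel) simp
    qed
    have "q i \<noteq> p (i + 2)" using qV by blast
    then obtain x where x: "x \<in> V" "E (q i) x" "E (p (i + 2)) x"
      using common[OF qV(1) pentagonD(1)[OF p]] n by metis
    have "x \<notin> range p"
    proof
      assume "x \<in> range p"
      then obtain l where l: "x = p l" by blast
      then have "l mod 5 = i mod 5" using pentagon_outside[OF p] qV x by metis
      then have "E (p (i + 2)) (p i)" using l x pentagonD(2)[OF p] by metis
      then show False unfolding pentagonD(3)[OF p] by (simp only: add.assoc mod_5_cancel) simp
    qed
    then have "x = q (i + 2)" using q[of "i + 2"] x by auto
    then show ?thesis using x by simp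
  qed
  then have "partner p q" unfolding partner_def using p qV per by blast
  then show ?thesis using that by blast
qed

end

text \<open>The generalised Petersen graph with inner step 2, the shape delivered by
  \<open>partner\<close>; \<open>petersen_label\<close> later translates it to 2-subsets.\<close>

definition petersen_adj :: "nat \<times> nat \<Rightarrow> nat \<times> nat \<Rightarrow> bool" where
  "petersen_adj u v \<longleftrightarrow> (\<exists>i<5. \<exists>(a, b) \<in> {((0, i), (0, (i + 1) mod 5)), ((0, i), (1, i)),
      ((1, i), (1, (i + 2) mod 5))}. (u, v) = (a, b) \<or> (u, v) = (b, a))"

lemma petersen_adjI:
  assumes "i < 5"
  shows "petersen_adj (0, i) (0, (i + 1) mod 5)" "petersen_adj (0, (i + 1) mod 5) (0, i)"
    "petersen_adj (0, i) (1, i)" "petersen_adj (1, i) (0, i)"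
    "petersen_adj (1, i) (1, (i + 2) mod 5)" "petersen_adj (1, (i + 2) mod 5) (1, i)"
  using assms unfolding petersen_adj_def by (blast+)

lemma petersen_degree:
  assumes "w \<in> {0, 1} \<times> {..<5}"
  shows "card {w' \<in> {0, 1} \<times> {..<5}. petersen_adj w w'} \<ge> 3"
proof -
  have *: "3 \<le> card {w' \<in> {0, 1} \<times> {..<5}. petersen_adj w w'}"
    if "S \<subseteq> {0, 1} \<times> {..<5}" "card S = 3" "\<And>w'. w' \<in> S \<Longrightarrow> petersen_adj w w'" for S
  proof -
    have "card S \<le> card {w' \<in> {0, 1} \<times> {..<5}. petersen_adj w w'}"
      by (rule card_mono) (use that in auto)
    then show ?thesis using that by simp
  qed
  consider i where "w = (0, i)" "i < 5" | i where "w = (1, i)" "i < 5"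
    using assms by auto
  then show ?thesis
  proof cases
    case (1 i)
    define j where "j = (i + 4) mod 5"
    have j: "j < 5" "(j + 1) mod 5 = i" "j \<noteq> (i + 1) mod 5"
      using less_5_cases[OF 1(2)] unfolding j_def by auto
    show ?thesis
      by (rule *[of "{(0, (i + 1) mod 5), (0, j), (1, i)}"])
        (use 1 j j(3)[symmetric] petersen_adjI[OF 1(2)] petersen_adjI[OF j(1)] in auto)
  next
    case (2 i)
    define j where "j = (i + 3) mod 5"
    have j: "j < 5" "(j + 2) mod 5 = i" "j \<noteq> (i + 2) mod 5"
      using less_5_cases[OF 2(2)] unfolding j_def by auto
    show ?thesis
      by (rule *[of "{(1, (i + 2) mod 5), (1, j), (0, i)}"])
        (use 2 j j(3)[symmetric] petersen_adjI[OF 2(2)] petersen_adjI[OF j(1)] in auto)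
  qed
qed

lemma (in moore) petersen_unique:
  assumes k: "k = 3"
  obtains g where "bij_betw g ({0, 1} \<times> {..<5}) V"
    "\<And>w w'. w \<in> {0, 1} \<times> {..<5} \<Longrightarrow> w' \<in> {0, 1} \<times> {..<5} \<Longrightarrow> E (g w) (g w') \<longleftrightarrow> petersen_adj w w'"
proof -
  obtain p where p: "pentagon_labelling p" using pentagon_exists by blast
  obtain q where pq: "partner p q" using partner_exists_3[OF k p] by blast
  define g where "g w = (if fst w = 0 then p (snd w) else q (snd w))" for w :: "nat \<times> nat"
  define W :: "(nat \<times> nat) set" where "W = {0, 1} \<times> {..<5}"
  have inj: "inj_on g W"
  proof (rule inj_onI)
    fix u v assume uv: "u \<in> W" "v \<in> W" "g u = g v"
    have pp: "p i = p j \<Longrightarrow> i < 5 \<Longrightarrow> j < 5 \<Longrightarrow> i = j" for i j using pentagonD(2)[OF p, of i j] by simp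
    have qq: "q i = q j \<Longrightarrow> i < 5 \<Longrightarrow> j < 5 \<Longrightarrow> i = j" for i j using partner_eqD[OF pq pq, of i j] by simp
    have qp: "q i \<noteq> p j" "p j \<noteq> q i" for i j using partner_outside[OF pq, of i] by (metis rangeI)+
    show "u = v" using uv qp by (auto simp: W_def g_def intro: pp qq)
  qed
  have sub: "g ` W \<subseteq> V" using pentagonD(1)[OF p] partnerD(2)[OF pq] by (auto simp: g_def W_def)
  have hom: "E (g w) (g w')" if "petersen_adj w w'" for w w'
  proof -
    have 1: "E (p i) (p (Suc i mod 5))" "E (p (Suc i mod 5)) (p i)" for i
      by (simp_all add: pentagonD(3)[OF p])
    have 2: "E (q i) (q ((i + 2) mod 5))" "E (q ((i + 2) mod 5)) (q i)" for i
    proof -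
      have "q ((i + 2) mod 5) = q (i + 2)" by (rule partnerD(3)[OF pq]) simp
      then show "E (q i) (q ((i + 2) mod 5))" "E (q ((i + 2) mod 5)) (q i)" using partnerD(6,7)[OF pq, of i] by simp_all
    qed
    show ?thesis
      using that 1 2 partnerD(4,5)[OF pq] unfolding petersen_adj_def by (auto simp: g_def)
  qed
  have W: "finite W" "g ` W \<subseteq> V" "inj_on g W" using sub inj by (simp_all add: W_def)
  have degV: "card (nb (g w)) = 3" if "w \<in> W" for w using deg W(2) that k by blast
  have degW: "3 \<le> card {w' \<in> W. petersen_adj w w'}" if "w \<in> W" for w
    using petersen_degree that unfolding W_def by blast
  have "card (g ` W) = card V" using card_image[OF inj] card_V k by (simp add: W_def card_cartesian_product)
  then have "g ` W = V" using card_subset_eq[OF fin sub] by blast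
  then have "bij_betw g W V" using inj by (simp add: bij_betw_def)
  moreover have "E (g w) (g w') \<longleftrightarrow> petersen_adj w w'" if "w \<in> W" "w' \<in> W" for w w'
    using regular_embedding_iff[of W g 3 petersen_adj, OF W degV degW hom] that by blast
  ultimately show ?thesis using that unfolding W_def by blast
qed

section \<open>Uniqueness of the Hoffman--Singleton graph\<close>

definition hoffman_singleton_arc :: "nat \<times> nat \<times> nat \<Rightarrow> nat \<times> nat \<times> nat \<Rightarrow> bool" where
  "hoffman_singleton_arc u v \<longleftrightarrow>
     (\<exists>h<5. \<exists>j<5. u = (0, h, j) \<and> v = (0, h, (j + 1) mod 5)) \<or>
     (\<exists>i<5. \<exists>j<5. u = (1, i, j) \<and> v = (1, i, (j + 2) mod 5)) \<or>
     (\<exists>h<5. \<exists>i<5. \<exists>j<5. u = (0, h, j) \<and> v = (1, i, (h * i + j) mod 5))"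

definition hoffman_singleton_adj :: "nat \<times> nat \<times> nat \<Rightarrow> nat \<times> nat \<times> nat \<Rightarrow> bool" where
  "hoffman_singleton_adj u v \<longleftrightarrow> hoffman_singleton_arc u v \<or> hoffman_singleton_arc v u"

abbreviation (input) hoffman_singleton_verts :: "(nat \<times> nat \<times> nat) set" where
  "hoffman_singleton_verts \<equiv> {0, 1} \<times> {..<5} \<times> {..<5}"

lemma hoffman_singleton_adjI:
  assumes "h < 5" "j < 5"
  shows "hoffman_singleton_adj (0, h, j) (0, h, (j + 1) mod 5)"
    "hoffman_singleton_adj (0, h, (j + 1) mod 5) (0, h, j)"
    "hoffman_singleton_adj (1, h, j) (1, h, (j + 2) mod 5)"
    "hoffman_singleton_adj (1, h, (j + 2) mod 5) (1, h, j)"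
    "i < 5 \<Longrightarrow> hoffman_singleton_adj (0, h, j) (1, i, (h * i + j) mod 5)"
    "i < 5 \<Longrightarrow> hoffman_singleton_adj (1, i, (h * i + j) mod 5) (0, h, j)"
proof -
  have "hoffman_singleton_arc (0, h, j) (0, h, (j + 1) mod 5)" "hoffman_singleton_arc (1, h, j) (1, h, (j + 2) mod 5)"
    using assms by (simp_all add: hoffman_singleton_arc_def)
  then show "hoffman_singleton_adj (0, h, j) (0, h, (j + 1) mod 5)"
    "hoffman_singleton_adj (0, h, (j + 1) mod 5) (0, h, j)"
    "hoffman_singleton_adj (1, h, j) (1, h, (j + 2) mod 5)"
    "hoffman_singleton_adj (1, h, (j + 2) mod 5) (1, h, j)"
    unfolding hoffman_singleton_adj_def by blast+
  assume "i < 5"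
  then have "hoffman_singleton_arc (0, h, j) (1, i, (h * i + j) mod 5)"
    using assms by (simp add: hoffman_singleton_arc_def)
  then show "hoffman_singleton_adj (0, h, j) (1, i, (h * i + j) mod 5)"
    "hoffman_singleton_adj (1, i, (h * i + j) mod 5) (0, h, j)"
    unfolding hoffman_singleton_adj_def by blast+
qed

lemma hoffman_singleton_degree:
  assumes "w \<in> hoffman_singleton_verts"
  shows "card {w' \<in> hoffman_singleton_verts. hoffman_singleton_adj w w'} \<ge> 7"
proof -
  have *: "7 \<le> card {w' \<in> hoffman_singleton_verts. hoffman_singleton_adj w w'}"
    if "S \<subseteq> hoffman_singleton_verts" "card S = 7" "\<And>w'. w' \<in> S \<Longrightarrow> hoffman_singleton_adj w w'" for S
  proof -
    have "card S \<le> card {w' \<in> hoffman_singleton_verts. hoffman_singleton_adj w w'}"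
      by (rule card_mono) (use that in auto)
    then show ?thesis using that by simp
  qed
  consider h j where "w = (0, h, j)" "h < 5" "j < 5" | i j where "w = (1, i, j)" "i < 5" "j < 5"
    using assms by auto
  then show ?thesis
  proof cases
    case (1 h j)
    define l where "l = (j + 4) mod 5"
    have l: "l < 5" "(l + 1) mod 5 = j" "l \<noteq> (j + 1) mod 5"
      using less_5_cases[OF 1(3)] unfolding l_def by auto
    let ?T = "(\<lambda>i. (1::nat, i, (h * i + j) mod 5)) ` {..<5}"
    have "inj_on (\<lambda>i. (1::nat, i, (h * i + j) mod 5)) {..<5}" by (auto simp: inj_on_def)
    then have "card ?T = 5" by (simp add: card_image)
    moreover have "(0, h, l) \<notin> ?T" "(0, h, (j + 1) mod 5) \<notin> insert (0, h, l) ?T" using l by auto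
    ultimately have c: "card (insert (0, h, (j + 1) mod 5) (insert (0, h, l) ?T)) = 7" by simp
    show ?thesis
    proof (rule *[OF _ c])
      show "insert (0, h, (j + 1) mod 5) (insert (0, h, l) ?T) \<subseteq> hoffman_singleton_verts" using 1 l by auto
      show "hoffman_singleton_adj w w'" if "w' \<in> insert (0, h, (j + 1) mod 5) (insert (0, h, l) ?T)" for w'
        using that 1 l hoffman_singleton_adjI[OF 1(2,3)] hoffman_singleton_adjI(2)[OF 1(2) l(1)] by auto
    qed
  next
    case (2 i j)
    define l where "l = (j + 3) mod 5"
    have l: "l < 5" "(l + 2) mod 5 = j" "l \<noteq> (j + 2) mod 5"
      using less_5_cases[OF 2(3)] unfolding l_def by auto
    \<comment> \<open>\<open>4 * (h * i)\<close> stands for \<open>- h * i\<close>: the last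
      coordinate solves \<open>h * i + j' = j\<close> modulo 5.\<close>
    let ?f = "\<lambda>h. (0::nat, h, (j + 4 * (h * i)) mod 5)"
    let ?T = "?f ` {..<5}"
    have "inj_on ?f {..<5}" by (auto simp: inj_on_def)
    then have "card ?T = 5" by (simp add: card_image)
    moreover have "(1, i, l) \<notin> ?T" "(1, i, (j + 2) mod 5) \<notin> insert (1, i, l) ?T" using l by auto
    ultimately have c: "card (insert (1, i, (j + 2) mod 5) (insert (1, i, l) ?T)) = 7" by simp
    have T: "hoffman_singleton_adj (1, i, j) (?f h)" if "h < 5" for h
    proof -
      have "(h * i + (j + 4 * (h * i)) mod 5) mod 5 = (j + 5 * (h * i)) mod 5"
        by (simp add: mod_simps algebra_simps)
      also have "\<dots> = j" using 2 by simp
      finally show ?thesis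
        using hoffman_singleton_adjI(6)[OF that, of "(j + 4 * (h * i)) mod 5" i] 2 by simp
    qed
    show ?thesis
    proof (rule *[OF _ c])
      show "insert (1, i, (j + 2) mod 5) (insert (1, i, l) ?T) \<subseteq> hoffman_singleton_verts" using 2 l by auto
      show "hoffman_singleton_adj w w'" if "w' \<in> insert (1, i, (j + 2) mod 5) (insert (1, i, l) ?T)" for w'
        using that 2 l T hoffman_singleton_adjI(3)[OF 2(2,3)] hoffman_singleton_adjI(4)[OF 2(2) l(1)] by auto
    qed
  qed
qed

text \<open>\<open>x\<close> is a permutation of the residues, and by \<open>diff\<close>, written
  without subtraction, so is \<open>x i - i\<close>. Once \<open>x 0\<close> and \<open>x 1\<close>
  are fixed, three values remain, and evaluating all cases leaves only the linear map.\<close>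

lemma orthomorphism_mod_5:
  fixes x :: "nat \<Rightarrow> nat"
  assumes lt: "\<And>i. i < 5 \<Longrightarrow> x i < 5" and x0: "x 0 = 0" and x1: "x 1 = h" and h: "h \<in> {2, 3, 4}"
    and inj: "\<And>i j. i < 5 \<Longrightarrow> j < 5 \<Longrightarrow> i \<noteq> j \<Longrightarrow> x i \<noteq> x j"
    and diff: "\<And>i j. i < 5 \<Longrightarrow> j < 5 \<Longrightarrow> i \<noteq> j \<Longrightarrow> (x i + j) mod 5 \<noteq> (x j + i) mod 5"
    and i: "i < 5"
  shows "x i = (h * i) mod 5"
proof -
  have check: "\<forall>h\<in>{2, 3, 4}. \<forall>a\<in>{0, 1, 2, 3, 4}. \<forall>b\<in>{0, 1, 2, 3, 4}. \<forall>c\<in>{0, 1, 2, 3, 4}.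
      0 \<noteq> a \<and> 0 \<noteq> b \<and> 0 \<noteq> c \<and> h \<noteq> a \<and> h \<noteq> b \<and> h \<noteq> c \<and> a \<noteq> b \<and> a \<noteq> c \<and> b \<noteq> c \<and>
      (0 + 2) mod 5 \<noteq> (a + 0) mod 5 \<and> (0 + 3) mod 5 \<noteq> (b + 0) mod 5 \<and> (0 + 4) mod 5 \<noteq> (c + 0) mod 5 \<and>
      (h + 2) mod 5 \<noteq> (a + 1) mod 5 \<and> (h + 3) mod 5 \<noteq> (b + 1) mod 5 \<and> (h + 4) mod 5 \<noteq> (c + 1) mod 5 \<and>
      (a + 3) mod 5 \<noteq> (b + 2) mod 5 \<and> (a + 4) mod 5 \<noteq> (c + 2) mod 5 \<and> (b + 4) mod 5 \<noteq> (c + 3) mod (5::nat)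
      \<longrightarrow> a = (h * 2) mod 5 \<and> b = (h * 3) mod 5 \<and> c = (h * 4) mod 5"
    by code_simp
  have mem: "x 2 \<in> {0, 1, 2, 3, 4}" "x 3 \<in> {0, 1, 2, 3, 4}" "x 4 \<in> {0, 1, 2, 3, 4}"
    using lt[of 2] lt[of 3] lt[of 4] by auto
  have "x 2 = (h * 2) mod 5 \<and> x 3 = (h * 3) mod 5 \<and> x 4 = (h * 4) mod 5"
  proof (rule check[rule_format, OF h mem])
    have "0 \<noteq> x 2" "0 \<noteq> x 3" "0 \<noteq> x 4" using inj[of 0 2] inj[of 0 3] inj[of 0 4] x0 by simp_all
    moreover have "h \<noteq> x 2" "h \<noteq> x 3" "h \<noteq> x 4" using inj[of 1 2] inj[of 1 3] inj[of 1 4] x1 by simp_all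
    moreover have "x 2 \<noteq> x 3" "x 2 \<noteq> x 4" "x 3 \<noteq> x 4" using inj[of 2 3] inj[of 2 4] inj[of 3 4] by simp_all
    moreover have "(0 + 2) mod 5 \<noteq> (x 2 + 0) mod 5" "(0 + 3) mod 5 \<noteq> (x 3 + 0) mod 5" "(0 + 4) mod 5 \<noteq> (x 4 + 0) mod 5"
      using diff[of 0 2] diff[of 0 3] diff[of 0 4] unfolding x0 by simp_all
    moreover have "(h + 2) mod 5 \<noteq> (x 2 + 1) mod 5" "(h + 3) mod 5 \<noteq> (x 3 + 1) mod 5" "(h + 4) mod 5 \<noteq> (x 4 + 1) mod 5"
      using diff[of 1 2] diff[of 1 3] diff[of 1 4] unfolding x1 by simp_all
    moreover have "(x 2 + 3) mod 5 \<noteq> (x 3 + 2) mod 5" "(x 2 + 4) mod 5 \<noteq> (x 4 + 2) mod 5" "(x 3 + 4) mod 5 \<noteq> (x 4 + 3) mod 5"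
      using diff[of 2 3] diff[of 2 4] diff[of 3 4] by simp_all
    ultimately show "0 \<noteq> x 2 \<and> 0 \<noteq> x 3 \<and> 0 \<noteq> x 4 \<and> h \<noteq> x 2 \<and> h \<noteq> x 3 \<and> h \<noteq> x 4 \<and>
      x 2 \<noteq> x 3 \<and> x 2 \<noteq> x 4 \<and> x 3 \<noteq> x 4 \<and>
      (0 + 2) mod 5 \<noteq> (x 2 + 0) mod 5 \<and> (0 + 3) mod 5 \<noteq> (x 3 + 0) mod 5 \<and> (0 + 4) mod 5 \<noteq> (x 4 + 0) mod 5 \<and>
      (h + 2) mod 5 \<noteq> (x 2 + 1) mod 5 \<and> (h + 3) mod 5 \<noteq> (x 3 + 1) mod 5 \<and> (h + 4) mod 5 \<noteq> (x 4 + 1) mod 5 \<and>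
      (x 2 + 3) mod 5 \<noteq> (x 3 + 2) mod 5 \<and> (x 2 + 4) mod 5 \<noteq> (x 4 + 2) mod 5 \<and> (x 3 + 4) mod 5 \<noteq> (x 4 + 3) mod 5"
      by blast
  qed
  then show ?thesis using less_5_cases[OF i] x0 x1 h by auto
qed

text \<open>\<open>C\<close> is a normalised difference matrix over the residues modulo 5. Columns
  are renamed to make row 1 the identity, then rows to make column 1 the identity. Comparison with
  rows 0 and 1 makes every other row an orthomorphism, hence linear.\<close>

lemma difference_matrix_mod_5:
  fixes C :: "nat \<Rightarrow> nat \<Rightarrow> nat"
  assumes lt: "\<And>h i. h < 5 \<Longrightarrow> i < 5 \<Longrightarrow> C h i < 5"
    and C0: "\<And>i. i < 5 \<Longrightarrow> C 0 i = 0" "\<And>h. h < 5 \<Longrightarrow> C h 0 = 0"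
    and diff: "\<And>h h' i i'. h < 5 \<Longrightarrow> h' < 5 \<Longrightarrow> i < 5 \<Longrightarrow> i' < 5 \<Longrightarrow> h \<noteq> h' \<Longrightarrow> i \<noteq> i' \<Longrightarrow>
        (C h i + C h' i') mod 5 \<noteq> (C h i' + C h' i) mod 5"
  obtains \<sigma> \<tau> where "bij_betw \<sigma> {..<5} {..<5}" "bij_betw \<tau> {..<5} {..<5}"
    "\<And>h i. h < 5 \<Longrightarrow> i < 5 \<Longrightarrow> C (\<tau> h) (\<sigma> i) = (h * i) mod 5"
proof -
  have rowinj: "C h i \<noteq> C h i'" if "h < 5" "i < 5" "i' < 5" "h \<noteq> 0" "i \<noteq> i'" for h i i'
    using diff[of h 0 i i'] that C0 by auto
  have colinj: "C h i \<noteq> C h' i" if "h < 5" "h' < 5" "i < 5" "i \<noteq> 0" "h \<noteq> h'" for h h' i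
    using diff[of h h' i 0] that C0 by auto
  have b1: "bij_betw (C 1) {..<5} {..<5}"
  proof (rule bij_betwI')
    show "C 1 x = C 1 y \<longleftrightarrow> x = y" if "x \<in> {..<5}" "y \<in> {..<5}" for x y
      using rowinj[of 1 x y] that by auto
    show "C 1 x \<in> {..<5}" if "x \<in> {..<5}" for x using lt[of 1 x] that by simp
    have "inj_on (C 1) {..<5}" using rowinj[of 1] by (intro inj_onI) auto
    moreover have "C 1 ` {..<5} \<subseteq> {..<5}" using lt[of 1] by auto
    ultimately have "C 1 ` {..<5} = {..<5}" by (simp add: endo_inj_surj)
    then show "\<exists>x\<in>{..<5}. y = C 1 x" if "y \<in> {..<5}" for y using that by blast
  qed
  define \<sigma> where "\<sigma> = inv_into {..<5} (C 1)"
  have sb: "bij_betw \<sigma> {..<5} {..<5}" unfolding \<sigma>_def by (rule bij_betw_inv_into[OF b1])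
  have C1s: "C 1 (\<sigma> i) = i" if "i < 5" for i
    unfolding \<sigma>_def using bij_betw_inv_into_right[OF b1] that by simp
  have slt: "\<sigma> i < 5" if "i < 5" for i using bij_betwE[OF sb] that by simp
  have s0: "\<sigma> 0 = 0" using rowinj[of 1 "\<sigma> 0" 0] C1s[of 0] slt[of 0] C0(2)[of 1] by auto
  have s1: "\<sigma> 1 \<noteq> 0"
  proof
    assume "\<sigma> 1 = 0"
    then have "C 1 0 = 1" using C1s[of 1] by simp
    then show False using C0(2)[of 1] by simp
  qed
  have sinj: "\<sigma> i \<noteq> \<sigma> j" if "i < 5" "j < 5" "i \<noteq> j" for i j using C1s that by metis
  let ?c = "\<lambda>h. C h (\<sigma> 1)"
  have b2: "bij_betw ?c {..<5} {..<5}"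
  proof -
    have "inj_on ?c {..<5}" using colinj[of _ _ "\<sigma> 1"] s1 slt[of 1] by (intro inj_onI) auto
    moreover have "?c ` {..<5} \<subseteq> {..<5}" using lt slt[of 1] by auto
    ultimately have "?c ` {..<5} = {..<5}" by (simp add: endo_inj_surj)
    then show ?thesis using \<open>inj_on ?c {..<5}\<close> by (simp add: bij_betw_def)
  qed
  define \<tau> where "\<tau> = inv_into {..<5} ?c"
  have tb: "bij_betw \<tau> {..<5} {..<5}" unfolding \<tau>_def by (rule bij_betw_inv_into[OF b2])
  have Ct: "C (\<tau> h) (\<sigma> 1) = h" if "h < 5" for h
    unfolding \<tau>_def using bij_betw_inv_into_right[OF b2] that by simp
  have tlt: "\<tau> h < 5" if "h < 5" for h using bij_betwE[OF tb] that by simp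
  have t0: "\<tau> 0 = 0" using colinj[of "\<tau> 0" 0 "\<sigma> 1"] Ct[of 0] tlt[of 0] s1 slt[of 1] C0(1)[of "\<sigma> 1"] by auto
  have t1: "\<tau> 1 = 1" using colinj[of "\<tau> 1" 1 "\<sigma> 1"] Ct[of 1] tlt[of 1] s1 slt[of 1] C1s[of 1] by auto
  have tne: "\<tau> h \<noteq> 0" "\<tau> h \<noteq> 1" if "h \<in> {2, 3, 4}" for h
  proof -
    have "C (\<tau> h) (\<sigma> 1) = h" using Ct that by auto
    moreover have "C 0 (\<sigma> 1) = 0" "C 1 (\<sigma> 1) = 1" using Ct[of 0] Ct[of 1] t0 t1 by simp_all
    ultimately show "\<tau> h \<noteq> 0" "\<tau> h \<noteq> 1" using that by (metis insertE singletonD zero_neq_numeral one_eq_numeral_iff semiring_norm(85) numeral_eq_one_iff num.distinct(1,3))+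
  qed
  have "C (\<tau> h) (\<sigma> i) = (h * i) mod 5" if hi: "h < 5" "i < 5" for h i
  proof -
    consider "h = 0" | "h = 1" | "h \<in> {2, 3, 4}" using less_5_cases[OF hi(1)] by auto
    then show ?thesis
    proof cases
      case 1
      then show ?thesis using t0 C0(1) slt hi by simp
    next
      case 2
      then show ?thesis using t1 C1s hi by simp
    next
      case 3
      show ?thesis
      proof (rule orthomorphism_mod_5[of "\<lambda>i. C (\<tau> h) (\<sigma> i)" h i, OF _ _ _ 3 _ _ hi(2)])
        show "C (\<tau> h) (\<sigma> i) < 5" if "i < 5" for i using lt tlt slt hi that by blast
        show "C (\<tau> h) (\<sigma> 0) = 0" using s0 C0(2) tlt hi by simp
        show "C (\<tau> h) (\<sigma> 1) = h" using Ct hi by blast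
        show "C (\<tau> h) (\<sigma> i) \<noteq> C (\<tau> h) (\<sigma> j)" if "i < 5" "j < 5" "i \<noteq> j" for i j
          using rowinj[OF tlt[OF hi(1)] slt[OF that(1)] slt[OF that(2)]] tne(1)[OF 3] sinj[OF that] by blast
        show "(C (\<tau> h) (\<sigma> i) + j) mod 5 \<noteq> (C (\<tau> h) (\<sigma> j) + i) mod 5" if "i < 5" "j < 5" "i \<noteq> j" for i j
          using diff[OF tlt[OF hi(1)] _ slt[OF that(1)] slt[OF that(2)], of 1] tne(2)[OF 3] sinj[OF that] C1s that
          by simp
      qed
    qed
  qed
  then show ?thesis using that sb tb by blast
qed

text \<open>A walk on the pentagon that does not turn back keeps its direction; \<open>s = 4\<close>
  is the step -1.\<close>

lemma mod_5_straight:
  fixes y s z t :: nat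
  assumes "y < 5" "s \<in> {1, 4}" "z = (y + s) mod 5" "t = (z + 1) mod 5 \<or> t = (z + 4) mod 5" "t \<noteq> y"
  shows "t = (y + 2 * s) mod 5"
  using less_5_cases[OF assms(1)] assms(2-5) by auto

context moore
begin

text \<open>A pentagon \<open>p\<close> has five partners \<open>Q i\<close>; the pentagram
  \<open>Q 0\<close>, read as a pentagon, has five partners \<open>P h\<close>, one of which is
  \<open>p\<close>. It remains to determine the edges between the \<open>P h\<close> and the
  \<open>Q i\<close>.\<close>

lemma hoffman_singleton_unique:
  assumes k: "k = 7"
  obtains g where "bij_betw g hoffman_singleton_verts V"
    "\<And>w w'. w \<in> hoffman_singleton_verts \<Longrightarrow> w' \<in> hoffman_singleton_verts \<Longrightarrow>
       E (g w) (g w') \<longleftrightarrow> hoffman_singleton_adj w w'"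
proof -
  obtain p where p: "pentagon_labelling p" using pentagon_exists by blast
  note pD = pentagonD[OF p]
  define A where "A = nb (p 0) - range p"
  have cA: "card A = 5" "finite A" using outside_neighbours[OF p, of 0] k by (auto simp: A_def)
  obtain a where a: "bij_betw a {..<5::nat} A"
    using ex_bij_betw_nat_finite[OF cA(2)] cA(1) by (auto simp: atLeast0LessThan)
  have aA: "a i \<in> V" "E (p 0) (a i)" "a i \<notin> range p" if "i < 5" for i
    using bij_betwE[OF a] that by (auto simp: A_def)
  have "\<exists>q. partner p q \<and> q 0 = a i" if "i < 5" for i
    using partner_exists_7[OF k p aA[OF that]] by metis
  then obtain Q where Q: "\<And>i. i < 5 \<Longrightarrow> partner p (Q i)" "\<And>i. i < 5 \<Longrightarrow> Q i 0 = a i" by metis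
  note QD = partnerD[OF Q(1)]
  have Qinj: "i = i' \<and> j mod 5 = j' mod 5" if i: "i < 5" "i' < 5" and eq: "Q i j = Q i' j'" for i i' j j'
  proof
    show jj: "j mod 5 = j' mod 5" by (rule partner_eqD[OF Q(1)[OF i(1)] Q(1)[OF i(2)] eq])
    then have "Q i j = Q i' j" using eq QD(3)[OF i(2), of j j'] by simp
    then have "Q i 0 = Q i' 0" by (rule partner_unique[OF Q(1)[OF i(1)] Q(1)[OF i(2)]])
    then show "i = i'" using Q(2) i a by (simp add: bij_betw_def inj_on_def)
  qed
  have Qsurj: "\<exists>i<5. x = Q i j" if x: "x \<in> nb (p j) - range p" for x j
  proof -
    let ?S = "(\<lambda>i. Q i j) ` {..<5}"
    have "inj_on (\<lambda>i. Q i j) {..<5}" using Qinj by (auto simp: inj_on_def)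
    then have "card ?S = 5" by (simp add: card_image)
    moreover have "Q i j \<in> nb (p j) - range p" if "i < 5" for i
      using QD(2,4)[OF that] partner_outside[OF Q(1)[OF that], of j] by simp
    then have "?S \<subseteq> nb (p j) - range p" by (metis image_subsetI lessThan_iff)
    ultimately have "?S = nb (p j) - range p"
      using card_subset_eq[of "nb (p j) - range p" ?S] outside_neighbours[OF p, of j] k by simp
    then show ?thesis using x by auto
  qed
  define p' where "p' j = Q 0 (2 * j)" for j
  have p': "pentagon_labelling p'" unfolding p'_def by (rule partner_pentagon[OF Q(1)]) simp
  have rp': "range p' = range (Q 0)"
  proof
    show "range p' \<subseteq> range (Q 0)" by (auto simp: p'_def)
    show "range (Q 0) \<subseteq> range p'"
    proof
      fix x assume "x \<in> range (Q 0)"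
      then obtain j where "x = Q 0 j" by blast
      moreover have "Q 0 j = Q 0 (2 * (3 * j))"
        by (rule QD(3)) (use mod_5_cancel(3)[of j "5 * j"] in simp_all)
      ultimately have "x = p' (3 * j)" by (simp add: p'_def)
      then show "x \<in> range p'" by blast
    qed
  qed
  \<comment> \<open>Being partners is symmetric: read with doubled indices, \<open>p\<close> is a
    partner of \<open>Q 0\<close>.\<close>
  have P0: "partner p' (\<lambda>j. p (2 * j))"
    unfolding partner_def
  proof (intro conjI allI impI)
    show "pentagon_labelling p'" by (rule p')
    show "p (2 * 0) \<notin> range p'"
      unfolding rp' using partner_outside[OF Q(1), of 0] by (metis rangeE rangeI zero_less_numeral)
    show "p (2 * i) \<in> V" for i by (rule pD)
    show "p (2 * i) = p (2 * j)" if "i mod 5 = j mod 5" for i j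
      using that mod_5_double[of i j] pD(2) by simp
    show "E (p' i) (p (2 * i))" for i unfolding p'_def by (rule QD) simp
    show "E (p (2 * i)) (p (2 * (i + 2)))" for i
    proof -
      have "(2 * (i + 2) + 1) mod 5 = (2 * i) mod 5"
        using mod_5_cancel(2)[of "2 * i" 5] by simp
      then show ?thesis using pD(3) by blast
    qed
  qed
  define A' where "A' = nb (p' 0) - range p'"
  have cA': "card A' = 5" "finite A'" using outside_neighbours[OF p', of 0] k by (auto simp: A'_def)
  have p0A': "p 0 \<in> A'"
    using partner_outside[OF P0, of 0] partnerD(4)[OF P0, of 0] pD(1) by (auto simp: A'_def)
  then have "card (A' - {p 0}) = 4" "finite (A' - {p 0})" using cA' by auto
  then obtain b where b: "bij_betw b {..<4::nat} (A' - {p 0})"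
    using ex_bij_betw_nat_finite[of "A' - {p 0}"] by (auto simp: atLeast0LessThan)
  define c where "c h = (if h = 0 then p 0 else b (h - 1))" for h
  have cA: "c h \<in> A'" if "h < 5" for h
    using p0A' bij_betwE[OF b] that by (auto simp: c_def)
  have cinj: "h = h'" if "h < 5" "h' < 5" "c h = c h'" for h h'
  proof -
    have bi: "b x \<noteq> p 0" if "x < 4" for x using bij_betwE[OF b] that by auto
    have bj: "x = y" if "b x = b y" "x < 4" "y < 4" for x y
      using b that by (auto simp: bij_betw_def inj_on_def)
    have lt: "h - 1 < 4" "h' - 1 < 4" using that by linarith+
    show ?thesis
    proof (cases "h = 0 \<or> h' = 0")
      case True
      then show ?thesis using that(3) bi[OF lt(1)] bi[OF lt(2)] by (auto simp: c_def split: if_splits)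
    next
      case False
      then have "h - 1 = h' - 1" using that(3) bj lt by (simp add: c_def)
      then show ?thesis using False by linarith
    qed
  qed
  have "\<exists>r. partner p' r \<and> r 0 = c h \<and> (h = 0 \<longrightarrow> r = (\<lambda>j. p (2 * j)))" if h: "h < 5" for h
  proof (cases "h = 0")
    case True
    then show ?thesis using P0 by (intro exI[of _ "\<lambda>j. p (2 * j)"]) (simp add: c_def)
  next
    case False
    have "c h \<in> V" "E (p' 0) (c h)" "c h \<notin> range p'" using cA[OF h] by (auto simp: A'_def)
    then show ?thesis using partner_exists_7[OF k p'] False by metis
  qed
  then obtain R where R: "\<And>h. h < 5 \<Longrightarrow> partner p' (R h)" "\<And>h. h < 5 \<Longrightarrow> R h 0 = c h"
      "R 0 = (\<lambda>j. p (2 * j))"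
    by (metis zero_less_numeral)
  note RD = partnerD[OF R(1)]
  \<comment> \<open>Tripling undoes the doubling, so that \<open>P 0\<close> is \<open>p\<close> and
    \<open>P h j\<close> is matched with \<open>Q 0 j\<close>.\<close>
  define P where "P h j = R h (3 * j)" for h j
  have m6: "(2 * (3 * j)) mod 5 = j mod 5" for j :: nat using mod_5_cancel(2)[of j "5 * j"] by simp
  have P_0: "P 0 j = p j" for j unfolding P_def R(3) using pD(2) m6 by blast
  have PV: "P h j \<in> V" if "h < 5" for h j unfolding P_def by (rule RD[OF that])
  have Pper: "P h i = P h j" if "h < 5" "i mod 5 = j mod 5" for h i j
    unfolding P_def by (rule RD(3)[OF that(1)]) (metis mod_mult_right_eq that(2))
  have PQ0: "E (P h j) (Q 0 j)" if "h < 5" for h j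
  proof -
    have "E (R h (3 * j)) (p' (3 * j))" by (rule RD(5)[OF that])
    moreover have "p' (3 * j) = Q 0 j" unfolding p'_def using QD(3)[of 0, OF _ m6] by simp
    ultimately show ?thesis by (simp add: P_def)
  qed
  have Pcyc: "E (P h j) (P h (j + 1))" "E (P h (j + 1)) (P h j)" if "h < 5" for h j
  proof -
    have "R h (3 * (j + 1) + 2) = R h (3 * j)"
      by (rule RD(3)[OF that]) (use mod_5_cancel(2)[of "3 * j" 5] in simp)
    then show "E (P h (j + 1)) (P h j)" using RD(6)[OF that, of "3 * (j + 1)"] by (simp add: P_def)
    then show "E (P h j) (P h (j + 1))" by (rule sym)
  qed
  have m3: "(3 * i) mod 5 = (3 * j) mod 5 \<Longrightarrow> i mod 5 = j mod 5" for i j :: nat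
    using mod_5_double[of "3 * i" "3 * j"] m6[of i] m6[of j] by simp
  have Pinj: "h = h' \<and> j mod 5 = j' mod 5" if h: "h < 5" "h' < 5" and eq: "P h j = P h' j'" for h h' j j'
  proof
    have jj: "(3 * j) mod 5 = (3 * j') mod 5"
      by (rule partner_eqD[OF R(1)[OF h(1)] R(1)[OF h(2)]]) (use eq in \<open>simp add: P_def\<close>)
    then show "j mod 5 = j' mod 5" by (rule m3)
    have "R h (3 * j) = R h' (3 * j)" using eq RD(3)[OF h(2) jj] by (simp add: P_def)
    then have "R h 0 = R h' 0" by (rule partner_unique[OF R(1)[OF h(1)] R(1)[OF h(2)]])
    then show "h = h'" using R(2) h cinj by simp
  qed
  \<comment> \<open>A common vertex would be adjacent to \<open>Q 0 j\<close> and
    \<open>p l\<close>, hence equal to \<open>Q 0 l\<close> by \<open>partner_neighbour\<close>; but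
    partners of \<open>p'\<close> avoid \<open>Q 0\<close>.\<close>
  have PnQ: "P h j \<noteq> Q i l" if hi: "h < 5" "i < 5" for h i j l
  proof
    assume eq: "P h j = Q i l"
    have out: "P h j \<notin> range (Q 0)" unfolding P_def rp'[symmetric] by (rule partner_outside[OF R(1)[OF hi(1)]])
    have "Q i l \<notin> range p" by (rule partner_outside[OF Q(1)[OF hi(2)]])
    moreover have "E (Q 0 j) (Q i l)" using PQ0[OF hi(1), of j] eq sym by simp
    ultimately have "Q i l = Q 0 l"
      using partner_neighbour[OF Q(1), of 0 "Q i l" l j] QD(2,5)[OF hi(2)] by simp
    then show False using out eq by auto
  qed
  have PnP: "\<not> E (P h j) (p l)" if h: "h < 5" "h \<noteq> 0" for h j l
  proof
    assume "E (P h j) (p l)"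
    then have e: "E (R 0 (3 * l)) (R h (3 * j))" using P_0[of l] sym by (simp add: P_def)
    have "R h (3 * j) = R 0 (3 * j)"
      using partner_neighbour[OF R(1), of 0 "R h (3 * j)" "3 * j" "3 * l"] RD(2,5)[OF h(1)]
        partner_outside[OF R(1)[OF h(1)]] e by simp
    then have "P h j = P 0 j" by (simp add: P_def)
    then show False using Pinj[of h 0 j j] h by simp
  qed
  have Qpent: "pentagon_labelling (\<lambda>j. Q i (2 * j))" if "i < 5" for i
    by (rule partner_pentagon[OF Q(1)[OF that]])
  have PQuniq: "l mod 5 = l' mod 5" if hi: "h < 5" "i < 5" and e: "E (P h j) (Q i l)" "E (P h j) (Q i l')" for h i j l l'
  proof -
    have q: "Q i x = Q i (2 * (3 * x))" for x by (rule QD(3)[OF hi(2)]) (simp only: m6)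
    have "P h j \<notin> range (\<lambda>j. Q i (2 * j))" using PnQ[OF hi] by auto
    moreover have "E (P h j) (Q i (2 * (3 * l)))" "E (P h j) (Q i (2 * (3 * l')))" using e q by metis+
    ultimately have "(3 * l) mod 5 = (3 * l') mod 5"
      using pentagon_outside[OF Qpent[OF hi(2)] PV[OF hi(1)]] by blast
    then show ?thesis by (rule m3)
  qed
  \<comment> \<open>For each \<open>l\<close> the common neighbour of \<open>P h j\<close> and
    \<open>p l\<close> lies on some \<open>Q i\<close> at index \<open>l\<close>. Different
    \<open>l\<close> use different \<open>i\<close> by \<open>PQuniq\<close>, so the five values of
    \<open>l\<close> reach every \<open>i\<close>.\<close>
  have PQex: "\<exists>l<5. E (P h j) (Q i l)" if hi: "h < 5" "i < 5" for h i j
  proof (cases "h = 0")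
    case True
    have "E (p (j mod 5)) (Q i (j mod 5))" by (rule QD(4)[OF hi(2)])
    moreover have "p (j mod 5) = P h j" using True P_0 pD(2) by simp
    ultimately show ?thesis by (intro exI[of _ "j mod 5"]) simp
  next
    case False
    have "\<exists>i<5. E (P h j) (Q i l)" for l
    proof -
      have "P h j \<noteq> p l" using Pinj[of h 0 j l] hi P_0[of l] False by auto
      then obtain x where x: "x \<in> V" "E (P h j) x" "E (p l) x"
        using common[OF PV[OF hi(1)] pD(1)] PnP[OF hi(1) False] by metis
      have "x \<notin> range p" using x PnP[OF hi(1) False] by auto
      then show ?thesis using Qsurj[of x l] x by auto
    qed
    then obtain \<iota> where io: "\<And>l. \<iota> l < 5 \<and> E (P h j) (Q (\<iota> l) l)" by metis
    have "inj_on \<iota> {..<5}"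
    proof (rule inj_onI)
      fix l l' assume l: "l \<in> {..<5::nat}" "l' \<in> {..<5}" "\<iota> l = \<iota> l'"
      then have "l mod 5 = l' mod 5" using PQuniq[OF hi(1), of "\<iota> l" j l l'] io[of l] io[of l'] by simp
      then show "l = l'" using l by simp
    qed
    moreover have "\<iota> ` {..<5} \<subseteq> {..<5}" using io by auto
    ultimately have "\<iota> ` {..<5} = {..<5}" by (simp add: endo_inj_surj)
    then obtain l where "l < 5" "\<iota> l = i" using hi(2) by (metis image_iff lessThan_iff)
    then show ?thesis using io[of l] by auto
  qed
  then obtain F where F: "\<And>h i j. h < 5 \<Longrightarrow> i < 5 \<Longrightarrow> F h i j < (5::nat) \<and> E (P h j) (Q i (F h i j))" by metis
  have Funiq: "F h i j = l mod 5" if "h < 5" "i < 5" "E (P h j) (Q i l)" for h i j l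
    using PQuniq[OF that(1,2) _ that(3)] F[OF that(1,2), of j] by (metis mod_less)
  have F0: "F 0 i j = j mod 5" if "i < 5" for i j
    by (rule Funiq) (use that QD(4)[OF that] P_0 in auto)
  have Fh0: "F h 0 j = j mod 5" if "h < 5" for h j
    by (rule Funiq) (use that PQ0 in auto)
  have Fper: "F h i j = F h i j'" if "h < 5" "i < 5" "j mod 5 = j' mod 5" for h i j j'
    using Funiq[OF that(1,2), of j "F h i j'"] F[OF that(1,2), of j'] Pper[OF that(1,3)] by simp
  \<comment> \<open>A fixed index would give \<open>P h j\<close> and \<open>p j\<close> the two
    common neighbours \<open>Q i j\<close> and \<open>Q 0 j\<close>.\<close>
  have Fne: "F h i j \<noteq> j mod 5" if hi: "h < 5" "i < 5" "h \<noteq> 0" "i \<noteq> 0" for h i j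
  proof
    assume "F h i j = j mod 5"
    then have "Q i (F h i j) = Q i j" by (intro QD(3)[OF hi(2)]) simp
    then have e: "E (P h j) (Q i j)" using F[OF hi(1,2), of j] by simp
    have "P h j \<noteq> p j" using Pinj[of h 0 j j] hi P_0[of j] by auto
    then have "Q i j = Q 0 j"
      using uniq[of "P h j" "p j" "Q i j" "Q 0 j"] e PQ0[OF hi(1), of j] QD(2,4)[OF hi(2)] QD(2,4)[of 0]
        PV[OF hi(1)] pD(1) by simp
    then show False using Qinj[of i 0 j j] hi by simp
  qed
  \<comment> \<open>The matches of two neighbours on \<open>P h\<close> are distinct and
    nonadjacent, else there is a triangle or a quadrangle; on a pentagram, whose edges have step 2,
    they then differ by 1.\<close>
  have Fstep: "F h i (j + 1) = (F h i j + 1) mod 5 \<or> F h i (j + 1) = (F h i j + 4) mod 5"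
    if hi: "h < 5" "i < 5" for h i j
  proof -
    let ?x = "F h i j" and ?y = "F h i (j + 1)"
    have x: "?x < 5" "E (P h j) (Q i ?x)" "?y < 5" "E (P h (j + 1)) (Q i ?y)" using F[OF hi] by auto
    have ne: "?x \<noteq> ?y"
      using no_tri[of "P h j" "P h (j + 1)" "Q i ?x"] x Pcyc(1)[OF hi(1)] PV[OF hi(1)] QD(2)[OF hi(2)] by auto
    have nadj: "\<not> E (Q i ?x) (Q i ?y)"
    proof
      assume e: "E (Q i ?x) (Q i ?y)"
      have "P h (j + 1) = Q i ?x"
        by (rule uniq[of "P h j" "Q i ?y"])
          (use e x sym Pcyc[OF hi(1)] PV[OF hi(1)] QD(2)[OF hi(2)] PnQ[OF hi] in auto)
      then show False using PnQ[OF hi] by blast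
    qed
    have "?y \<noteq> (?x + 2) mod 5"
    proof
      assume "?y = (?x + 2) mod 5"
      then have "Q i ?y = Q i (?x + 2)" by (intro QD(3)[OF hi(2)]) simp
      then show False using nadj QD(6)[OF hi(2), of ?x] by simp
    qed
    moreover have "?x \<noteq> (?y + 2) mod 5"
    proof
      assume "?x = (?y + 2) mod 5"
      then have "Q i ?x = Q i (?y + 2)" by (intro QD(3)[OF hi(2)]) simp
      then show False using nadj QD(7)[OF hi(2), of ?y] by simp
    qed
    ultimately show ?thesis
      using less_5_cases[OF x(1)] less_5_cases[OF x(3)] ne by auto
  qed
  have Fstep2: "F h i (j + 2) \<noteq> F h i j" if hi: "h < 5" "i < 5" for h i j
  proof
    assume eq: "F h i (j + 2) = F h i j"
    have ne: "P h j \<noteq> P h (j + 2)"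
    proof
      assume "P h j = P h (j + 2)"
      then have "j mod 5 = (j + 2) mod 5" using Pinj[OF hi(1) hi(1)] by blast
      then show False by (simp only: mod_5_cancel) simp
    qed
    have Pcyc2: "E (P h (j + 2)) (P h (j + 1))" using Pcyc(2)[OF hi(1), of "j + 1"] by simp
    have "P h (j + 1) = Q i (F h i j)"
      by (rule uniq[of "P h j" "P h (j + 2)"])
        (use ne Pcyc2 Pcyc(1)[OF hi(1)] PV[OF hi(1)] QD(2)[OF hi(2)] F[OF hi, of j] F[OF hi, of "j + 2"] eq in auto)
    then show False using PnQ[OF hi] by blast
  qed
  have Flin: "F h i j = (F h i 0 + j) mod 5" if hi: "h < 5" "i < 5" for h i j
  proof -
    define x where "x = F h i 0"
    have "\<exists>s\<in>{1, 4}. F h i 1 = (x + s) mod 5" using Fstep[OF hi, of 0] by (simp add: x_def)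
    then obtain s where s: "s \<in> {1, 4}" "F h i 1 = (x + s) mod 5" by blast
    have lin: "F h i n = (x + s * n) mod 5 \<and> F h i (n + 1) = (x + s * (n + 1)) mod 5" for n
    proof (induction n)
      case 0
      then show ?case using s F[OF hi, of 0] by (simp add: x_def)
    next
      case (Suc n)
      let ?y = "(x + s * n) mod 5"
      have "F h i (n + 1) = (?y + s) mod 5" using Suc by (simp add: mod_simps algebra_simps)
      moreover have "F h i (n + 2) = (F h i (n + 1) + 1) mod 5 \<or> F h i (n + 2) = (F h i (n + 1) + 4) mod 5"
        using Fstep[OF hi, of "n + 1"] by simp
      moreover have "F h i (n + 2) \<noteq> ?y" using Fstep2[OF hi, of n] Suc by simp
      moreover have "?y < 5" by simp
      ultimately have "F h i (n + 2) = (?y + 2 * s) mod 5"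
        using mod_5_straight[of ?y s] s(1) by blast
      also have "\<dots> = (x + s * n + 2 * s) mod 5" by (simp only: mod_add_left_eq)
      also have "x + s * n + 2 * s = x + s * (n + 2)" by (simp add: algebra_simps)
      finally have "F h i (n + 2) = (x + s * (n + 2)) mod 5" .
      then show ?case using Suc by (simp only: Suc_eq_plus1 add.assoc one_add_one)
    qed
    show ?thesis
    proof (cases "s = 1")
      case True
      then show ?thesis using lin[of j] by (simp add: x_def)
    next
      case False
      then have s4: "s = 4" using s by simp
      \<comment> \<open>A reflection sending \<open>j\<close> to \<open>x - j\<close> fixes
        \<open>3 * x\<close> modulo 5, so \<open>Fne\<close> leaves only \<open>h = 0\<close> or
        \<open>i = 0\<close>, where the matching is the identity.\<close>
      have "F h i (3 * x) = (x + 4 * (3 * x)) mod 5" using lin[of "3 * x"] s4 by simp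
      also have "\<dots> = (3 * x) mod 5" using mod_5_cancel(2)[of "3 * x" "10 * x"] by (simp add: mod_simps)
      finally have "h = 0 \<or> i = 0" using Fne[OF hi, of "3 * x"] by blast
      then show ?thesis using F0[OF hi(2)] Fh0[OF hi(1)] by auto
    qed
  qed
  define C where "C h i = F h i 0" for h i
  have PQ: "E (P h j) (Q i (C h i + j))" if hi: "h < 5" "i < 5" for h i j
  proof -
    have "Q i (C h i + j) = Q i (F h i j)" unfolding C_def
      by (rule QD(3)[OF hi(2)]) (use Flin[OF hi, of j] in simp)
    then show ?thesis using F[OF hi, of j] by simp
  qed
  \<comment> \<open>Otherwise, for \<open>j = C h i - C h' i\<close> modulo 5, the vertices
    \<open>P h 0\<close> and \<open>P h' j\<close> have a common neighbour on \<open>Q i\<close> and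
    another on \<open>Q i'\<close>.\<close>
  have Cdiff: "(C h i + C h' i') mod 5 \<noteq> (C h i' + C h' i) mod 5"
    if h: "h < 5" "h' < 5" "i < 5" "i' < 5" "h \<noteq> h'" "i \<noteq> i'" for h h' i i'
  proof
    assume eq: "(C h i + C h' i') mod 5 = (C h i' + C h' i) mod 5"
    define j where "j = C h i + 4 * C h' i"
    have 1: "(C h' i + j) mod 5 = (C h i) mod 5"
      using mod_5_cancel(2)[of "C h i" "5 * C h' i"] by (simp add: j_def algebra_simps)
    have "(C h' i' + j) mod 5 = (C h i + C h' i' + 4 * C h' i) mod 5" by (simp add: j_def algebra_simps)
    also have "\<dots> = (C h i' + C h' i + 4 * C h' i) mod 5" using eq by (metis mod_add_left_eq)
    also have "\<dots> = C h i' mod 5"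
      using mod_5_cancel(2)[of "C h i'" "5 * C h' i"] by (simp add: algebra_simps)
    finally have 2: "(C h' i' + j) mod 5 = C h i' mod 5" .
    have e: "E (P h 0) (Q i (C h i))" "E (P h 0) (Q i' (C h i'))"
      using PQ[OF h(1,3), of 0] PQ[OF h(1,4), of 0] by simp_all
    have "Q i (C h' i + j) = Q i (C h i)" "Q i' (C h' i' + j) = Q i' (C h i')"
      by (rule QD(3)[OF h(3) 1], rule QD(3)[OF h(4) 2])
    then have e': "E (P h' j) (Q i (C h i))" "E (P h' j) (Q i' (C h i'))"
      using PQ[OF h(2,3), of j] PQ[OF h(2,4), of j] by simp_all
    have "P h 0 \<noteq> P h' j" using Pinj[OF h(1,2), of 0 j] h by blast
    then have "Q i (C h i) = Q i' (C h i')"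
      using uniq[of "P h 0" "P h' j"] e e' PV h QD(2) by simp
    then show False using Qinj[OF h(3,4)] h by blast
  qed
  obtain \<sigma> \<tau> where st: "bij_betw \<sigma> {..<5} {..<5}" "bij_betw \<tau> {..<5} {..<5}"
      "\<And>h i. h < 5 \<Longrightarrow> i < 5 \<Longrightarrow> C (\<tau> h) (\<sigma> i) = (h * i) mod 5"
  proof (rule difference_matrix_mod_5[of C])
    show "C h i < 5" if "h < 5" "i < 5" for h i using F[OF that] by (simp add: C_def)
    show "C 0 i = 0" if "i < 5" for i using F0[OF that, of 0] by (simp add: C_def)
    show "C h 0 = 0" if "h < 5" for h using Fh0[OF that, of 0] by (simp add: C_def)
  qed (use Cdiff in blast)+
  have slt: "\<sigma> i < 5" if "i < 5" for i using bij_betwE[OF st(1)] that by simp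
  have tlt: "\<tau> h < 5" if "h < 5" for h using bij_betwE[OF st(2)] that by simp
  define g where "g w = (case w of (x, h, j) \<Rightarrow> if x = 0 then P (\<tau> h) j else Q (\<sigma> h) j)" for w :: "nat \<times> nat \<times> nat"
  define W :: "(nat \<times> nat \<times> nat) set" where "W = hoffman_singleton_verts"
  have g: "g (0, h, j) = P (\<tau> h) j" "g (1, i, j) = Q (\<sigma> i) j" "g (Suc 0, i, j) = Q (\<sigma> i) j" for h i j
    by (simp_all add: g_def)
  have inj: "inj_on g W"
  proof (rule inj_onI)
    fix u v assume uv: "u \<in> W" "v \<in> W" "g u = g v"
    obtain x h j where u: "u = (x, h, j)" "x = 0 \<or> x = 1" "h < 5" "j < 5" using uv(1) by (auto simp: W_def)
    obtain x' h' j' where v: "v = (x', h', j')" "x' = 0 \<or> x' = 1" "h' < 5" "j' < 5" using uv(2) by (auto simp: W_def)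
    have s: "\<sigma> h = \<sigma> h' \<Longrightarrow> h = h'" "\<tau> h = \<tau> h' \<Longrightarrow> h = h'"
      using st(1,2) u v by (auto simp: bij_betw_def inj_on_def)
    have d: "P (\<tau> h) j \<noteq> Q (\<sigma> h') j'" "Q (\<sigma> h) j \<noteq> P (\<tau> h') j'"
      using PnQ[OF tlt slt] u v by metis+
    consider "x = 0" "x' = 0" | "x = 1" "x' = 1" | "x \<noteq> x'" using u v by blast
    then show "u = v"
    proof cases
      case 1
      then have "\<tau> h = \<tau> h' \<and> j mod 5 = j' mod 5"
        using Pinj[OF tlt[OF u(3)] tlt[OF v(3)], of j j'] uv(3) u v by (simp add: g)
      then show ?thesis using s u v 1 by simp
    next
      case 2
      then have "\<sigma> h = \<sigma> h' \<and> j mod 5 = j' mod 5"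
        using Qinj[OF slt[OF u(3)] slt[OF v(3)], of j j'] uv(3) u v by (simp add: g)
      then show ?thesis using s u v 2 by simp
    next
      case 3
      then show ?thesis using d uv(3) u v by (auto simp: g)
    qed
  qed
  have sub: "g ` W \<subseteq> V" using PV[OF tlt] QD(2)[OF slt] by (auto simp: W_def g)
  have hom: "E (g w) (g w')" if "hoffman_singleton_adj w w'" for w w'
  proof -
    have 1: "E (g (0, h, j)) (g (0, h, (j + 1) mod 5))" if "h < 5" for h j
    proof -
      have "P (\<tau> h) ((j + 1) mod 5) = P (\<tau> h) (j + 1)" by (rule Pper[OF tlt[OF that]]) simp
      then show ?thesis unfolding g using Pcyc(1)[OF tlt[OF that], of j] by simp
    qed
    have 2: "E (g (1, i, j)) (g (1, i, (j + 2) mod 5))" if "i < 5" for i j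
    proof -
      have "Q (\<sigma> i) ((j + 2) mod 5) = Q (\<sigma> i) (j + 2)" by (rule QD(3)[OF slt[OF that]]) simp
      then show ?thesis unfolding g using QD(6)[OF slt[OF that], of j] by simp
    qed
    have 3: "E (g (0, h, j)) (g (1, i, (h * i + j) mod 5))" if "h < 5" "i < 5" for h i j
    proof -
      have "Q (\<sigma> i) ((h * i + j) mod 5) = Q (\<sigma> i) (C (\<tau> h) (\<sigma> i) + j)"
        by (rule QD(3)[OF slt[OF that(2)]]) (use st(3)[OF that] in \<open>simp add: mod_simps\<close>)
      then show ?thesis unfolding g using PQ[OF tlt[OF that(1)] slt[OF that(2)], of j] by simp
    qed
    have arc: "E (g u) (g v)" if "hoffman_singleton_arc u v" for u v
      using that 1 2 3 unfolding hoffman_singleton_arc_def by blast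
    show ?thesis
      using that arc sym unfolding hoffman_singleton_adj_def by blast
  qed
  have W: "finite W" "g ` W \<subseteq> V" "inj_on g W" using sub inj by (simp_all add: W_def)
  have degV: "card (nb (g w)) = 7" if "w \<in> W" for w using deg W(2) that k by blast
  have degW: "7 \<le> card {w' \<in> W. hoffman_singleton_adj w w'}" if "w \<in> W" for w
    using hoffman_singleton_degree that unfolding W_def by blast
  have "card (g ` W) = card V" using card_image[OF inj] card_V k by (simp add: W_def card_cartesian_product)
  then have "g ` W = V" using card_subset_eq[OF fin sub] by blast
  then have "bij_betw g W V" using inj by (simp add: bij_betw_def)
  moreover have "E (g w) (g w') \<longleftrightarrow> hoffman_singleton_adj w w'" if "w \<in> W" "w' \<in> W" for w w'
    using regular_embedding_iff[of W g 7 hoffman_singleton_adj, OF W degV degW hom] that by blast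
  ultimately show ?thesis using that unfolding W_def by blast
qed

end

section \<open>Degrees of Moore graphs\<close>

definition mat_trace :: "'a::comm_monoid_add mat \<Rightarrow> 'a" where
  "mat_trace A = (\<Sum>i<dim_row A. A $$ (i, i))"

lemma mat_mult_index:
  assumes "A \<in> carrier_mat n n" "B \<in> carrier_mat n n" "i < n" "j < n"
  shows "(A * B) $$ (i, j) = (\<Sum>l<n. A $$ (i, l) * B $$ (l, j))"
  using assms by (simp add: scalar_prod_def atLeast0LessThan)

lemma mat_trace_mult_commute:
  fixes A B :: "'a::comm_semiring_0 mat"
  assumes "A \<in> carrier_mat n n" "B \<in> carrier_mat n n"
  shows "mat_trace (A * B) = mat_trace (B * A)"
proof -
  have "mat_trace (A * B) = (\<Sum>i<n. \<Sum>l<n. A $$ (i, l) * B $$ (l, i))"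
    using assms by (simp add: mat_trace_def mat_mult_index del: index_mult_mat(1))
  also have "\<dots> = (\<Sum>l<n. \<Sum>i<n. A $$ (i, l) * B $$ (l, i))" by (rule sum.swap)
  also have "\<dots> = mat_trace (B * A)"
    using assms by (simp add: mat_trace_def mat_mult_index mult.commute del: index_mult_mat(1))
  finally show ?thesis .
qed

text \<open>A triangular matrix similar to \<open>A\<close> has the same trace and is idempotent, so
  its diagonal entries are 0 or 1.\<close>

lemma idempotent_trace_nat:
  fixes A :: "complex mat"
  assumes A: "A \<in> carrier_mat n n" and idem: "A * A = A"
  obtains m :: nat where "mat_trace A = of_nat m"
proof -
  obtain es where es: "char_poly A = (\<Prod>a\<leftarrow>es. [:- a, 1:])" using char_poly_factorized[OF A] by blast
  obtain B where B: "B \<in> carrier_mat n n" "upper_triangular B" "similar_mat A B"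
    using schur_decomposition_exists[OF A es] by blast
  then obtain P Q where wit: "similar_mat_wit A B P Q" unfolding similar_mat_def by blast
  note w = similar_mat_witD2[OF A wit]
  have PQ: "P \<in> carrier_mat n n" "Q \<in> carrier_mat n n" "Q * P = 1\<^sub>m n" "A = P * B * Q" using w by auto
  have QAP: "Q * A * P = B"
  proof -
    have "Q * A * P = Q * (P * B * Q) * P" using PQ by simp
    also have "\<dots> = (Q * P) * B * (Q * P)"
      using PQ(1,2) B(1) by (simp add: assoc_mult_mat[of _ n n _ n _ n])
    also have "\<dots> = B" using PQ(3) B(1) by simp
    finally show ?thesis .
  qed
  have "B * B = B"
  proof -
    have "B * B = (Q * P) * B * (Q * P) * B" using PQ(3) B(1) by simp
    also have "\<dots> = Q * (P * B * Q) * (P * B)"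
      using PQ(1,2) B(1) by (simp add: assoc_mult_mat[of _ n n _ n _ n])
    also have "\<dots> = Q * (P * B * Q) * (P * (B * (Q * P)))" using PQ(3) B(1) by simp
    also have "\<dots> = Q * ((P * B * Q) * (P * B * Q)) * P"
      using PQ(1,2) B(1) by (simp add: assoc_mult_mat[of _ n n _ n _ n])
    also have "\<dots> = Q * A * P" using PQ(4) idem by simp
    also have "\<dots> = B" by (rule QAP)
    finally show ?thesis .
  qed
  have diag: "B $$ (i, i) = 0 \<or> B $$ (i, i) = 1" if i: "i < n" for i
  proof -
    have ut: "B $$ (l, j) = 0" if "j < l" "l < n" for l j using B(1,2) that by auto
    have "B $$ (i, i) = (\<Sum>l<n. B $$ (i, l) * B $$ (l, i))"
      using mat_mult_index[OF B(1) B(1) i i] \<open>B * B = B\<close> by simp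
    also have "\<dots> = (\<Sum>l\<in>{i}. B $$ (i, l) * B $$ (l, i))"
    proof (rule sum.mono_neutral_right)
      show "\<forall>l\<in>{..<n} - {i}. B $$ (i, l) * B $$ (l, i) = 0"
      proof
        fix l assume l: "l \<in> {..<n} - {i}"
        then consider "l < i" | "i < l" by fastforce
        then show "B $$ (i, l) * B $$ (l, i) = 0" using ut i l by cases auto
      qed
    qed (use i in auto)
    finally have "B $$ (i, i) * (B $$ (i, i) - 1) = 0" by (simp add: algebra_simps)
    then show ?thesis by simp
  qed
  have "mat_trace A = mat_trace (P * (B * Q))" using PQ B(1) by (simp add: assoc_mult_mat[of _ n n _ n _ n])
  also have "\<dots> = mat_trace (B * Q * P)" using PQ(1,2) B(1) by (intro mat_trace_mult_commute[of _ n]) auto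
  also have "\<dots> = mat_trace B" using PQ B(1) by (simp add: assoc_mult_mat[of _ n n _ n _ n])
  also have "\<dots> = (\<Sum>i<n. if B $$ (i, i) = 1 then 1 else 0)"
    unfolding mat_trace_def using B(1) diag by (intro sum.cong) auto
  also have "\<dots> = of_nat (card {i \<in> {..<n}. B $$ (i, i) = 1})" by (simp add: sum.If_cases Int_def)
  finally show ?thesis using that by blast
qed

text \<open>\<open>m\<close> divides \<open>N = k\<^sup>2 - 2 * k\<close>, and the quotient
  \<open>q\<close> satisfies \<open>4 * k - 3 = q\<^sup>2\<close>. Substituting
  \<open>4 * k = q\<^sup>2 + 3\<close> shows that \<open>16 * N\<close> is -15 modulo
  \<open>q\<close>, while \<open>q\<close> divides \<open>N\<close>; so \<open>q\<close> divides 15.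
  For \<open>k = 2\<close> both sides could vanish, which is why that degree is treated
  apart.\<close>

lemma moore_degree_arith:
  fixes m :: int and k :: nat
  assumes eq: "(4 * int k - 3) * m\<^sup>2 = ((int k)\<^sup>2 - 2 * int k)\<^sup>2" and k: "k > 2"
  shows "k \<in> {3, 7, 57}"
proof -
  define N where "N = (int k)\<^sup>2 - 2 * int k"
  have "N = int k * (int k - 2)" by (simp add: N_def power2_eq_square algebra_simps)
  then have N: "N > 0" using k by simp
  have "m\<^sup>2 dvd N\<^sup>2" using eq unfolding N_def by (metis dvd_triv_right)
  then have "m dvd N" by (simp add: pow_divides_pow_iff)
  then obtain q where q: "N = m * q" by blast
  have "m \<noteq> 0" using N q by auto
  have "(4 * int k - 3) * m\<^sup>2 = q\<^sup>2 * m\<^sup>2" using eq q unfolding N_def[symmetric] by (simp add: power_mult_distrib mult.commute)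
  then have qk: "4 * int k - 3 = q\<^sup>2" using \<open>m \<noteq> 0\<close> by simp
  have "16 * N = (4 * int k)\<^sup>2 - 8 * (4 * int k)" by (simp add: N_def power2_eq_square)
  also have "4 * int k = q\<^sup>2 + 3" using qk by simp
  finally have "16 * N = q * (q\<^sup>2 * q - 2 * q) - 15" by (simp add: power2_eq_square algebra_simps)
  then have "15 = q * (q\<^sup>2 * q - 2 * q) - 16 * N" by simp
  then have "15 = q * (q\<^sup>2 * q - 2 * q - 16 * m)" unfolding q by (simp add: algebra_simps)
  then have "q dvd 15" by (rule dvdI)
  then have "\<bar>q\<bar> dvd 15" by simp
  then have "nat \<bar>q\<bar> dvd 15" by (simp add: nat_dvd_iff)
  then have "nat \<bar>q\<bar> \<in> {d. d dvd 15}" by simp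
  moreover have "{d. d dvd (15::nat)} \<subseteq> {1, 3, 5, 15}"
  proof
    fix d :: nat assume "d \<in> {d. d dvd 15}"
    then have "d dvd 15" by simp
    then have "d \<le> 15" "15 mod d = 0" by (auto dest: dvd_imp_le)
    from \<open>d \<le> 15\<close> have "d = 0 \<or> d = 1 \<or> d = 2 \<or> d = 3 \<or> d = 4 \<or> d = 5 \<or> d = 6 \<or> d = 7 \<or> d = 8 \<or> d = 9 \<or>
        d = 10 \<or> d = 11 \<or> d = 12 \<or> d = 13 \<or> d = 14 \<or> d = 15" by presburger
    then show "d \<in> {1, 3, 5, 15}" using \<open>15 mod d = 0\<close> by (elim disjE) simp_all
  qed
  ultimately have "nat \<bar>q\<bar> = 1 \<or> nat \<bar>q\<bar> = 3 \<or> nat \<bar>q\<bar> = 5 \<or> nat \<bar>q\<bar> = 15" by blast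
  then have "\<bar>q\<bar> = 1 \<or> \<bar>q\<bar> = 3 \<or> \<bar>q\<bar> = 5 \<or> \<bar>q\<bar> = 15" by linarith
  moreover have "q\<^sup>2 = \<bar>q\<bar> * \<bar>q\<bar>" by (simp add: power2_eq_square)
  ultimately have "q\<^sup>2 = 1 \<or> q\<^sup>2 = 9 \<or> q\<^sup>2 = 25 \<or> q\<^sup>2 = 225" by (elim disjE) simp_all
  then show ?thesis using qk k by auto
qed

context moore
begin

text \<open>With \<open>\<tau>\<close> the negative root of \<open>x\<^sup>2 + x - (k - 1)\<close> and \<open>D = sqrt (4 k - 3)\<close>, the matrix
  \<open>(A - \<tau>) (1 - J / n) / D\<close> is the projection onto an eigenspace of \<open>A\<close>; its trace is an integer.\<close>

lemma moore_degree: "k \<in> {2, 3, 7, 57}"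
proof (cases "k = 2")
  case False
  then have k2: "k > 2" using k_ge by simp
  define n where "n = card V"
  have n: "n = k * k + 1" using card_V by (simp add: n_def)
  define D where "D = sqrt (4 * real k - 3)"
  have D2: "D * D = 4 * real k - 3" unfolding D_def using k2 by simp
  have D0: "D > 0" unfolding D_def using k2 by simp
  define \<tau> where "\<tau> = (- 1 - D) / 2"
  have tau2: "\<tau> * \<tau> = real k - 1 - \<tau>"
  proof -
    have "4 * (\<tau> * \<tau>) = 1 + 2 * D + D * D" by (simp add: \<tau>_def field_simps)
    then show ?thesis using D2 by (simp add: \<tau>_def field_simps)
  qed
  have Dt: "D = - 1 - 2 * \<tau>" by (simp add: \<tau>_def field_simps)
  \<comment> \<open>Chosen so that the rows of \<open>a - \<tau> * \<delta> - c\<close> sum to 0,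
    which puts the constant vector in the kernel.\<close>
  define c where "c = (real k - \<tau>) / real n"
  have "n \<noteq> 0" using n by simp
  then have n0: "real n \<noteq> 0" by simp
  have cn: "c * real n = real k - \<tau>" using n0 by (simp add: c_def)
  define a where "a u v = (if E u v then 1 else 0 :: real)" for u v
  define \<delta> where "\<delta> u v = (if u = v then 1 else 0 :: real)" for u v :: 'a
  define e where "e u v = (a u v - \<tau> * \<delta> u v - c) / D" for u v
  have row: "(\<Sum>w\<in>V. a u w) = real k" if "u \<in> V" for u
    using deg[OF that] fin by (simp add: a_def sum.If_cases nb_def Int_def)
  have col: "(\<Sum>w\<in>V. a w v) = real k" if "v \<in> V" for v
    using row[OF that] by (simp add: a_def E_commute)
  have sq: "(\<Sum>w\<in>V. a u w * a w v) = (real k - 1) * \<delta> u v - a u v + 1" if uv: "u \<in> V" "v \<in> V" for u v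
  proof -
    have "(\<Sum>w\<in>V. a u w * a w v) = (\<Sum>w\<in>nb u \<inter> nb v. 1)"
      by (rule sum.mono_neutral_cong_right) (use fin sym in \<open>auto simp: a_def\<close>)
    then have *: "(\<Sum>w\<in>V. a u w * a w v) = real (card (nb u \<inter> nb v))" by simp
    consider "u = v" | "E u v" | "u \<noteq> v" "\<not> E u v" by blast
    then show ?thesis
    proof cases
      case 1
      then show ?thesis using * deg uv by (simp add: a_def \<delta>_def irrefl)
    next
      case 2
      then have "u \<noteq> v" using irrefl by auto
      then show ?thesis using * tri[OF uv 2] 2 by (simp add: a_def \<delta>_def)
    next
      case 3
      then show ?thesis using * quad[OF uv] by (simp add: a_def \<delta>_def)
    qed
  qed
  have dl: "(\<Sum>w\<in>V. \<delta> u w * f w) = f u" "(\<Sum>w\<in>V. f w * \<delta> w u) = f u" if "u \<in> V" for u and f :: "'a \<Rightarrow> real"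
    using that fin by (simp_all add: \<delta>_def if_distrib[of "\<lambda>x. x * _"] if_distrib[of "\<lambda>x. _ * x"] cong: if_cong)
  have idem: "(\<Sum>w\<in>V. e u w * e w v) = e u v" if uv: "u \<in> V" "v \<in> V" for u v
  proof -
    have "D * D * (\<Sum>w\<in>V. e u w * e w v) = (\<Sum>w\<in>V. (a u w - \<tau> * \<delta> u w - c) * (a w v - \<tau> * \<delta> w v - c))"
      using D0 by (simp add: sum_distrib_left e_def)
    also have "\<dots> = (\<Sum>w\<in>V. a u w * a w v - \<tau> * (a u w * \<delta> w v) - c * a u w
        - \<tau> * (\<delta> u w * a w v) + \<tau> * \<tau> * (\<delta> u w * \<delta> w v) + \<tau> * c * (\<delta> u w * 1)
        - c * a w v + c * \<tau> * (1 * \<delta> w v) + c * c)"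
      by (intro sum.cong refl) (simp add: algebra_simps)
    also have "\<dots> = (real k - 1) * \<delta> u v - a u v + 1 - \<tau> * a u v - c * real k
        - \<tau> * a u v + \<tau> * \<tau> * \<delta> u v + \<tau> * c - c * real k + c * \<tau> + real n * (c * c)"
      unfolding sum.distrib sum_subtractf sum_distrib_left[symmetric] sq[OF uv] row[OF uv(1)] col[OF uv(2)]
        dl[OF uv(1)] dl[OF uv(2)] using dl(2)[OF uv(2), of "\<lambda>_. 1"] by (simp add: n_def)
    also have "\<dots> = D * (a u v - \<tau> * \<delta> u v - c)"
    proof -
      have "1 - 2 * (c * (real k - \<tau>)) + c * (c * real n) = - D * c"
      proof -
        have "real n * (1 - c * (real k - \<tau>)) = real n * (- D * c)"
        proof -
          have "real n * (1 - c * (real k - \<tau>)) = real n - (c * real n) * (real k - \<tau>)"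
            by (simp add: algebra_simps)
          also have "\<dots> = real n - (real k - \<tau>) * (real k - \<tau>)" unfolding cn ..
          also have "\<dots> = (1 + 2 * \<tau>) * (real k - \<tau>)" using tau2 by (simp add: n algebra_simps)
          also have "\<dots> = - D * (c * real n)" unfolding cn using Dt by simp
          also have "\<dots> = real n * (- D * c)" by simp
          finally show ?thesis .
        qed
        then have "1 - c * (real k - \<tau>) = - D * c" using n0 mult_cancel_left by blast
        moreover have "c * (c * real n) = c * (real k - \<tau>)" using cn by simp
        ultimately show ?thesis by linarith
      qed
      then have "1 = 2 * (c * (real k - \<tau>)) - c * (c * real n) - D * c" by simp
      moreover have "(real k - 1) * \<delta> u v + \<tau> * \<tau> * \<delta> u v = - D * \<tau> * \<delta> u v"
      proof -
        have "- D * \<tau> = \<tau> + 2 * (\<tau> * \<tau>)" unfolding Dt by (simp add: algebra_simps)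
        then have "(real k - 1) + \<tau> * \<tau> = - D * \<tau>" using tau2 by linarith
        then show ?thesis by (metis distrib_right)
      qed
      moreover have "- a u v - \<tau> * a u v - \<tau> * a u v = D * a u v" unfolding Dt by (simp add: algebra_simps)
      ultimately show ?thesis by (simp add: algebra_simps)
    qed
    finally have "D * D * (\<Sum>w\<in>V. e u w * e w v) = D * D * e u v" using D0 by (simp add: e_def)
    then show ?thesis using D0 by simp
  qed
  obtain f where f: "bij_betw f {..<n} V"
    using ex_bij_betw_nat_finite[OF fin] by (auto simp: n_def atLeast0LessThan)
  have fV: "f i \<in> V" if "i < n" for i using bij_betwE[OF f] that by simp
  define M where "M = mat n n (\<lambda>(i, j). complex_of_real (e (f i) (f j)))"
  have M: "M \<in> carrier_mat n n" by (simp add: M_def)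
  have "M * M = M"
  proof (rule eq_matI)
    fix i j assume "i < dim_row M" "j < dim_col M"
    then have ij: "i < n" "j < n" by (simp_all add: M_def)
    have "(M * M) $$ (i, j) = (\<Sum>l<n. complex_of_real (e (f i) (f l) * e (f l) (f j)))"
      unfolding mat_mult_index[OF M M ij] by (intro sum.cong) (use ij in \<open>auto simp: M_def\<close>)
    also have "\<dots> = complex_of_real (\<Sum>l<n. e (f i) (f l) * e (f l) (f j))" by simp
    also have "(\<Sum>l<n. e (f i) (f l) * e (f l) (f j)) = (\<Sum>w\<in>V. e (f i) w * e w (f j))"
      by (rule sum.reindex_bij_betw[OF f])
    also have "\<dots> = e (f i) (f j)" using idem fV ij by blast
    finally show "(M * M) $$ (i, j) = M $$ (i, j)" using ij by (simp add: M_def)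
  qed (simp_all add: M_def)
  then obtain m where m: "mat_trace M = of_nat m" using idempotent_trace_nat[OF M] by blast
  have "mat_trace M = complex_of_real (\<Sum>i<n. e (f i) (f i))" by (simp add: mat_trace_def M_def)
  also have "(\<Sum>i<n. e (f i) (f i)) = (\<Sum>w\<in>V. e w w)" by (rule sum.reindex_bij_betw[OF f])
  also have "\<dots> = real n * ((- \<tau> - c) / D)" by (simp add: e_def a_def \<delta>_def irrefl n_def)
  finally have "complex_of_real (real n * ((- \<tau> - c) / D)) = complex_of_real (real m)" using m by simp
  then have "real n * ((- \<tau> - c) / D) = real m" by (simp only: of_real_eq_iff)
  then have "real m * D = - \<tau> * real n - c * real n" using D0 by (simp add: field_simps)
  also have "\<dots> = - \<tau> * (real k * real k) - real k" unfolding cn by (simp add: n algebra_simps)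
  finally have "2 * (real m * D) = (real k)\<^sup>2 * (1 + D) - 2 * real k"
    by (simp add: \<tau>_def power2_eq_square field_simps)
  then have mD: "D * (2 * real m - (real k)\<^sup>2) = (real k)\<^sup>2 - 2 * real k" by (simp add: algebra_simps)
  \<comment> \<open>Squaring \<open>mD\<close> removes the possibly irrational \<open>D\<close> and
    leaves an equation between integers.\<close>
  define z where "z = 2 * int m - (int k)\<^sup>2"
  have "D * real_of_int z = (real k)\<^sup>2 - 2 * real k" using mD by (simp add: z_def)
  then have "(D * real_of_int z) * (D * real_of_int z) = ((real k)\<^sup>2 - 2 * real k)\<^sup>2"
    by (simp add: power2_eq_square)
  moreover have "(D * real_of_int z) * (D * real_of_int z) = (4 * real k - 3) * (real_of_int z)\<^sup>2"
  proof -
    have "(D * real_of_int z) * (D * real_of_int z) = (D * D) * (real_of_int z)\<^sup>2"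
      by (simp add: power2_eq_square)
    then show ?thesis using D2 by simp
  qed
  ultimately have "real_of_int ((4 * int k - 3) * z\<^sup>2) = real_of_int (((int k)\<^sup>2 - 2 * int k)\<^sup>2)" by simp
  then have "(4 * int k - 3) * z\<^sup>2 = ((int k)\<^sup>2 - 2 * int k)\<^sup>2" by (simp only: of_int_eq_iff)
  then show ?thesis using moore_degree_arith[OF _ k2] by blast
qed simp

end

section \<open>The two consequences of positive curvature, and the graph of lines\<close>

context terwilliger_graph
begin

text \<open>If \<open>u\<close> and \<open>v\<close> were adjacent, \<open>x\<close> and
  \<open>v\<close> would be common neighbours of the nonadjacent \<open>u\<close> and
  \<open>y\<close>, hence adjacent.\<close>

lemma no_edge_between_private:
  assumes xy: "x \<in> V" "y \<in> V" "E x y" and u: "u \<in> nb x - cnb y" and v: "v \<in> nb y - cnb x"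
  shows "\<not> E u v"
proof
  assume "E u v"
  have uy: "u \<noteq> y" "\<not> E u y" using u sym by auto
  have "x \<in> nb u \<inter> nb y" using xy u sym by auto
  moreover have "v \<in> nb u \<inter> nb y" using v \<open>E u v\<close> by auto
  moreover have "x \<noteq> v" using v by auto
  ultimately have "E x v" using terw[of u y x v] uy u xy by auto
  then show False using v by auto
qed

text \<open>This is what positive curvature of all edges gives by Kantorovich duality. It is applied to the
  distance from the private neighbours of \<open>y\<close>, capped at 3.\<close>

definition lipschitz_bound :: bool where
  "lipschitz_bound \<longleftrightarrow> (\<forall>x\<in>V. \<forall>y\<in>V. \<forall>f :: 'a \<Rightarrow> real. E x y \<longrightarrow>
      (\<forall>u\<in>V. \<forall>v\<in>V. E u v \<longrightarrow> f u - f v \<le> 1) \<longrightarrow> f x - f y = 1 \<longrightarrow>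
      (\<Sum>u\<in>nb x. f u) - (\<Sum>u\<in>nb y. f u) < real d)"

context
  assumes curv: lipschitz_bound
begin

lemma capped_distance_sum:
  assumes xy: "x \<in> V" "y \<in> V" "E x y"
  shows "2 * (d - Suc \<alpha>) \<le> d"
    and "d = 2 * Suc \<alpha> \<Longrightarrow> z \<in> nb x - cnb y \<Longrightarrow> \<exists>w\<in>nb y - cnb x. nb z \<inter> nb w \<noteq> {}"
proof -
  define Nx where "Nx = nb x - cnb y"
  define Ny where "Ny = nb y - cnb x"
  define f :: "'a \<Rightarrow> real" where
    "f v = (if v \<in> Ny then 0 else if \<exists>u\<in>Ny. E v u then 1
        else if \<exists>u\<in>Ny. \<exists>w\<in>V. E v w \<and> E w u then 2 else 3)" for v
  have cx: "d = Suc \<alpha> + card Nx" unfolding Nx_def by (rule card_nb_split[OF xy])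
  have "d = Suc \<alpha> + card Ny" unfolding Ny_def using card_nb_split[of y x] xy sym by blast
  then have "card Ny \<noteq> 0" using alpha_less by linarith
  then obtain v0 where v0: "v0 \<in> Ny" by fastforce
  have NyV: "Ny \<subseteq> V" by (auto simp: Ny_def)
  have lip: "f u - f v \<le> 1" if uv: "u \<in> V" "v \<in> V" "E u v" for u v
  proof -
    have le1: "f u \<le> 1" if "v \<in> Ny" using that uv(3) by (auto simp: f_def)
    have le2: "f u \<le> 2" if "t \<in> Ny" "E v t" for t using that uv by (auto simp: f_def)
    have le3: "f u \<le> 3" by (simp add: f_def)
    consider "v \<in> Ny" | t where "v \<notin> Ny" "t \<in> Ny" "E v t" | "v \<notin> Ny" "\<not> (\<exists>t\<in>Ny. E v t)" by blast
    then show ?thesis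
    proof cases
      case 1
      then have "f v = 0" by (simp add: f_def)
      then show ?thesis using le1 1 by simp
    next
      case (2 t)
      then have "f v = 1" by (auto simp: f_def)
      then show ?thesis using le2[OF 2(2,3)] by simp
    next
      case 3
      then have "f v \<ge> 2" by (simp add: f_def)
      then show ?thesis using le3 by simp
    qed
  qed
  have fy: "f y = 1"
  proof -
    have "E y v0" using v0 by (auto simp: Ny_def)
    moreover have "y \<notin> Ny" using irrefl by (auto simp: Ny_def)
    ultimately show ?thesis using v0 by (auto simp: f_def)
  qed
  have fx: "f x = 2"
  proof -
    have "x \<notin> Ny" by (auto simp: Ny_def)
    moreover have "\<not> E x u" if "u \<in> Ny" for u using that by (auto simp: Ny_def)
    moreover have "E x y" "E y v0" using xy v0 by (auto simp: Ny_def)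
    ultimately show ?thesis using v0 xy unfolding f_def by auto
  qed
  have f2: "f u \<ge> 2" if u: "u \<in> Nx" for u
  proof -
    have "u \<notin> Ny" using u by (auto simp: Nx_def Ny_def)
    moreover have "\<not> E u v" if "v \<in> Ny" for v
      using no_edge_between_private[OF xy] u that unfolding Nx_def Ny_def by blast
    ultimately show ?thesis by (auto simp: f_def)
  qed
  have split: "(\<Sum>u\<in>nb a. f u) = f b + (\<Sum>u\<in>nb x \<inter> nb y. f u) + (\<Sum>u\<in>N. f u)"
    if "nb a = insert b (nb x \<inter> nb y) \<union> N" "b \<notin> nb x \<inter> nb y" "insert b (nb x \<inter> nb y) \<inter> N = {}" "finite N" for a b N
  proof -
    have "(\<Sum>u\<in>nb a. f u) = (\<Sum>u\<in>insert b (nb x \<inter> nb y). f u) + (\<Sum>u\<in>N. f u)"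
      unfolding that(1) by (rule sum.union_disjoint) (use that in auto)
    then show ?thesis using that(2) by simp
  qed
  have sx: "(\<Sum>u\<in>nb x. f u) = f y + (\<Sum>u\<in>nb x \<inter> nb y. f u) + (\<Sum>u\<in>Nx. f u)"
    by (rule split) (use xy irrefl in \<open>auto simp: Nx_def\<close>)
  have sy: "(\<Sum>u\<in>nb y. f u) = f x + (\<Sum>u\<in>nb x \<inter> nb y. f u) + (\<Sum>u\<in>Ny. f u)"
    by (rule split) (use xy irrefl sym in \<open>auto simp: Ny_def\<close>)
  have "(\<Sum>u\<in>Ny. f u) = 0" by (simp add: f_def)
  moreover have "(\<Sum>u\<in>nb x. f u) - (\<Sum>u\<in>nb y. f u) < real d"
    using curv[unfolded lipschitz_bound_def, rule_format, of x y f] xy lip fx fy by simp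
  \<comment> \<open>The common neighbours cancel and \<open>f y - f x = -1\<close>, so the curvature
    bound becomes a bound on the sum over \<open>Nx\<close>.\<close>
  ultimately have less: "(\<Sum>u\<in>Nx. f u) < real d + 1" using sx sy fx fy by simp
  have ge: "(\<Sum>u\<in>Nx. f u) \<ge> 2 * real (card Nx)"
    using sum_bounded_below[of Nx 2 f] f2 by (simp add: mult.commute)
  have "2 * card Nx \<le> d" using less ge by linarith
  then show "2 * (d - Suc \<alpha>) \<le> d" using cx by simp
  assume eq: "d = 2 * Suc \<alpha>" and z: "z \<in> nb x - cnb y"
  show "\<exists>w\<in>nb y - cnb x. nb z \<inter> nb w \<noteq> {}"
  proof (rule ccontr)
    assume no: "\<not> ?thesis"
    have zN: "z \<in> Nx" "finite Nx" using z by (auto simp: Nx_def)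
    have "\<not> E w u" if "u \<in> Ny" "w \<in> V" "E z w" for u w
    proof
      assume "E w u"
      then have "w \<in> nb z \<inter> nb u" using that sym by auto
      then show False using no that(1) unfolding Ny_def by blast
    qed
    \<comment> \<open>\<open>z\<close> reaches the cap and exceeds the lower bound 2 by 1; as
      \<open>2 * card Nx = d\<close> here, the strict bound on the sum leaves no room for
      that.\<close>
    then have "f z = 3" using f2[OF zN(1)] by (auto simp: f_def split: if_splits)
    moreover have "(\<Sum>u\<in>Nx. f u) = f z + (\<Sum>u\<in>Nx - {z}. f u)" using zN by (simp add: sum.remove)
    moreover have "(\<Sum>u\<in>Nx - {z}. f u) \<ge> 2 * real (card (Nx - {z}))"
      using sum_bounded_below[of "Nx - {z}" 2 f] f2 by (simp add: mult.commute)
    moreover have "card Nx = Suc (card (Nx - {z}))" using zN by (metis card_Suc_Diff1)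
    ultimately have "2 * real (card Nx) + 1 \<le> (\<Sum>u\<in>Nx. f u)" by simp
    then have "2 * card Nx < d" using less by linarith
    then show False using cx eq by simp
  qed
qed

lemma degree_le: "d \<le> 2 * Suc \<alpha>"
proof -
  obtain x where x: "x \<in> V" using not_complete by blast
  obtain y where y: "y \<in> nb x" using nb_nonempty[OF x] by blast
  show ?thesis using capped_distance_sum(1)[of x y] x y by auto
qed

end

end

section \<open>The graph of lines for \<beta> = 1\<close>

text \<open>For \<open>\<beta> = 1\<close> the maximal cliques are the lines of a partial linear space; a vertex lies on two of them,
  so that the graph is the line graph of the graph of its lines.\<close>

locale terwilliger_lines = terwilliger_graph +
  assumes beta_1: "\<beta> = 1" and degree_small: "d \<le> 2 * Suc \<alpha>"
    and private_common: "\<And>x y z. x \<in> V \<Longrightarrow> y \<in> V \<Longrightarrow> E x y \<Longrightarrow> d = 2 * Suc \<alpha> \<Longrightarrow> z \<in> nb x - cnb y \<Longrightarrow>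
        \<exists>w\<in>nb y - cnb x. nb z \<inter> nb w \<noteq> {}"
begin

text \<open>For an edge this is the maximal clique containing it.\<close>

definition line :: "'a \<Rightarrow> 'a \<Rightarrow> 'a set" where
  "line x y = insert x (insert y (nb x \<inter> nb y))"

definition lines :: "'a set set" where
  "lines = {line x y | x y. x \<in> V \<and> y \<in> V \<and> E x y}"

definition meet :: "'a set \<Rightarrow> 'a set \<Rightarrow> bool" where
  "meet l m \<longleftrightarrow> l \<noteq> m \<and> l \<inter> m \<noteq> {}"

definition lines_through :: "'a \<Rightarrow> 'a set set" where
  "lines_through x = {l \<in> lines. x \<in> l}"

text \<open>Nonadjacent \<open>u\<close>, \<open>w\<close> would have the two common neighbours
  \<open>x\<close> and \<open>v\<close>. So neighbourhoods are disjoint unions of cliques.\<close>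

lemma local_trans:
  assumes "x \<in> V" "u \<in> nb x" "v \<in> nb x" "w \<in> nb x" "E u v" "E v w" "u \<noteq> w"
  shows "E u w"
proof (rule ccontr)
  assume n: "\<not> E u w"
  have xv: "x \<in> nb u \<inter> nb w" "v \<in> nb u \<inter> nb w" "x \<noteq> v" using assms sym irrefl by auto
  have "nb u \<inter> nb w \<noteq> {}" using xv(1) by blast
  then have "card (nb u \<inter> nb w) = 1" using beta[of u w] beta_1 n assms(2,4,7) by simp
  then show False using xv by (metis card_1_singletonE singletonD)
qed

lemma line_clique:
  assumes xy: "x \<in> V" "y \<in> V" "E x y" and ab: "a \<in> line x y" "b \<in> line x y" "a \<noteq> b"
  shows "E a b"
proof -
  have cc: "E c c'" if "c \<in> nb x \<inter> nb y" "c' \<in> nb x \<inter> nb y" "c \<noteq> c'" for c c'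
    by (rule local_trans[of x c y c']) (use that xy sym in auto)
  have xc: "E x c \<and> E c x \<and> E y c \<and> E c y" if "c \<in> nb x \<inter> nb y" for c using that sym by auto
  have "E y x" using xy sym by blast
  then show ?thesis using ab xy(3) cc xc unfolding line_def by blast
qed

lemma line_props:
  assumes "l \<in> lines"
  shows "l \<subseteq> V" "finite l" "card l = \<alpha> + 2" "\<And>a b. a \<in> l \<Longrightarrow> b \<in> l \<Longrightarrow> a \<noteq> b \<Longrightarrow> E a b"
proof -
  obtain x y where l: "l = line x y" and xy: "x \<in> V" "y \<in> V" "E x y" using assms by (auto simp: lines_def)
  show V: "l \<subseteq> V" using l xy by (auto simp: line_def)
  show "finite l" using V fin finite_subset by blast
  have "x \<noteq> y" using xy irrefl by auto
  then show "card l = \<alpha> + 2" using l alpha[OF xy] irrefl by (simp add: line_def)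
  show "\<And>a b. a \<in> l \<Longrightarrow> b \<in> l \<Longrightarrow> a \<noteq> b \<Longrightarrow> E a b" using line_clique[OF xy] l by blast
qed

lemma line_in_lines: "x \<in> V \<Longrightarrow> y \<in> V \<Longrightarrow> E x y \<Longrightarrow> line x y \<in> lines"
  by (auto simp: lines_def)

lemma line_eq:
  assumes l: "l \<in> lines" and ab: "a \<in> l" "b \<in> l" "a \<noteq> b"
  shows "l = line a b"
proof -
  have E: "a \<in> V" "b \<in> V" "E a b" using line_props[OF l] ab by auto
  have "l \<subseteq> line a b"
  proof
    fix c assume "c \<in> l"
    then show "c \<in> line a b" using line_props[OF l] ab by (auto simp: line_def)
  qed
  then show ?thesis
    using card_subset_eq[of "line a b" l] line_props[OF l] line_props[OF line_in_lines[OF E]] by simp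
qed

lemma lines_meet_once:
  assumes "l \<in> lines" "m \<in> lines" "l \<noteq> m" "a \<in> l \<inter> m" "b \<in> l \<inter> m"
  shows "a = b"
  using line_eq[of l a b] line_eq[of m a b] assms by blast

text \<open>A second line through \<open>x\<close> exists by \<open>alpha_less\<close>. Two lines
  cover \<open>2 * \<alpha> + 3\<close> vertices of \<open>cnb x\<close>, the most that
  \<open>degree_small\<close> permits; so they fill \<open>cnb x\<close>, and equality holds in the
  degree bound.\<close>

lemma lines_through_eq:
  assumes x: "x \<in> V"
  shows "d = 2 * Suc \<alpha>" "\<exists>l m. l \<noteq> m \<and> lines_through x = {l, m}"
proof -
  obtain y where y: "y \<in> nb x" using nb_nonempty[OF x] by blast
  have "d = Suc \<alpha> + card (nb x - cnb y)" using card_nb_split[of x y] x y by simp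
  then have "card (nb x - cnb y) \<noteq> 0" using alpha_less by linarith
  then have "nb x - cnb y \<noteq> {}" by (metis card.empty)
  then obtain z where z: "z \<in> nb x" "z \<notin> cnb y" by blast
  have E: "y \<in> V" "E x y" "z \<in> V" "E x z" using y z by auto
  let ?l = "line x y" and ?m = "line x z"
  have L: "?l \<in> lines" "?m \<in> lines" using line_in_lines x E by auto
  have xl: "x \<in> ?l" "x \<in> ?m" "y \<in> ?l" "z \<in> ?m" by (auto simp: line_def)
  have ne: "?l \<noteq> ?m"
  proof
    assume "?l = ?m"
    then have "y \<in> ?l" "z \<in> ?l" using xl by auto
    then have "y = z \<or> E y z" using line_props(4)[OF L(1)] by blast
    then show False using z E by auto
  qed
  have "?l \<inter> ?m = {x}" using lines_meet_once[OF L ne, of x] xl by blast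
  then have c: "card (?l \<union> ?m) = 2 * \<alpha> + 3"
    using card_Un_Int[of ?l ?m] line_props(2,3)[OF L(1)] line_props(2,3)[OF L(2)] by simp
  have sub: "?l \<union> ?m \<subseteq> cnb x" using x E by (auto simp: line_def)
  then have "2 * \<alpha> + 3 \<le> card (cnb x)" using card_mono[OF finite_cnb sub] c by simp
  then show d: "d = 2 * Suc \<alpha>" using degree_small deg[OF x] by (simp add: card_cnb)
  then have all: "?l \<union> ?m = cnb x"
    using card_subset_eq[OF finite_cnb sub] c deg[OF x] by (simp add: card_cnb)
  have "lines_through x = {?l, ?m}"
  proof
    show "{?l, ?m} \<subseteq> lines_through x" using L xl by (auto simp: lines_through_def)
    show "lines_through x \<subseteq> {?l, ?m}"
    proof
      fix n assume "n \<in> lines_through x"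
      then have n: "n \<in> lines" "x \<in> n" by (auto simp: lines_through_def)
      have "\<not> n \<subseteq> {x}"
      proof
        assume "n \<subseteq> {x}"
        then have "card n \<le> card {x}" by (intro card_mono) auto
        then show False using line_props(3)[OF n(1)] by simp
      qed
      then obtain t where t: "t \<in> n" "t \<noteq> x" by blast
      then have "E x t" "t \<in> V" using line_props[OF n(1)] n by auto
      then have "t \<in> ?l \<union> ?m" using all by simp
      moreover have "n = line x t" using line_eq[OF n t(1)] t by blast
      moreover have "?l = line x t" if "t \<in> ?l" using line_eq[OF L(1) xl(1) that] t by blast
      moreover have "?m = line x t" if "t \<in> ?m" using line_eq[OF L(2) xl(2) that] t by blast
      ultimately show "n \<in> {?l, ?m}" by blast
    qed
  qed
  then show "\<exists>l m. l \<noteq> m \<and> lines_through x = {l, m}" using ne by blast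
qed

lemma no_three_lines:
  assumes "l \<in> lines" "m \<in> lines" "n \<in> lines" "x \<in> l" "x \<in> m" "x \<in> n" "l \<noteq> m" "l \<noteq> n"
  shows "m = n"
proof -
  have "x \<in> V" using line_props(1) assms by blast
  then obtain a b where ab: "lines_through x = {a, b}" using lines_through_eq(2)[of x] by blast
  have "l \<in> lines_through x" "m \<in> lines_through x" "n \<in> lines_through x"
    using assms by (auto simp: lines_through_def)
  then show ?thesis unfolding ab using assms(7,8) by auto
qed

lemma other_line:
  assumes "l \<in> lines" "x \<in> l"
  obtains m where "m \<in> lines" "x \<in> m" "m \<noteq> l"
proof -
  have "x \<in> V" using line_props(1) assms by blast
  then obtain a b where ab: "a \<noteq> b" "lines_through x = {a, b}" using lines_through_eq(2)[of x] by blast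
  then have "a \<in> lines" "b \<in> lines" "x \<in> a" "x \<in> b" by (auto simp: lines_through_def)
  then show ?thesis using that ab(1) by metis
qed

lemma adjacent_iff_line:
  assumes "x \<in> V" "y \<in> V"
  shows "E x y \<longleftrightarrow> x \<noteq> y \<and> (\<exists>l\<in>lines. x \<in> l \<and> y \<in> l)"
proof
  assume "E x y"
  then show "x \<noteq> y \<and> (\<exists>l\<in>lines. x \<in> l \<and> y \<in> l)"
    using line_in_lines[OF assms] irrefl by (auto simp: line_def)
qed (use line_props(4) in blast)

text \<open>The three intersection points are distinct, as no vertex is on three lines, and pairwise
  adjacent; so one lies on the line through the other two, giving a third line there.\<close>

lemma line_triangle_free:
  assumes L: "l \<in> lines" "m \<in> lines" "n \<in> lines" and M: "meet l m" "meet m n" "meet l n"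
  shows False
proof -
  obtain x where x: "x \<in> l" "x \<in> m" using M by (auto simp: meet_def)
  obtain y where y: "y \<in> l" "y \<in> n" using M by (auto simp: meet_def)
  obtain z where z: "z \<in> m" "z \<in> n" using M by (auto simp: meet_def)
  have ne: "l \<noteq> m" "m \<noteq> n" "l \<noteq> n" using M by (auto simp: meet_def)
  have xy: "x \<noteq> y" using no_three_lines[of l m n x] L x y ne by auto
  have xz: "x \<noteq> z" using no_three_lines[of l m n x] L x z ne by auto
  have yz: "y \<noteq> z" using no_three_lines[of l m n y] L y z ne by auto
  have "E x z" "E y z" "z \<in> V" using line_props L x y z xz yz by blast+
  then have "z \<in> line x y" by (auto simp: line_def)
  then have "z \<in> l" using line_eq[OF L(1) x(1) y(1) xy] by simp
  then show False using no_three_lines[of l m n z] L z ne by auto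
qed

text \<open>The four intersection points form a quadrangle \<open>a, b, c, e\<close>, in which the
  nonadjacent \<open>a\<close> and \<open>c\<close> have two common neighbours, against \<beta> =
  1.\<close>

lemma line_common_unique:
  assumes L: "l \<in> lines" "m \<in> lines" "n \<in> lines" "n' \<in> lines" and lm: "l \<noteq> m"
    and M: "meet l n" "meet m n" "meet l n'" "meet m n'"
  shows "n = n'"
proof (rule ccontr)
  assume nn: "n \<noteq> n'"
  have nlm: "l \<inter> m = {}"
  proof (rule ccontr)
    assume "l \<inter> m \<noteq> {}"
    then have "meet l m" using lm by (simp add: meet_def)
    then show False using line_triangle_free[OF L(1,2,3)] M by blast
  qed
  obtain a where a: "a \<in> l" "a \<in> n" using M by (auto simp: meet_def)
  obtain b where b: "b \<in> m" "b \<in> n" using M by (auto simp: meet_def)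
  obtain c where c: "c \<in> m" "c \<in> n'" using M by (auto simp: meet_def)
  obtain e where e: "e \<in> l" "e \<in> n'" using M by (auto simp: meet_def)
  have ne: "l \<noteq> n" "m \<noteq> n" "l \<noteq> n'" "m \<noteq> n'" using M by (auto simp: meet_def)
  have d: "a \<noteq> b" "c \<noteq> e" "b \<noteq> e" "a \<noteq> c" using nlm a b c e by auto
  have bc: "b \<noteq> c" using no_three_lines[of m n n' b] L b c ne nn by auto
  have ae: "a \<noteq> e" using no_three_lines[of l n n' a] L a e ne nn by auto
  have V: "a \<in> V" "b \<in> V" "c \<in> V" "e \<in> V" using line_props(1) L a b c e by blast+
  have E: "E a b" "E c b" "E a e" "E c e" using line_props(4) L a b c e d bc ae by metis+
  have nac: "\<not> E a c"
  proof
    assume "E a c"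
    then obtain g where g: "g \<in> lines" "a \<in> g" "c \<in> g" using adjacent_iff_line V by blast
    have "g = l \<or> g = n" using no_three_lines[of g l n a] g L a ne by blast
    moreover have "g = m \<or> g = n'" using no_three_lines[of g m n' c] g L c ne by blast
    ultimately show False using lm nn ne by auto
  qed
  have "b \<in> nb a \<inter> nb c" "e \<in> nb a \<inter> nb c" using E V by auto
  moreover from this have "card (nb a \<inter> nb c) = 1" using beta[OF V(1,3) d(4) nac] beta_1 by blast
  ultimately show False using d by (metis card_1_singletonE singletonD)
qed

text \<open>The equality case of the transport argument enters here. With \<open>z\<close>,
  \<open>x\<close>, \<open>y\<close> on \<open>l \<inter> b\<close>, \<open>b \<inter> c\<close>,
  \<open>c \<inter> c'\<close>, the vertex \<open>z\<close> is private to \<open>x\<close>, so some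
  \<open>w\<close> private to \<open>y\<close> has a common neighbour \<open>t\<close> with
  \<open>z\<close>. The edges from \<open>t\<close> to \<open>z\<close> and to \<open>w\<close> each
  lie on one of two lines; three of the four combinations shorten the path, and
  \<open>line_common_unique\<close> excludes the fourth.\<close>

lemma line_path_3:
  assumes L: "l \<in> lines" "b \<in> lines" "c \<in> lines" "c' \<in> lines"
    and M: "meet l b" "meet b c" "meet c c'" and ne: "l \<noteq> c" "b \<noteq> c'"
  shows "l = c' \<or> meet l c' \<or> (\<exists>g\<in>lines. meet l g \<and> meet g c')"
proof (rule ccontr)
  assume no: "\<not> ?thesis"
  have nbc': "b \<inter> c' = {}" using no M L ne(2) by (auto simp: meet_def)
  obtain z where z: "z \<in> l" "z \<in> b" using M by (auto simp: meet_def)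
  obtain x where x: "x \<in> b" "x \<in> c" using M by (auto simp: meet_def)
  obtain y where y: "y \<in> c" "y \<in> c'" using M by (auto simp: meet_def)
  have ne': "l \<noteq> b" "b \<noteq> c" "c \<noteq> c'" "l \<noteq> c'" using M no by (auto simp: meet_def)
  have V: "x \<in> V" "y \<in> V" "z \<in> V" using line_props(1) L x y z by blast+
  have "x \<noteq> y" using nbc' x y by auto
  then have Exy: "E x y" using line_props(4)[OF L(3)] x y by blast
  have "z \<noteq> x" using no_three_lines[of l b c z] L z x ne ne' by auto
  then have Exz: "E x z" using line_props(4)[OF L(2)] x z by blast
  have two: "g = p \<or> g = q" if "g \<in> lines" "t \<in> g" "p \<in> lines" "q \<in> lines" "t \<in> p" "t \<in> q" "p \<noteq> q" for g t p q
    using no_three_lines[of g p q t] that by blast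
  have "z \<notin> cnb y"
  proof
    assume "z \<in> cnb y"
    moreover have "z \<noteq> y" using nbc' z y by auto
    ultimately have "E y z" by simp
    then obtain g where g: "g \<in> lines" "y \<in> g" "z \<in> g" using adjacent_iff_line V by blast
    have "g = l \<or> g = b" using two[OF g(1,3) L(1,2) z ne'(1)] .
    moreover have "g = c \<or> g = c'" using two[OF g(1,2) L(3,4) y ne'(3)] .
    ultimately show False using ne ne' by auto
  qed
  then have "z \<in> nb x - cnb y" using Exz V by simp
  then obtain w t where w: "w \<in> nb y - cnb x" and t: "t \<in> nb z \<inter> nb w"
    using private_common[OF V(1,2) Exy lines_through_eq(1)[OF V(1)]] by blast
  have wV: "w \<in> V" "E y w" "t \<in> V" "E z t" "E w t" using w t by auto
  obtain q where q: "q \<in> lines" "y \<in> q" "w \<in> q" using adjacent_iff_line V wV by blast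
  have "w \<notin> c" using w x line_props(4)[OF L(3)] by auto
  then have wc': "w \<in> c'" using two[OF q(1,2) L(3,4) y ne'(3)] q by blast
  obtain g where g: "g \<in> lines" "w \<in> g" "g \<noteq> c'" using other_line[OF L(4) wc'] by blast
  obtain h where h: "h \<in> lines" "z \<in> h" "t \<in> h" using adjacent_iff_line V wV by blast
  have hl: "h = l \<or> h = b" using two[OF h(1,2) L(1,2) z ne'(1)] .
  obtain i where i: "i \<in> lines" "w \<in> i" "t \<in> i" using adjacent_iff_line wV by blast
  have ig: "i = c' \<or> i = g" using two[OF i(1,2) L(4) g(1) wc' g(2)] g by blast
  have gc': "meet g c'" using g wc' by (auto simp: meet_def)
  have nlc': "l \<inter> c' = {}" using no by (auto simp: meet_def)
  have "h = b \<and> i = g"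
  proof -
    have "\<not> (h = l \<and> i = c')" using nlc' h i by auto
    moreover have "\<not> (h = l \<and> i = g)"
    proof
      assume "h = l \<and> i = g"
      then have "t \<in> l" "t \<in> g" using h i by auto
      then have "l = g \<or> meet l g" by (auto simp: meet_def)
      then show False using no gc' g by auto
    qed
    moreover have "\<not> (h = b \<and> i = c')" using nbc' h i by auto
    ultimately show ?thesis using hl ig by blast
  qed
  then have tb: "t \<in> b" "t \<in> g" using h i by auto
  have "b \<noteq> g" using nbc' wc' g by auto
  then have "meet b g" using tb by (auto simp: meet_def)
  then have "g = c"
    using line_common_unique[OF L(2,4) g(1) L(3) ne(2)] M gc' by (auto simp: meet_def Int_commute)
  then show False using \<open>w \<notin> c\<close> g by auto
qed

text \<open>By \<open>line_path_3\<close> the lines at distance at most 2 from \<open>l\<close> are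
  closed under meeting, so their union is closed under adjacency and equals
  \<open>V\<close>.\<close>

lemma line_distance_2:
  assumes L: "l \<in> lines" "m \<in> lines"
  shows "l = m \<or> meet l m \<or> (\<exists>g\<in>lines. meet l g \<and> meet g m)"
proof -
  define R where "R = {c \<in> lines. l = c \<or> meet l c \<or> (\<exists>g\<in>lines. meet l g \<and> meet g c)}"
  have step: "c' \<in> R" if c: "c \<in> R" "c' \<in> lines" "meet c c'" for c c'
  proof -
    consider "l = c" | "meet l c" | g where "g \<in> lines" "meet l g" "meet g c" using c(1) by (auto simp: R_def)
    then show ?thesis
    proof cases
      case 3
      show ?thesis
      proof (cases "l = c \<or> g = c'")
        case True
        then show ?thesis using 3 c by (auto simp: R_def)
      next
        case False
        then show ?thesis using line_path_3[OF L(1) 3(1) _ c(2) 3(2,3) c(3)] c by (auto simp: R_def)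
      qed
    qed (use c in \<open>auto simp: R_def\<close>)
  qed
  have lR: "l \<in> R" using L by (simp add: R_def)
  have "\<Union>R = V"
  proof (rule connected)
    show "\<Union>R \<subseteq> V" using line_props(1) by (auto simp: R_def)
    have "l \<noteq> {}" using line_props(3)[OF L(1)] by auto
    then show "\<Union>R \<noteq> {}" using lR by blast
    fix u v assume u: "u \<in> \<Union>R" and v: "v \<in> nb u"
    obtain c where c: "c \<in> R" "u \<in> c" using u by blast
    have cL: "c \<in> lines" using c by (simp add: R_def)
    have "u \<in> V" using c cL line_props(1) by blast
    then obtain c' where c': "c' \<in> lines" "u \<in> c'" "v \<in> c'" using adjacent_iff_line[of u v] v by auto
    then have "c = c' \<or> meet c c'" using c by (auto simp: meet_def)
    then show "v \<in> \<Union>R" using step[OF c(1) c'(1)] c c' by blast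
  qed
  moreover obtain v where v: "v \<in> m" using line_props(3)[OF L(2)] by fastforce
  ultimately obtain c where c: "c \<in> R" "v \<in> c" using line_props(1)[OF L(2)] by blast
  then have "c = m \<or> meet c m" using v by (auto simp: meet_def)
  then have "m \<in> R" using step[OF c(1) L(2)] c by blast
  then show ?thesis by (simp add: R_def)
qed

sublocale lg: finite_graph lines meet
proof
  have "lines \<subseteq> Pow V" using line_props(1) by auto
  then show "finite lines" using fin finite_subset by blast
qed (auto simp: meet_def)

text \<open>Each of the \<open>\<alpha> + 2\<close> vertices of a line lies on exactly one other
  line, which gives the degree. The rest is \<open>line_triangle_free\<close>,
  \<open>line_common_unique\<close> and \<open>line_distance_2\<close>.\<close>

lemma lines_moore: "moore lines meet (\<alpha> + 2)"
proof
  fix l assume l: "l \<in> lines"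
  define f where "f x = (SOME m. m \<in> lines \<and> x \<in> m \<and> m \<noteq> l)" for x
  have f: "f x \<in> lines \<and> x \<in> f x \<and> f x \<noteq> l" if "x \<in> l" for x
    unfolding f_def using other_line[OF l that] by (metis (mono_tags, lifting) someI_ex)
  have "bij_betw f l (lg.nb l)"
    unfolding bij_betw_def
  proof
    show "inj_on f l"
    proof (rule inj_onI)
      fix x y assume xy: "x \<in> l" "y \<in> l" "f x = f y"
      show "x = y" using lines_meet_once[of l "f x" x y] f[OF xy(1)] f[OF xy(2)] xy l by auto
    qed
    show "f ` l = lg.nb l"
    proof
      show "f ` l \<subseteq> lg.nb l" using f unfolding meet_def lg.nb_def by blast
      show "lg.nb l \<subseteq> f ` l"
      proof
        fix m assume "m \<in> lg.nb l"
        then obtain x where x: "m \<in> lines" "l \<noteq> m" "x \<in> l" "x \<in> m" by (auto simp: meet_def)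
        then have "m = f x" using no_three_lines[of l m "f x" x] f[of x] l by auto
        then show "m \<in> f ` l" using x by blast
      qed
    qed
  qed
  then show "card (lg.nb l) = \<alpha> + 2" using bij_betw_same_card line_props(3)[OF l] by metis
next
  fix l m assume "l \<in> lines" "m \<in> lines" "meet l m"
  then show "lg.nb l \<inter> lg.nb m = {}" using line_triangle_free[of l m] unfolding lg.nb_def by blast
next
  fix l m assume lm: "l \<in> lines" "m \<in> lines" "l \<noteq> m" "\<not> meet l m"
  then obtain g where g: "g \<in> lines" "meet l g" "meet g m" using line_distance_2 by blast
  have "lg.nb l \<inter> lg.nb m = {g}"
  proof
    have mg: "meet m g" using g by (auto simp: meet_def)
    show "{g} \<subseteq> lg.nb l \<inter> lg.nb m" using g mg by simp
    show "lg.nb l \<inter> lg.nb m \<subseteq> {g}"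
      using line_common_unique[OF lm(1,2) _ g(1) lm(3) _ _ g(2) mg] unfolding lg.nb_def by blast
  qed
  then show "card (lg.nb l \<inter> lg.nb m) = 1" by simp
next
  show "2 \<le> \<alpha> + 2" by simp
  obtain x where x: "x \<in> V" using not_complete by blast
  obtain y where y: "y \<in> nb x" using nb_nonempty[OF x] by blast
  then show "lines \<noteq> {}" using line_in_lines[OF x, of y] by auto
qed

text \<open>This exhibits the graph as a line graph: a vertex is the edge joining the two lines
  through it.\<close>

lemma lines_through_bij:
  "bij_betw lines_through V {{l, m} | l m. l \<in> lines \<and> m \<in> lines \<and> meet l m}"
  unfolding bij_betw_def
proof
  have through: "\<exists>l m. l \<in> lines \<and> m \<in> lines \<and> l \<noteq> m \<and> x \<in> l \<and> x \<in> m \<and> lines_through x = {l, m}"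
    if xV: "x \<in> V" for x
  proof -
    obtain l m where "l \<noteq> m" "lines_through x = {l, m}" using lines_through_eq(2)[OF xV] by blast
    moreover from this have "l \<in> lines_through x" "m \<in> lines_through x" by auto
    ultimately show ?thesis by (auto simp: lines_through_def)
  qed
  show "inj_on lines_through V"
  proof (rule inj_onI)
    fix x y assume xy: "x \<in> V" "y \<in> V" "lines_through x = lines_through y"
    obtain l m where lm: "l \<in> lines" "m \<in> lines" "l \<noteq> m" "x \<in> l" "x \<in> m" "lines_through x = {l, m}"
      using through[OF xy(1)] by blast
    then have "l \<in> lines_through y" "m \<in> lines_through y" using xy(3) by auto
    then have "y \<in> l \<inter> m" by (auto simp: lines_through_def)
    then show "x = y" using lines_meet_once[of l m x y] lm by blast
  qed
  show "lines_through ` V = {{l, m} | l m. l \<in> lines \<and> m \<in> lines \<and> meet l m}"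
  proof
    show "lines_through ` V \<subseteq> {{l, m} | l m. l \<in> lines \<and> m \<in> lines \<and> meet l m}"
    proof
      fix e assume "e \<in> lines_through ` V"
      then obtain x where x: "x \<in> V" "e = lines_through x" by blast
      obtain l m where lm: "l \<in> lines" "m \<in> lines" "l \<noteq> m" "x \<in> l" "x \<in> m" "lines_through x = {l, m}"
        using through[OF x(1)] by blast
      then have "meet l m" by (auto simp: meet_def)
      then show "e \<in> {{l, m} | l m. l \<in> lines \<and> m \<in> lines \<and> meet l m}" using lm x by blast
    qed
    show "{{l, m} | l m. l \<in> lines \<and> m \<in> lines \<and> meet l m} \<subseteq> lines_through ` V"
    proof
      fix e assume "e \<in> {{l, m} | l m. l \<in> lines \<and> m \<in> lines \<and> meet l m}"
      then obtain l m where lm: "e = {l, m}" "l \<in> lines" "m \<in> lines" "meet l m" by blast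
      then obtain x where x: "x \<in> l" "x \<in> m" "l \<noteq> m" by (auto simp: meet_def)
      have "x \<in> V" using x lm line_props(1) by blast
      moreover have "lines_through x = {l, m}"
        using no_three_lines[of _ l m x] lm x by (auto simp: lines_through_def)
      ultimately show "e \<in> lines_through ` V" using lm(1) by blast
    qed
  qed
qed

lemma adjacent_iff_lines_through:
  assumes "x \<in> V" "y \<in> V"
  shows "E x y \<longleftrightarrow> lines_through x \<noteq> lines_through y \<and> lines_through x \<inter> lines_through y \<noteq> {}"
proof -
  have "lines_through x = lines_through y \<longleftrightarrow> x = y"
    using lines_through_bij assms by (auto simp: bij_betw_def inj_on_def)
  then show ?thesis using adjacent_iff_line[OF assms] by (auto simp: lines_through_def)
qed

end

section \<open>Lin--Lu--Yau curvature\<close>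

text \<open>The limit is the supremum of \<open>F\<close> on \<open>{0..<1}\<close>.\<close>

lemma mono_bounded_tendsto_at_left:
  fixes F :: "real \<Rightarrow> real"
  assumes mono: "\<And>p q. 0 \<le> p \<Longrightarrow> p \<le> q \<Longrightarrow> q < 1 \<Longrightarrow> F p \<le> F q"
    and bound: "\<And>p. 0 \<le> p \<Longrightarrow> p < 1 \<Longrightarrow> F p \<le> B"
  obtains l where "l \<le> B" "(F \<longlongrightarrow> l) (at_left 1)"
proof -
  define l where "l = (SUP p\<in>{0..<1}. F p)"
  have bdd: "bdd_above (F ` {0..<1})" using bound by (intro bdd_aboveI[of _ B]) auto
  have upper: "F p \<le> l" if "0 \<le> p" "p < 1" for p
    unfolding l_def by (rule cSUP_upper[OF _ bdd]) (use that in auto)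
  have "l \<le> B" unfolding l_def by (rule cSUP_least) (use bound in auto)
  moreover have "(F \<longlongrightarrow> l) (at_left 1)"
  proof (rule order_tendstoI)
    fix a assume "a < l"
    then obtain p where p: "p \<in> {0..<1}" "a < F p"
      unfolding l_def using less_cSUP_iff[OF _ bdd] by auto
    then have "a < F q" if "p < q" "q < 1" for q using mono[of p q] that by simp
    then show "\<forall>\<^sub>F q in at_left 1. a < F q"
      unfolding eventually_at_left_field using p by (intro exI[of _ p]) auto
  next
    fix a assume "l < a"
    then have "F q < a" if "0 < q" "q < 1" for q using upper[of q] that by simp
    then show "\<forall>\<^sub>F q in at_left 1. F q < a"
      unfolding eventually_at_left_field by (intro exI[of _ 0]) auto
  qed
  ultimately show ?thesis using that by blast
qed

section \<open>Distances and walks\<close>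

context pair_graph
begin

definition adjacent :: "'a \<Rightarrow> 'a \<Rightarrow> bool" where
  "adjacent u v \<longleftrightarrow> (u, v) \<in> parcs G"

sublocale fg: finite_graph "pverts G" adjacent
proof
  show "finite (pverts G)" by (rule pair_finite_verts)
  show "adjacent v u" if "adjacent u v" for u v
    using that arcs_symmetric by (simp add: adjacent_def)
  show "\<not> adjacent v v" for v using pair_no_loops[of "(v, v)"] by (auto simp: adjacent_def)
qed

lemma adjacent_verts: "adjacent u v \<Longrightarrow> u \<in> pverts G" "adjacent u v \<Longrightarrow> v \<in> pverts G"
  using in_arcsD1 in_arcsD2 by (auto simp: adjacent_def)

lemma nb_eq: "fg.nb u = {v. adjacent u v}"
  using adjacent_verts by (auto simp: fg.nb_def)

lemma out_degree_eq: "out_degree (with_proj G) u = card (fg.nb u)"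
proof -
  have "out_arcs (with_proj G) u = Pair u ` fg.nb u"
    by (auto simp: out_arcs_def nb_eq adjacent_def)
  then show ?thesis by (simp add: out_degree_def card_image inj_on_def)
qed

lemma common_neighbours_eq: "common_neighbours G u v = fg.nb u \<inter> fg.nb v"
  by (auto simp: common_neighbours_def adjacent_def)

lemma gdist_eq: "gdist G u v = (INF p\<in>{p. awalk u p v}. ereal (real (length p)))"
proof -
  have "awalk_cost (\<lambda>_. 1) p = real (length p)" for p :: "('a \<times> 'a) list"
    by (induction p) auto
  then show ?thesis by (simp add: gdist_def \<mu>_def)
qed

lemma gdist_le: "awalk u p v \<Longrightarrow> gdist G u v \<le> ereal (real (length p))"
  unfolding gdist_eq by (rule INF_lower) simp

text \<open>Walk lengths are natural numbers, so a least one exists.\<close>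

lemma gdist_attained:
  assumes "awalk u q v"
  obtains p where "awalk u p v" "gdist G u v = ereal (real (length p))"
proof -
  define n where "n = (LEAST n. \<exists>p. awalk u p v \<and> length p = n)"
  have "\<exists>p. awalk u p v \<and> length p = n" unfolding n_def by (rule LeastI_ex) (use assms in blast)
  then obtain p where p: "awalk u p v" "length p = n" by blast
  have "n \<le> length q" if "awalk u q v" for q
    unfolding n_def by (rule Least_le) (use that in blast)
  then have "ereal (real n) \<le> gdist G u v"
    unfolding gdist_eq by (intro INF_greatest) auto
  then have "gdist G u v = ereal (real (length p))" using gdist_le[OF p(1)] p(2) by simp
  then show ?thesis using that p by blast
qed

lemma awalk_arc: "adjacent u v \<Longrightarrow> awalk u [(u, v)] v"
  using adjacent_verts by (simp add: awalk_Cons_iff awalk_Nil_iff adjacent_def)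

lemma awalk_arc2: "adjacent u v \<Longrightarrow> adjacent v w \<Longrightarrow> awalk u [(u, v), (v, w)] w"
  using adjacent_verts by (simp add: awalk_Cons_iff awalk_Nil_iff adjacent_def)

lemma gdist_adjacent:
  assumes "adjacent u v"
  shows "gdist G u v = 1"
proof -
  obtain p where p: "awalk u p v" "gdist G u v = ereal (real (length p))"
    using gdist_attained[OF awalk_arc[OF assms]] by blast
  have "p \<noteq> []" using p(1) assms fg.irrefl by (auto simp: awalk_Nil_iff)
  moreover have "length p \<le> 1" using gdist_le[OF awalk_arc[OF assms]] p(2) by simp
  ultimately have "length p = 1" by (cases p) auto
  then show ?thesis using p(2) by (simp add: one_ereal_def)
qed

lemma gdist_2_iff:
  assumes "u \<in> pverts G" "v \<in> pverts G"
  shows "gdist G u v = 2 \<longleftrightarrow> u \<noteq> v \<and> \<not> adjacent u v \<and> fg.nb u \<inter> fg.nb v \<noteq> {}"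
proof
  assume d: "gdist G u v = 2"
  have "{p. awalk u p v} \<noteq> {}"
  proof
    assume "{p. awalk u p v} = {}"
    \<comment> \<open>Without walks the infimum is over the empty set and hence infinite.\<close>
    then have "gdist G u v = Orderings.top" by (simp only: gdist_eq image_empty Inf_empty)
    then show False using d by (simp add: top_ereal_def)
  qed
  then obtain p where p: "awalk u p v" "gdist G u v = ereal (real (length p))"
    using gdist_attained by blast
  have "length p = 2" using p(2) d by (simp add: numeral_eq_ereal)
  then obtain e e' where "p = [e, e']" by (auto simp: numeral_2_eq_2 length_Suc_conv)
  then have "e \<in> parcs G" "e' \<in> parcs G" "u = fst e" "fst e' = snd e" "snd e' = v"
    using p(1) by (auto simp: awalk_Cons_iff awalk_Nil_iff)
  then have "adjacent u (snd e)" "adjacent (snd e) v" unfolding adjacent_def by (metis prod.collapse)+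
  then have "snd e \<in> fg.nb u \<inter> fg.nb v" using fg.sym by (auto simp: nb_eq)
  moreover have "\<not> adjacent u v" using gdist_adjacent d by auto
  moreover have "u \<noteq> v"
  proof
    assume "u = v"
    then have "awalk u [] v" using assms by (simp add: awalk_Nil_iff)
    from gdist_le[OF this] have "ereal 2 \<le> ereal 0" using d by (simp add: numeral_eq_ereal)
    then show False by simp
  qed
  ultimately show "u \<noteq> v \<and> \<not> adjacent u v \<and> fg.nb u \<inter> fg.nb v \<noteq> {}" by blast
next
  assume a: "u \<noteq> v \<and> \<not> adjacent u v \<and> fg.nb u \<inter> fg.nb v \<noteq> {}"
  then obtain w where w: "adjacent u w" "adjacent w v" using fg.sym by (auto simp: nb_eq)
  obtain p where p: "awalk u p v" "gdist G u v = ereal (real (length p))"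
    using gdist_attained[OF awalk_arc2[OF w]] by blast
  have "length p \<le> 2" using gdist_le[OF awalk_arc2[OF w]] p(2) by simp
  moreover have "length p \<noteq> 0" using p(1) a by (auto simp: awalk_Nil_iff)
  moreover have "length p \<noteq> 1"
  proof
    assume "length p = 1"
    then obtain e where "p = [e]" by (auto simp: length_Suc_conv)
    then show False using p(1) a by (auto simp: awalk_Cons_iff awalk_Nil_iff adjacent_def)
  qed
  ultimately have "length p = 2" by linarith
  then show "gdist G u v = 2" using p(2) by (simp add: numeral_eq_ereal)
qed

lemma awalk_lipschitz:
  fixes f :: "'a \<Rightarrow> real"
  assumes lip: "\<And>u v. adjacent u v \<Longrightarrow> f u - f v \<le> 1" and "awalk u p v"
  shows "f u - f v \<le> real (length p)"
  using assms(2)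
proof (induction p arbitrary: u)
  case Nil
  then show ?case by (simp add: awalk_Nil_iff)
next
  case (Cons e p)
  then have "e \<in> parcs G" "u = fst e" "awalk (snd e) p v" by (auto simp: awalk_Cons_iff)
  then have "f u - f (snd e) \<le> 1" "f (snd e) - f v \<le> real (length p)"
    using lip[of u "snd e"] Cons.IH by (auto simp: adjacent_def)
  then show ?case by simp
qed

lemma connected_awalk:
  assumes "Digraph_Component.connected (with_proj G)" "u \<in> pverts G" "v \<in> pverts G"
  obtains p where "awalk u p v"
proof -
  have "symmetric (with_proj G)" by (rule pair_sym_arcs)
  then have "strongly_connected (with_proj G)"
    using symmetric_connected_imp_strongly_connected assms(1) by blast
  then have "u \<rightarrow>\<^sup>*\<^bsub>with_proj G\<^esub> v" using assms(2,3) by (auto simp: strongly_connected_def)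
  then show ?thesis using that by (auto simp: reachable_awalk)
qed

lemma connected_closed_subset:
  assumes c: "Digraph_Component.connected (with_proj G)" and S: "S \<subseteq> pverts G" "S \<noteq> {}"
    and cl: "\<And>u v. u \<in> S \<Longrightarrow> v \<in> fg.nb u \<Longrightarrow> v \<in> S"
  shows "S = pverts G"
proof
  obtain u where u: "u \<in> S" using S by blast
  have walk: "v \<in> S" if "awalk x p v" "x \<in> S" for x p v
    using that
  proof (induction p arbitrary: x)
    case Nil
    then show ?case by (simp add: awalk_Nil_iff)
  next
    case (Cons e p)
    then have "e \<in> parcs G" "x = fst e" "awalk (snd e) p v" by (auto simp: awalk_Cons_iff)
    then have "snd e \<in> fg.nb x" by (auto simp: nb_eq adjacent_def)
    then show ?case using Cons.IH[of "snd e"] cl Cons.prems \<open>awalk (snd e) p v\<close> by blast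
  qed
  show "pverts G \<subseteq> S"
  proof
    fix v assume "v \<in> pverts G"
    then obtain p where "awalk u p v" using connected_awalk[OF c] u S by blast
    then show "v \<in> S" using walk u by blast
  qed
qed (use S in simp)

lemma gdist_real:
  assumes "Digraph_Component.connected (with_proj G)" "u \<in> pverts G" "v \<in> pverts G"
  obtains p where "awalk u p v" "real_of_ereal (gdist G u v) = real (length p)"
  using connected_awalk[OF assms] gdist_attained by (metis real_of_ereal.simps(1))

section \<open>Transport plans and the bound on the curvature\<close>

definition plan_cost :: "('a \<Rightarrow> 'a \<Rightarrow> real) \<Rightarrow> real" where
  "plan_cost \<pi> = (\<Sum>u\<in>pverts G. \<Sum>v\<in>pverts G. \<pi> u v * real_of_ereal (gdist G u v))"

lemma wasserstein1_eq: "wasserstein1 G m1 m2 = (INF \<pi>\<in>{\<pi>. transport_plan G m1 m2 \<pi>}. plan_cost \<pi>)"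
  by (simp add: wasserstein1_def plan_cost_def)

context
  fixes x y :: 'a and d :: nat
  assumes conn: "Digraph_Component.connected (with_proj G)" and xy: "adjacent x y"
    and dx: "card (fg.nb x) = d" and dy: "card (fg.nb y) = d"
begin

lemma d_pos: "d > 0"
proof -
  have "y \<in> fg.nb x" using xy by (simp add: nb_eq)
  then show ?thesis using dx by (metis card_gt_0_iff empty_iff fg.finite_nb)
qed

lemma plan_cost_nonneg:
  assumes "transport_plan G m1 m2 \<pi>"
  shows "0 \<le> plan_cost \<pi>"
  unfolding plan_cost_def
proof (intro sum_nonneg mult_nonneg_nonneg)
  fix u v assume uv: "u \<in> pverts G" "v \<in> pverts G"
  show "0 \<le> \<pi> u v" using assms uv by (simp add: transport_plan_def)
  show "0 \<le> real_of_ereal (gdist G u v)" using gdist_real[OF conn uv] by (metis of_nat_0_le_iff)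
qed

lemma lazy_sum:
  fixes f :: "'a \<Rightarrow> real"
  assumes z: "z \<in> pverts G" "card (fg.nb z) = d"
  shows "(\<Sum>v\<in>pverts G. f v * lazy_walk_measure G p z v) = p * f z + (1 - p) / real d * (\<Sum>v\<in>fg.nb z. f v)"
proof -
  let ?V = "pverts G"
  have "(\<Sum>v\<in>?V. f v * lazy_walk_measure G p z v)
      = f z * lazy_walk_measure G p z z + (\<Sum>v\<in>?V - {z}. f v * lazy_walk_measure G p z v)"
    using z fg.fin by (simp add: sum.remove)
  also have "(\<Sum>v\<in>?V - {z}. f v * lazy_walk_measure G p z v) = (\<Sum>v\<in>fg.nb z. f v * ((1 - p) / real d))"
  proof (rule sum.mono_neutral_cong_right)
    show "fg.nb z \<subseteq> ?V - {z}" using fg.irrefl by auto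
  qed (use fg.fin z fg.irrefl in \<open>auto simp: lazy_walk_measure_def out_degree_eq adjacent_def\<close>)
  finally show ?thesis by (simp add: lazy_walk_measure_def sum_distrib_left mult.commute)
qed

lemma lazy_mass:
  assumes z: "z \<in> pverts G" "card (fg.nb z) = d"
  shows "(\<Sum>v\<in>pverts G. lazy_walk_measure G p z v) = 1"
  using lazy_sum[OF z, of "\<lambda>_. 1" p] z d_pos by simp

lemma lazy_nonneg: "0 \<le> p \<Longrightarrow> p \<le> 1 \<Longrightarrow> 0 \<le> lazy_walk_measure G p z v"
  by (simp add: lazy_walk_measure_def)

lemma xyV: "x \<in> pverts G" "y \<in> pverts G" using adjacent_verts xy by auto

abbreviation lazy_w1 where
  "lazy_w1 p \<equiv> wasserstein1 G (lazy_walk_measure G p x) (lazy_walk_measure G p y)"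

text \<open>The product of the two measures; it ensures that the real infimum in
  \<open>wasserstein1\<close> is over a nonempty set.\<close>

lemma plan_exists:
  assumes "0 \<le> p" "p \<le> 1"
  shows "transport_plan G (lazy_walk_measure G p x) (lazy_walk_measure G p y)
    (\<lambda>u v. lazy_walk_measure G p x u * lazy_walk_measure G p y v)"
  using lazy_nonneg[OF assms] lazy_mass[OF xyV(1) dx, of p] lazy_mass[OF xyV(2) dy, of p]
  by (simp add: transport_plan_def flip: sum_distrib_left sum_distrib_right)

lemma lazy_w1_le:
  assumes "transport_plan G (lazy_walk_measure G p x) (lazy_walk_measure G p y) \<pi>"
  shows "lazy_w1 p \<le> plan_cost \<pi>"
  unfolding wasserstein1_eq
proof (rule cINF_lower)
  show "bdd_below (plan_cost ` {\<pi>. transport_plan G (lazy_walk_measure G p x) (lazy_walk_measure G p y) \<pi>})"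
    using plan_cost_nonneg by (intro bdd_belowI[of _ 0]) auto
qed (use assms in simp)

lemma lazy_w1_ge:
  assumes "0 \<le> p" "p \<le> 1"
    and "\<And>\<pi>. transport_plan G (lazy_walk_measure G p x) (lazy_walk_measure G p y) \<pi> \<Longrightarrow> a \<le> plan_cost \<pi>"
  shows "a \<le> lazy_w1 p"
  unfolding wasserstein1_eq by (rule cINF_greatest) (use assms plan_exists in auto)

text \<open>The easy half of Kantorovich duality: \<open>f u - f v\<close> is at most the distance,
  and this is summed against a transport plan.\<close>

lemma lazy_w1_dual:
  fixes f :: "'a \<Rightarrow> real"
  assumes p: "0 \<le> p" "p \<le> 1" and lip: "\<And>u v. adjacent u v \<Longrightarrow> f u - f v \<le> 1"
  shows "p * (f x - f y) + (1 - p) / real d * ((\<Sum>v\<in>fg.nb x. f v) - (\<Sum>v\<in>fg.nb y. f v)) \<le> lazy_w1 p"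
proof (rule lazy_w1_ge[OF p])
  fix \<pi> assume pl: "transport_plan G (lazy_walk_measure G p x) (lazy_walk_measure G p y) \<pi>"
  let ?V = "pverts G"
  have "(\<Sum>u\<in>?V. f u * lazy_walk_measure G p x u) = (\<Sum>u\<in>?V. f u * (\<Sum>v\<in>?V. \<pi> u v))"
    using pl by (intro sum.cong) (auto simp: transport_plan_def)
  also have "\<dots> = (\<Sum>u\<in>?V. \<Sum>v\<in>?V. \<pi> u v * f u)" by (simp add: sum_distrib_left mult.commute)
  finally have 1: "(\<Sum>u\<in>?V. f u * lazy_walk_measure G p x u) = (\<Sum>u\<in>?V. \<Sum>v\<in>?V. \<pi> u v * f u)" .
  have "(\<Sum>v\<in>?V. f v * lazy_walk_measure G p y v) = (\<Sum>v\<in>?V. f v * (\<Sum>u\<in>?V. \<pi> u v))"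
    using pl by (intro sum.cong) (auto simp: transport_plan_def)
  also have "\<dots> = (\<Sum>v\<in>?V. \<Sum>u\<in>?V. \<pi> u v * f v)" by (simp add: sum_distrib_left mult.commute)
  also have "\<dots> = (\<Sum>u\<in>?V. \<Sum>v\<in>?V. \<pi> u v * f v)" by (rule sum.swap)
  finally have 2: "(\<Sum>v\<in>?V. f v * lazy_walk_measure G p y v) = (\<Sum>u\<in>?V. \<Sum>v\<in>?V. \<pi> u v * f v)" .
  have "(\<Sum>u\<in>?V. f u * lazy_walk_measure G p x u) - (\<Sum>v\<in>?V. f v * lazy_walk_measure G p y v)
      = (\<Sum>u\<in>?V. \<Sum>v\<in>?V. \<pi> u v * (f u - f v))"
    unfolding 1 2 by (simp add: sum_subtractf right_diff_distrib)
  also have "\<dots> \<le> plan_cost \<pi>"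
    unfolding plan_cost_def
  proof (intro sum_mono mult_left_mono)
    fix u v assume uv: "u \<in> ?V" "v \<in> ?V"
    show "0 \<le> \<pi> u v" using pl uv by (simp add: transport_plan_def)
    obtain q where "awalk u q v" "real_of_ereal (gdist G u v) = real (length q)"
      using gdist_real[OF conn uv] by blast
    then show "f u - f v \<le> real_of_ereal (gdist G u v)" using awalk_lipschitz[of f, OF lip] by simp
  qed
  finally show "p * (f x - f y) + (1 - p) / real d * ((\<Sum>v\<in>fg.nb x. f v) - (\<Sum>v\<in>fg.nb y. f v)) \<le> plan_cost \<pi>"
    unfolding lazy_sum[OF xyV(1) dx] lazy_sum[OF xyV(2) dy] by (simp add: algebra_simps)
qed

text \<open>The walk measure with idleness \<open>q\<close> mixes the one with idleness
  \<open>p\<close> and a point mass, with weights \<open>t\<close> and \<open>1 - t\<close>. Mixing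
  a plan with the transport from \<open>x\<close> to \<open>y\<close>, at distance 1, gives the
  bound, from which \<open>lazy_curvature G p x y / (1 - p)\<close> grows with
  \<open>p\<close>.\<close>

lemma lazy_w1_convex:
  assumes p: "0 \<le> p" "p \<le> q" "q < 1"
  defines "t \<equiv> (1 - q) / (1 - p)"
  shows "lazy_w1 q \<le> t * lazy_w1 p + (1 - t)"
proof -
  have t: "0 < t" "t \<le> 1" "t * (1 - p) = 1 - q" using p by (auto simp: t_def)
  have "(lazy_w1 q - (1 - t)) / t \<le> lazy_w1 p"
  proof (rule lazy_w1_ge)
    fix \<pi> assume pl: "transport_plan G (lazy_walk_measure G p x) (lazy_walk_measure G p y) \<pi>"
    let ?V = "pverts G"
    define \<rho> where "\<rho> u v = t * \<pi> u v + (if u = x \<and> v = y then 1 - t else 0)" for u v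
    have pt: "lazy_walk_measure G q z v = t * lazy_walk_measure G p z v + (if v = z then 1 - t else 0)" for z v
    proof -
      have "q = t * p + (1 - t)" using t(3) by (simp add: algebra_simps)
      moreover have "(1 - q) / real (out_degree (with_proj G) z) = t * ((1 - p) / real (out_degree (with_proj G) z))"
        using t(3) by simp
      ultimately show ?thesis unfolding lazy_walk_measure_def by simp
    qed
    have "transport_plan G (lazy_walk_measure G q x) (lazy_walk_measure G q y) \<rho>"
      unfolding transport_plan_def
    proof (intro conjI ballI)
      fix u v assume "u \<in> ?V" "v \<in> ?V"
      then show "0 \<le> \<rho> u v" using pl t by (auto simp: \<rho>_def transport_plan_def)
    next
      fix u assume u: "u \<in> ?V"
      have "(\<Sum>v\<in>?V. \<rho> u v) = t * (\<Sum>v\<in>?V. \<pi> u v) + (\<Sum>v\<in>?V. if v = y then (if u = x then 1 - t else 0) else 0)"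
        unfolding \<rho>_def sum.distrib sum_distrib_left by (intro arg_cong2[of _ _ _ _ "(+)"] sum.cong) auto
      then show "(\<Sum>v\<in>?V. \<rho> u v) = lazy_walk_measure G q x u"
        using pl u xyV fg.fin by (simp add: pt[of x] transport_plan_def)
    next
      fix v assume v: "v \<in> ?V"
      have "(\<Sum>u\<in>?V. \<rho> u v) = t * (\<Sum>u\<in>?V. \<pi> u v) + (\<Sum>u\<in>?V. if u = x then (if v = y then 1 - t else 0) else 0)"
        unfolding \<rho>_def sum.distrib sum_distrib_left by (intro arg_cong2[of _ _ _ _ "(+)"] sum.cong) auto
      then show "(\<Sum>u\<in>?V. \<rho> u v) = lazy_walk_measure G q y v"
        using pl v xyV fg.fin by (simp add: pt[of y] transport_plan_def)
    qed
    then have "lazy_w1 q \<le> plan_cost \<rho>" by (rule lazy_w1_le)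
    also have "plan_cost \<rho> = t * plan_cost \<pi> + (1 - t)"
    proof -
      let ?g = "\<lambda>u v. real_of_ereal (gdist G u v)"
      have "plan_cost \<rho> = (\<Sum>u\<in>?V. \<Sum>v\<in>?V. t * (\<pi> u v * ?g u v) + (if v = y then (if u = x then (1 - t) * ?g x y else 0) else 0))"
        unfolding plan_cost_def \<rho>_def by (intro sum.cong) (auto simp: algebra_simps)
      also have "\<dots> = t * plan_cost \<pi> + (1 - t) * ?g x y"
        using xyV fg.fin by (simp add: sum.distrib plan_cost_def sum_distrib_left)
      finally show ?thesis using gdist_adjacent[OF xy] by simp
    qed
    finally show "(lazy_w1 q - (1 - t)) / t \<le> plan_cost \<pi>" using t(1) by (simp add: field_simps)
  qed (use p in auto)
  then show ?thesis using t(1) by (simp add: field_simps)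
qed

text \<open>\<open>Lim\<close> is a definite description, so the limit is first shown to exist: the
  quotient is monotone by \<open>lazy_w1_convex\<close> and bounded by
  \<open>lazy_w1_dual\<close>.\<close>

lemma LLY_curvature_le:
  fixes f :: "'a \<Rightarrow> real"
  assumes lip: "\<And>u v. adjacent u v \<Longrightarrow> f u - f v \<le> 1" and f1: "f x - f y = 1"
  shows "LLY_curvature G x y \<le> 1 - ((\<Sum>v\<in>fg.nb x. f v) - (\<Sum>v\<in>fg.nb y. f v)) / real d"
proof -
  define \<Delta> where "\<Delta> = ((\<Sum>v\<in>fg.nb x. f v) - (\<Sum>v\<in>fg.nb y. f v)) / real d"
  define F where "F p = lazy_curvature G p x y / (1 - p)" for p
  have F: "F p = (1 - lazy_w1 p) / (1 - p)" for p
    by (simp add: F_def lazy_curvature_def gdist_adjacent[OF xy])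
  have "F p \<le> F q" if p: "0 \<le> p" "p \<le> q" "q < 1" for p q
  proof -
    have "1 - lazy_w1 q \<ge> (1 - q) / (1 - p) * (1 - lazy_w1 p)" using lazy_w1_convex[OF p] by (simp add: algebra_simps)
    then have "(1 - q) / (1 - p) * (1 - lazy_w1 p) / (1 - q) \<le> (1 - lazy_w1 q) / (1 - q)"
      using p by (intro divide_right_mono) auto
    then show ?thesis using p by (simp add: F)
  qed
  moreover have "F p \<le> 1 - \<Delta>" if p: "0 \<le> p" "p < 1" for p
  proof -
    have "(1 - p) / real d * ((\<Sum>v\<in>fg.nb x. f v) - (\<Sum>v\<in>fg.nb y. f v)) = (1 - p) * \<Delta>" by (simp add: \<Delta>_def)
    then have "p * 1 + (1 - p) * \<Delta> \<le> lazy_w1 p" using lazy_w1_dual[of p f, OF _ _ lip] p f1 by simp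
    then have "1 - lazy_w1 p \<le> (1 - \<Delta>) * (1 - p)" by (simp add: algebra_simps)
    then show ?thesis using p by (simp add: F divide_le_eq)
  qed
  ultimately obtain l where l: "l \<le> 1 - \<Delta>" "(F \<longlongrightarrow> l) (at_left 1)"
    using mono_bounded_tendsto_at_left[of F "1 - \<Delta>"] by blast
  have "LLY_curvature G x y = Lim (at_left 1) F" unfolding LLY_curvature_def F_def ..
  also have "\<dots> = l" by (rule tendsto_Lim[OF _ l(2)]) simp
  finally have "LLY_curvature G x y = l" .
  then show ?thesis using l(1) by (simp add: \<Delta>_def)
qed

end

end

section \<open>The classification\<close>

lemma (in terwilliger_graph) beta_pos: "\<beta> \<ge> 1"
proof -
  obtain x where x: "x \<in> V" using not_complete by blast
  obtain y where y: "y \<in> nb x" using nb_nonempty[OF x] by blast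
  have "d = Suc \<alpha> + card (nb x - cnb y)" using card_nb_split[of x y] x y by simp
  then have "card (nb x - cnb y) \<noteq> 0" using alpha_less by linarith
  then have "nb x - cnb y \<noteq> {}" by (metis card.empty)
  then obtain z where z: "z \<in> nb x" "z \<notin> cnb y" by blast
  have "x \<in> nb y \<inter> nb z" using x y z sym by auto
  then have ne: "nb y \<inter> nb z \<noteq> {}" by blast
  then have "card (nb y \<inter> nb z) = \<beta>" using beta[of y z] y z by auto
  moreover have "card (nb y \<inter> nb z) \<noteq> 0" using ne by (metis card_0_eq finite_Int finite_nb)
  ultimately show ?thesis by simp
qed

text \<open>The bijection goes from the model graph to \<open>G\<close>, the direction in which the
  embeddings are built; the isomorphism is its inverse.\<close>

lemma pair_digraph_isoI:
  assumes G: "pair_wf_digraph G" and H: "pair_wf_digraph H"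
    and g: "bij_betw g (pverts H) (pverts G)"
    and arcs: "\<And>u v. u \<in> pverts H \<Longrightarrow> v \<in> pverts H \<Longrightarrow> (g u, g v) \<in> parcs G \<longleftrightarrow> (u, v) \<in> parcs H"
  shows "digraph_iso (with_proj G) (with_proj H)"
proof -
  interpret G: pair_wf_digraph G by (rule G)
  interpret H: pair_wf_digraph H by (rule H)
  define f where "f = inv_into (pverts H) g"
  have f: "bij_betw f (pverts G) (pverts H)" unfolding f_def by (rule bij_betw_inv_into[OF g])
  have gf: "g (f u) = u" if "u \<in> pverts G" for u
    unfolding f_def using bij_betw_inv_into_right[OF g that] .
  have fH: "f u \<in> pverts H" if "u \<in> pverts G" for u using bij_betwE[OF f] that by blast
  define h where "h = \<lparr>iso_verts = f, iso_arcs = map_prod f f, iso_head = snd, iso_tail = fst\<rparr>"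
  have arcs': "map_prod f f ` parcs G = parcs H"
  proof
    show "map_prod f f ` parcs G \<subseteq> parcs H"
    proof
      fix e assume "e \<in> map_prod f f ` parcs G"
      then obtain u v where uv: "(u, v) \<in> parcs G" "e = (f u, f v)" by auto
      then have "u \<in> pverts G" "v \<in> pverts G" using G.in_arcsD1 G.in_arcsD2 by auto
      then show "e \<in> parcs H" using arcs[of "f u" "f v"] gf fH uv by simp
    qed
    show "parcs H \<subseteq> map_prod f f ` parcs G"
    proof
      fix e assume e: "e \<in> parcs H"
      obtain u v where uv: "e = (u, v)" by (metis surj_pair)
      then have V: "u \<in> pverts H" "v \<in> pverts H" using e H.in_arcsD1 H.in_arcsD2 by auto
      then have "(g u, g v) \<in> parcs G" using arcs e uv by simp
      moreover have "f (g u) = u" "f (g v) = v" unfolding f_def using bij_betw_inv_into_left[OF g] V by auto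
      ultimately show "e \<in> map_prod f f ` parcs G" using uv by (metis imageI map_prod_simp)
    qed
  qed
  have inj: "inj_on f (pverts G)" using f by (simp add: bij_betw_def)
  have "inj_on (map_prod f f) (parcs G)"
  proof (rule inj_onI)
    fix e e' assume e: "e \<in> parcs G" "e' \<in> parcs G" "map_prod f f e = map_prod f f e'"
    have "fst e \<in> pverts G" "snd e \<in> pverts G" "fst e' \<in> pverts G" "snd e' \<in> pverts G"
      using e G.arc_fst_in_verts G.arc_snd_in_verts by auto
    moreover have "f (fst e) = f (fst e')" "f (snd e) = f (snd e')" using e(3) by (cases e; cases e'; simp)+
    ultimately show "e = e'" using inj by (metis inj_onD prod_eqI)
  qed
  moreover have "wf_digraph (with_proj G)" by unfold_locales
  ultimately have "pre_digraph.digraph_isomorphism (with_proj G) h"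
    using inj by (simp add: pre_digraph.digraph_isomorphism_def h_def)
  moreover have "with_proj H = app_iso h (with_proj G)"
    using f arcs' by (simp add: app_iso_def h_def with_proj_def bij_betw_def)
  ultimately show ?thesis unfolding digraph_iso_def by blast
qed

lemma parcs_mk_symmetric_pair:
  "(u, v) \<in> parcs (mk_symmetric (with_proj G)) \<longleftrightarrow> (u, v) \<in> parcs G \<or> (v, u) \<in> parcs G"
proof
  assume "(u, v) \<in> parcs (mk_symmetric (with_proj G))"
  then obtain e where "e \<in> parcs G" "(u, v) = (fst e, snd e) \<or> (u, v) = (snd e, fst e)"
    by (auto simp: parcs_mk_symmetric)
  then show "(u, v) \<in> parcs G \<or> (v, u) \<in> parcs G" by (metis prod.collapse prod.inject)
next
  assume "(u, v) \<in> parcs G \<or> (v, u) \<in> parcs G"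
  then show "(u, v) \<in> parcs (mk_symmetric (with_proj G))"
    unfolding parcs_mk_symmetric with_proj_simps
  proof (elim disjE)
    assume "(u, v) \<in> parcs G"
    then show "(u, v) \<in> (\<Union>e\<in>parcs G. {(fst e, snd e), (snd e, fst e)})" by (rule UN_I) simp
  next
    assume "(v, u) \<in> parcs G"
    then show "(u, v) \<in> (\<Union>e\<in>parcs G. {(fst e, snd e), (snd e, fst e)})" by (rule UN_I) simp
  qed
qed

lemma pair_wf_digraphI:
  assumes "\<And>u v. (u, v) \<in> parcs G \<Longrightarrow> u \<in> pverts G \<and> v \<in> pverts G"
  shows "pair_wf_digraph G"
  by unfold_locales (use assms in auto)

section \<open>The named graphs\<close>

lemma icosahedron_parcs:
  "pverts icosahedron = icosahedron_verts" "(u, v) \<in> parcs icosahedron \<longleftrightarrow> icosahedron_adj u v"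
proof -
  have *: "(u, v) \<in> (\<Union>i<5. A i) \<or> (v, u) \<in> (\<Union>i<5. A i) \<longleftrightarrow>
      (\<exists>i<5. \<exists>(a, b)\<in>A i. (u, v) = (a, b) \<or> (u, v) = (b, a))" for A :: "nat \<Rightarrow> ((nat \<times> nat) \<times> nat \<times> nat) set"
    by auto
  show "pverts icosahedron = icosahedron_verts" by (simp add: icosahedron_def)
  show "(u, v) \<in> parcs icosahedron \<longleftrightarrow> icosahedron_adj u v"
    unfolding icosahedron_def icosahedron_adj_def parcs_mk_symmetric_pair pair_pre_digraph.select_convs * ..
qed

lemma icosahedron_adj_verts:
  "icosahedron_adj u v \<Longrightarrow> u \<in> icosahedron_verts \<and> v \<in> icosahedron_verts"
  unfolding icosahedron_adj_def by auto

lemma hoffman_singleton_parcs: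
  "pverts hoffman_singleton = hoffman_singleton_verts"
  "(u, v) \<in> parcs hoffman_singleton \<longleftrightarrow> hoffman_singleton_adj u v"
  unfolding hoffman_singleton_def hoffman_singleton_adj_def hoffman_singleton_arc_def parcs_mk_symmetric_pair
  by auto

lemma hoffman_singleton_adj_verts:
  "hoffman_singleton_adj u v \<Longrightarrow> u \<in> hoffman_singleton_verts \<and> v \<in> hoffman_singleton_verts"
  unfolding hoffman_singleton_adj_def hoffman_singleton_arc_def by auto

lemma pentagon_parcs:
  "pverts pentagon = {..<5}"
  "(u, v) \<in> parcs pentagon \<longleftrightarrow> u < 5 \<and> v < 5 \<and> ((u + 1) mod 5 = v \<or> (v + 1) mod 5 = u)"
  unfolding pentagon_def parcs_mk_symmetric_pair by auto

text \<open>The sets \<open>{2 * i, 2 * i + 1}\<close> for consecutive \<open>i\<close> are disjoint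
  and form the outer pentagon; \<open>{2 * i + 2, 2 * i + 4}\<close> is the inner set disjoint from
  the outer one with the same index.\<close>

definition petersen_label :: "nat \<times> nat \<Rightarrow> nat set" where
  "petersen_label w = (if fst w = 0 then {(2 * snd w) mod 5, (2 * snd w + 1) mod 5}
     else {(2 * snd w + 2) mod 5, (2 * snd w + 4) mod 5})"

lemma petersen_labels:
  "petersen_label (0, 0) = {0, 1}" "petersen_label (0, 1) = {2, 3}" "petersen_label (0, 2) = {4, 0}"
  "petersen_label (0, 3) = {1, 2}" "petersen_label (0, 4) = {3, 4}"
  "petersen_label (1, 0) = {2, 4}" "petersen_label (1, 1) = {4, 1}" "petersen_label (1, 2) = {1, 3}"
  "petersen_label (1, 3) = {3, 0}" "petersen_label (1, 4) = {0, 2}"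
  by (simp_all add: petersen_label_def, simp_all add: numeral_2_eq_2)

lemma petersen_index_cases:
  assumes "w \<in> {0, 1} \<times> {..<5::nat}"
  shows "w = (0, 0) \<or> w = (0, 1) \<or> w = (0, 2) \<or> w = (0, 3) \<or> w = (0, 4) \<or>
    w = (1, 0) \<or> w = (1, 1) \<or> w = (1, 2) \<or> w = (1, 3) \<or> w = (1::nat, 4)"
  using assms less_5_cases[of "snd w"] by (cases w) auto

lemma petersen_adj_iff:
  "petersen_adj u v \<longleftrightarrow> fst u \<le> 1 \<and> snd u < 5 \<and> snd v < 5 \<and>
     (if fst u = 0 \<and> fst v = 0 then (snd u + 1) mod 5 = snd v \<or> (snd v + 1) mod 5 = snd u
      else if fst u = 1 \<and> fst v = 1 then (snd u + 2) mod 5 = snd v \<or> (snd v + 2) mod 5 = snd u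
      else fst v \<le> 1 \<and> snd u = snd v)"
proof -
  have "fst u = 0 \<or> fst u = 1 \<or> \<not> fst u \<le> 1" "fst v = 0 \<or> fst v = 1 \<or> \<not> fst v \<le> 1" by linarith+
  then show ?thesis unfolding petersen_adj_def by (cases u; cases v) auto
qed

lemma petersen_label_iso:
  "bij_betw petersen_label ({0, 1} \<times> {..<5}) (pverts petersen)"
  "u \<in> {0, 1} \<times> {..<5} \<Longrightarrow> v \<in> {0, 1} \<times> {..<5} \<Longrightarrow>
     (petersen_label u, petersen_label v) \<in> parcs petersen \<longleftrightarrow> petersen_adj u v"
proof -
  have pv: "pverts petersen = {S. S \<subseteq> {..<5} \<and> card S = 2}" by (simp add: petersen_def)
  have into: "petersen_label w \<in> pverts petersen" if "w \<in> {0, 1} \<times> {..<5}" for w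
    unfolding pv using petersen_index_cases[OF that] by (elim disjE) (simp_all only: petersen_labels, simp_all)
  have ten: "card ({0, 1} \<times> {..<5::nat} :: (nat \<times> nat) set) = 10" by (simp add: card_cartesian_product)
  have inj: "inj_on petersen_label ({0, 1} \<times> {..<5})"
  proof (rule inj_onI)
    fix u v assume uv: "u \<in> {0, 1} \<times> {..<5::nat}" "v \<in> {0, 1} \<times> {..<5::nat}" "petersen_label u = petersen_label v"
    show "u = v"
      using petersen_index_cases[OF uv(1)] petersen_index_cases[OF uv(2)] uv(3)
      by (elim disjE) (simp_all add: petersen_labels[unfolded One_nat_def] doubleton_eq_iff)
  qed
  have fin: "finite (pverts petersen)" unfolding pv by (rule finite_subset[of _ "Pow {..<5}"]) auto
  \<comment> \<open>Ten indices and ten 2-subsets of a 5-set: injectivity gives bijectivity.\<close>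
  have "card (pverts petersen) = 10"
  proof -
    have "card (pverts petersen) = card {..<5::nat} choose 2" unfolding pv by (rule n_subsets) simp
    then show ?thesis by (simp add: choose_two)
  qed
  then have "petersen_label ` ({0, 1} \<times> {..<5}) = pverts petersen"
    using card_subset_eq[OF fin, of "petersen_label ` ({0, 1} \<times> {..<5})"] into card_image[OF inj] ten by fastforce
  then show "bij_betw petersen_label ({0, 1} \<times> {..<5}) (pverts petersen)" using inj by (simp add: bij_betw_def)
  assume uv: "u \<in> {0, 1} \<times> {..<5::nat}" "v \<in> {0, 1} \<times> {..<5::nat}"
  have "(petersen_label u, petersen_label v) \<in> parcs petersen \<longleftrightarrow> petersen_label u \<inter> petersen_label v = {}"
    using into[OF uv(1)] into[OF uv(2)] by (simp add: petersen_def)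
  also have "\<dots> \<longleftrightarrow> petersen_adj u v"
    unfolding petersen_adj_iff
    using petersen_index_cases[OF uv(1)] petersen_index_cases[OF uv(2)]
    by (elim disjE) (simp_all add: petersen_labels[unfolded One_nat_def])
  finally show "(petersen_label u, petersen_label v) \<in> parcs petersen \<longleftrightarrow> petersen_adj u v" .
qed

lemma line_graph_wf: "pair_wf_digraph (line_graph K)"
  by (rule pair_wf_digraphI) (auto simp: line_graph_def Let_def)

lemma line_graph_parcs:
  "(e, f) \<in> parcs (line_graph K) \<longleftrightarrow>
     e \<in> pverts (line_graph K) \<and> f \<in> pverts (line_graph K) \<and> e \<noteq> f \<and> e \<inter> f \<noteq> {}"
  by (simp add: line_graph_def Let_def)

text \<open>The Moore graph of degree 2 leads to the line graph of the pentagon; vertex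
  \<open>i\<close> corresponds to the edge from \<open>i\<close> to \<open>i + 1\<close>.\<close>

lemma line_graph_pentagon_iso: "digraph_iso (with_proj (line_graph pentagon)) (with_proj pentagon)"
proof (rule pair_digraph_isoI[of _ _ "\<lambda>i. {i, (i + 1) mod 5}"])
  show "pair_wf_digraph (line_graph pentagon)" by (rule line_graph_wf)
  show "pair_wf_digraph pentagon" by (rule pair_wf_digraphI) (auto simp: pentagon_parcs)
  have inj: "i = j" if "i < 5" "j < 5" "{i, (i + 1) mod 5} = {j, (j + 1) mod 5}" for i j :: nat
    using less_5_cases[OF that(1)] less_5_cases[OF that(2)] that(3)
    by (elim disjE) (simp_all add: doubleton_eq_iff)
  have meet: "{i, (i + 1) mod 5} \<inter> {j, (j + 1) mod 5} \<noteq> {} \<and> {i, (i + 1) mod 5} \<noteq> {j, (j + 1) mod 5} \<longleftrightarrow>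
      (i + 1) mod 5 = j \<or> (j + 1) mod 5 = i" if "i < 5" "j < 5" for i j :: nat
    using less_5_cases[OF that(1)] less_5_cases[OF that(2)]
    by (elim disjE) (simp_all add: doubleton_eq_iff)
  have lv: "pverts (line_graph pentagon) = (\<lambda>i. {i, (i + 1) mod 5}) ` {..<5}"
  proof
    show "pverts (line_graph pentagon) \<subseteq> (\<lambda>i. {i, (i + 1) mod 5}) ` {..<5}"
    proof
      fix e assume "e \<in> pverts (line_graph pentagon)"
      then obtain u v where uv: "e = {u, v}" "u < 5" "v < 5" "(u + 1) mod 5 = v \<or> (v + 1) mod 5 = u"
        by (auto simp: line_graph_def Let_def pentagon_parcs)
      then have "e = {u, (u + 1) mod 5} \<or> e = {v, (v + 1) mod 5}" by auto
      then show "e \<in> (\<lambda>i. {i, (i + 1) mod 5}) ` {..<5}" using uv by auto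
    qed
    show "(\<lambda>i. {i, (i + 1) mod 5}) ` {..<5} \<subseteq> pverts (line_graph pentagon)"
    proof
      fix e assume "e \<in> (\<lambda>i. {i, (i + 1) mod 5}) ` {..<5::nat}"
      then obtain i where i: "i < 5" "e = {i, (i + 1) mod 5}" by auto
      then have "(i, (i + 1) mod 5) \<in> parcs pentagon" by (simp add: pentagon_parcs)
      then show "e \<in> pverts (line_graph pentagon)" using i(2) by (auto simp: line_graph_def Let_def)
    qed
  qed
  show "bij_betw (\<lambda>i. {i, (i + 1) mod 5}) (pverts pentagon) (pverts (line_graph pentagon))"
    unfolding lv pentagon_parcs(1) bij_betw_def using inj by (auto intro!: inj_onI)
  fix i j assume "i \<in> pverts pentagon" "j \<in> pverts pentagon"
  then have ij: "i < 5" "j < 5" by (auto simp: pentagon_parcs)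
  have "{i, (i + 1) mod 5} \<in> pverts (line_graph pentagon)" "{j, (j + 1) mod 5} \<in> pverts (line_graph pentagon)"
    unfolding lv using ij by auto
  then have "({i, (i + 1) mod 5}, {j, (j + 1) mod 5}) \<in> parcs (line_graph pentagon) \<longleftrightarrow>
      {i, (i + 1) mod 5} \<inter> {j, (j + 1) mod 5} \<noteq> {} \<and> {i, (i + 1) mod 5} \<noteq> {j, (j + 1) mod 5}"
    unfolding line_graph_parcs by argo
  also have "\<dots> \<longleftrightarrow> (i, j) \<in> parcs pentagon" unfolding meet[OF ij] pentagon_parcs using ij by simp
  finally show "({i, (i + 1) mod 5}, {j, (j + 1) mod 5}) \<in> parcs (line_graph pentagon) \<longleftrightarrow> (i, j) \<in> parcs pentagon" .
qed

text \<open>Carries the graph of lines, whose vertices are sets, to a graph on natural numbers, as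
  the last alternative of the theorem demands.\<close>

lemma moore_transfer:
  assumes m: "moore V E k" and g: "bij_betw g W V"
    and F: "\<And>u v. F u v \<longleftrightarrow> u \<in> W \<and> v \<in> W \<and> E (g u) (g v)"
  shows "moore W F k"
proof -
  interpret M: moore V E k by (rule m)
  interpret W: finite_graph W F
    by unfold_locales (use F M.sym M.irrefl bij_betw_finite[OF g] M.fin in auto)
  have gV: "g u \<in> V" if "u \<in> W" for u using bij_betwE[OF g] that by blast
  have inj: "inj_on g W" and img: "g ` W = V" using g by (auto simp: bij_betw_def)
  have nb: "g ` W.nb u = M.nb (g u)" if "u \<in> W" for u
    using that F gV img by (auto simp: W.nb_def M.nb_def)
  have sub: "W.nb u \<subseteq> W" for u by auto
  have Int: "g ` (W.nb u \<inter> W.nb v) = M.nb (g u) \<inter> M.nb (g v)" if "u \<in> W" "v \<in> W" for u v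
    using inj_on_image_Int[OF inj sub sub] nb that by simp
  have ci: "card (g ` S) = card S" if "S \<subseteq> W" for S using card_image inj_on_subset[OF inj that] by blast
  show ?thesis
  proof unfold_locales
    show "card (W.nb u) = k" if "u \<in> W" for u using ci[OF sub, of u] nb[OF that] M.deg gV that by simp
    show "W.nb u \<inter> W.nb v = {}" if "u \<in> W" "v \<in> W" "F u v" for u v
      using Int[OF that(1,2)] M.tri[of "g u" "g v"] gV that F by auto
    show "card (W.nb u \<inter> W.nb v) = 1" if "u \<in> W" "v \<in> W" "u \<noteq> v" "\<not> F u v" for u v
    proof -
      have "g u \<noteq> g v" using inj that by (auto simp: inj_on_def)
      then have "card (M.nb (g u) \<inter> M.nb (g v)) = 1" using M.quad[of "g u" "g v"] gV that F by auto
      moreover have "W.nb u \<inter> W.nb v \<subseteq> W" by auto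
      ultimately show ?thesis using ci Int[OF that(1,2)] by metis
    qed
    show "2 \<le> k" by (rule M.k_ge)
    show "W \<noteq> {}" using img M.nonempty by auto
  qed
qed

text \<open>Nonadjacent vertices have a common neighbour, so walks of length at most 2 give both
  connectedness and the diameter.\<close>

lemma moore_strongly_regular:
  assumes K: "pair_graph K" and m: "moore (pverts K) (\<lambda>u v. (u, v) \<in> parcs K) k"
  shows "strongly_regular K (k * k + 1) k 0 1"
proof -
  interpret K: pair_graph K by (rule K)
  have adj: "K.adjacent = (\<lambda>u v. (u, v) \<in> parcs K)" by (simp add: fun_eq_iff K.adjacent_def)
  interpret M: moore "pverts K" K.adjacent k unfolding adj by (rule m)
  interpret MW: local_terwilliger "pverts K" K.adjacent k 1 by (rule M.moore_local_terwilliger)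
  obtain a b where ab: "a \<in> pverts K" "b \<in> pverts K" "a \<noteq> b" "\<not> K.adjacent a b" using MW.noncomplete by blast
  have le2: "\<exists>p. K.awalk u p v \<and> length p \<le> 2" if uv: "u \<in> pverts K" "v \<in> pverts K" for u v
  proof -
    consider "u = v" | "K.adjacent u v" | "u \<noteq> v" "\<not> K.adjacent u v" by blast
    then show ?thesis
    proof cases
      case 1
      then show ?thesis using uv by (intro exI[of _ "[]"]) (simp add: K.awalk_Nil_iff)
    next
      case 2
      then show ?thesis using K.awalk_arc by (intro exI[of _ "[(u, v)]"]) simp
    next
      case 3
      then obtain w where "K.adjacent u w" "K.adjacent v w" using M.common[OF uv] by metis
      then show ?thesis using K.awalk_arc2[of u w v] K.fg.sym by (intro exI[of _ "[(u, w), (w, v)]"]) simp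
    qed
  qed
  have "\<not> complete_graph K"
    using ab unfolding complete_graph_def complete_digraph_pair_def K.adjacent_def by auto
  moreover have "Digraph_Component.connected (with_proj K)"
    unfolding connected_def
  proof (rule strongly_connectedI)
    show "verts (with_proj (mk_symmetric (with_proj K))) \<noteq> {}" using ab by auto
    fix u v assume "u \<in> verts (with_proj (mk_symmetric (with_proj K)))" "v \<in> verts (with_proj (mk_symmetric (with_proj K)))"
    then have "u \<in> pverts K" "v \<in> pverts K" by auto
    then have "u \<rightarrow>\<^sup>*\<^bsub>with_proj K\<^esub> v" using le2 K.reachable_awalk by blast
    then show "u \<rightarrow>\<^sup>*\<^bsub>with_proj (mk_symmetric (with_proj K))\<^esub> v"
      using K.reachable_mk_symmetric_eq[OF K.pair_sym_arcs] by blast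
  qed
  moreover have "card (pverts K) = k * k + 1" by (rule M.card_V)
  moreover have "out_degree (with_proj K) u = k" if "u \<in> pverts K" for u
    using M.deg that by (simp add: K.out_degree_eq)
  moreover have "card (common_neighbours K u v) = 0" if "(u, v) \<in> parcs K" for u v
    using M.tri[of u v] that K.adjacent_verts[of u v] by (simp add: K.common_neighbours_eq K.adjacent_def)
  moreover have "card (common_neighbours K u v) = 1" if "u \<in> pverts K" "v \<in> pverts K" "gdist K u v = 2" for u v
    using M.quad[of u v] that K.gdist_2_iff by (simp add: K.common_neighbours_eq)
  ultimately have ar: "amply_regular K (k * k + 1) k 0 1" unfolding amply_regular_def using K by blast
  have dle: "gdist K u v \<le> 2" if uv: "u \<in> pverts K" "v \<in> pverts K" for u v
  proof -
    obtain p where p: "K.awalk u p v" "length p \<le> 2" using le2[OF uv] by blast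
    have "gdist K u v \<le> ereal (real (length p))" by (rule K.gdist_le[OF p(1)])
    also have "\<dots> \<le> 2" using p(2) by (simp add: numeral_eq_ereal)
    finally show ?thesis .
  qed
  have "diameter K = 2"
    unfolding diameter_def
  proof (rule antisym)
    show "(SUP x\<in>pverts K. SUP y\<in>pverts K. gdist K x y) \<le> 2"
      by (intro SUP_least dle)
    obtain w where "K.adjacent a w" "K.adjacent b w" using M.common[OF ab] by metis
    then have "gdist K a b = 2" using K.gdist_2_iff[OF ab(1,2)] ab K.nb_eq by auto
    then show "2 \<le> (SUP x\<in>pverts K. SUP y\<in>pverts K. gdist K x y)"
      using ab(1,2) by (metis SUP_upper2 order_refl)
  qed
  then show ?thesis using ar by (simp add: strongly_regular_def)
qed

text \<open>\<open>g\<close> names the lines by vertices of \<open>K\<close>. An edge of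
  \<open>K\<close> becomes a pair of meeting lines and thus, by \<open>lines_through_bij\<close>,
  the vertex of \<open>G\<close> where they meet.\<close>

lemma line_graph_iso:
  assumes G: "pair_graph G" and T: "terwilliger_lines (pverts G) (pair_graph.adjacent G) d \<alpha> \<beta>"
    and K: "pair_wf_digraph K"
    and g: "bij_betw g (pverts K) (terwilliger_lines.lines (pverts G) (pair_graph.adjacent G))"
    and arcs: "\<And>u v. u \<in> pverts K \<Longrightarrow> v \<in> pverts K \<Longrightarrow>
        terwilliger_lines.meet (g u) (g v) \<longleftrightarrow> (u, v) \<in> parcs K"
  shows "digraph_iso (with_proj G) (with_proj (line_graph K))"
proof -
  interpret G: pair_graph G by (rule G)
  interpret T: terwilliger_lines "pverts G" G.adjacent d \<alpha> \<beta> by (rule T)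
  interpret K: pair_wf_digraph K by (rule K)
  define \<phi> where "\<phi> e = inv_into (pverts G) T.lines_through (g ` e)" for e
  let ?E = "{{u, v} | u v. (u, v) \<in> parcs K}"
  let ?L = "{{l, m} | l m. l \<in> T.lines \<and> m \<in> T.lines \<and> T.meet l m}"
  have lv: "pverts (line_graph K) = ?E" by (simp add: line_graph_def Let_def)
  have inj: "inj_on g (pverts K)" and img: "g ` pverts K = T.lines" using g by (auto simp: bij_betw_def)
  have EV: "e \<subseteq> pverts K" if "e \<in> ?E" for e using that K.in_arcsD1 K.in_arcsD2 by auto
  have b1: "bij_betw (image g) ?E ?L"
    unfolding bij_betw_def
  proof
    show "inj_on (image g) ?E" using inj_on_image[of g ?E] inj EV by (meson Sup_least inj_on_subset)
    show "image g ` ?E = ?L"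
    proof
      show "image g ` ?E \<subseteq> ?L"
      proof
        fix x assume "x \<in> image g ` ?E"
        then obtain u v where uv: "(u, v) \<in> parcs K" "x = {g u, g v}" by auto
        then have V: "u \<in> pverts K" "v \<in> pverts K" using K.in_arcsD1 K.in_arcsD2 by auto
        then have "T.meet (g u) (g v)" using arcs uv by blast
        then show "x \<in> ?L" using uv V img by blast
      qed
      show "?L \<subseteq> image g ` ?E"
      proof
        fix x assume "x \<in> ?L"
        then obtain l m where lm: "x = {l, m}" "l \<in> T.lines" "m \<in> T.lines" "T.meet l m" by blast
        then obtain u v where uv: "u \<in> pverts K" "v \<in> pverts K" "l = g u" "m = g v" using img by (metis imageE)
        then have "{u, v} \<in> ?E" using arcs lm by blast
        moreover have "x = g ` {u, v}" using lm uv by simp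
        ultimately show "x \<in> image g ` ?E" by blast
      qed
    qed
  qed
  have b2: "bij_betw (inv_into (pverts G) T.lines_through) ?L (pverts G)"
    by (rule bij_betw_inv_into[OF T.lines_through_bij])
  have bij: "bij_betw \<phi> (pverts (line_graph K)) (pverts G)"
    unfolding \<phi>_def lv using bij_betw_trans[OF b1 b2] by (simp add: comp_def)
  have lt: "T.lines_through (\<phi> e) = g ` e" if "e \<in> ?E" for e
  proof -
    have "g ` e \<in> ?L" by (rule bij_betw_apply[OF b1 that])
    then show ?thesis unfolding \<phi>_def by (rule bij_betw_inv_into_right[OF T.lines_through_bij])
  qed
  show ?thesis
  proof (rule pair_digraph_isoI[OF _ line_graph_wf bij])
    show "pair_wf_digraph G" by unfold_locales
    fix e e' assume "e \<in> pverts (line_graph K)" "e' \<in> pverts (line_graph K)"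
    then have e: "e \<in> ?E" "e' \<in> ?E" unfolding lv by auto
    have V: "\<phi> e \<in> pverts G" "\<phi> e' \<in> pverts G" using bij_betwE[OF bij] e unfolding lv by auto
    have "(\<phi> e, \<phi> e') \<in> parcs G \<longleftrightarrow> G.adjacent (\<phi> e) (\<phi> e')" by (simp add: G.adjacent_def)
    also have "\<dots> \<longleftrightarrow> g ` e \<noteq> g ` e' \<and> g ` e \<inter> g ` e' \<noteq> {}"
      unfolding T.adjacent_iff_lines_through[OF V] lt[OF e(1)] lt[OF e(2)] ..
    also have "\<dots> \<longleftrightarrow> e \<noteq> e' \<and> e \<inter> e' \<noteq> {}"
      using inj_on_image_eq_iff[OF inj EV[OF e(1)] EV[OF e(2)]] inj_on_image_Int[OF inj EV[OF e(1)] EV[OF e(2)]]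
      by auto
    also have "\<dots> \<longleftrightarrow> (e, e') \<in> parcs (line_graph K)" using e by (simp add: line_graph_def Let_def)
    finally show "(\<phi> e, \<phi> e') \<in> parcs G \<longleftrightarrow> (e, e') \<in> parcs (line_graph K)" .
  qed
qed

section \<open>From the definitions to the locales, and the case distinction\<close>

lemma amply_regular_terwilliger_graph:
  assumes ar: "amply_regular G n d \<alpha> \<beta>" and t: "terwilliger G"
  shows "terwilliger_graph (pverts G) (pair_graph.adjacent G) d \<alpha> \<beta>"
proof -
  interpret G: pair_graph G using ar by (simp add: amply_regular_def)
  obtain \<beta>' where b': "\<And>u v. u \<in> pverts G \<Longrightarrow> v \<in> pverts G \<Longrightarrow> gdist G u v = 2 \<Longrightarrow>
      complete_digraph \<beta>' (with_proj G \<restriction> common_neighbours G u v)"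
    using t unfolding terwilliger_def by blast
  show ?thesis
  proof unfold_locales
    show "card (G.fg.nb u) = d" if "u \<in> pverts G" for u
      using ar that by (simp add: amply_regular_def G.out_degree_eq)
    show "card (G.fg.nb u \<inter> G.fg.nb v) = \<alpha>" if "u \<in> pverts G" "v \<in> pverts G" "G.adjacent u v" for u v
      using ar that by (simp add: amply_regular_def G.common_neighbours_eq G.adjacent_def)
    show "card (G.fg.nb u \<inter> G.fg.nb v) = \<beta>"
      if "u \<in> pverts G" "v \<in> pverts G" "u \<noteq> v" "\<not> G.adjacent u v" "G.fg.nb u \<inter> G.fg.nb v \<noteq> {}" for u v
    proof -
      have "gdist G u v = 2" using G.gdist_2_iff that by blast
      then show ?thesis using ar that by (simp add: amply_regular_def G.common_neighbours_eq)
    qed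
    show "G.adjacent x y"
      if "u \<in> pverts G" "v \<in> pverts G" "u \<noteq> v" "\<not> G.adjacent u v" "x \<in> G.fg.nb u \<inter> G.fg.nb v"
        "y \<in> G.fg.nb u \<inter> G.fg.nb v" "x \<noteq> y" for u v x y
    proof -
      let ?S = "common_neighbours G u v"
      have "gdist G u v = 2" using G.gdist_2_iff that by blast
      then have "complete_digraph \<beta>' (with_proj G \<restriction> ?S)" using b' that by blast
      then have "arcs_ends (with_proj G \<restriction> ?S) = {(u, v). (u, v) \<in> verts (with_proj G \<restriction> ?S) \<times> verts (with_proj G \<restriction> ?S) \<and> u \<noteq> v}"
        by (simp add: complete_digraph_def)
      moreover have "x \<in> ?S" "y \<in> ?S" using that by (simp_all only: G.common_neighbours_eq)
      ultimately have "(x, y) \<in> arcs_ends (with_proj G \<restriction> ?S)" using that(7) by (simp add: induce_subgraph_verts)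
      then show ?thesis by (auto simp: arcs_ends_def induce_subgraph_def arc_to_ends_def G.adjacent_def)
    qed
    show "S = pverts G" if "S \<subseteq> pverts G" "S \<noteq> {}" "\<And>u v. u \<in> S \<Longrightarrow> v \<in> G.fg.nb u \<Longrightarrow> v \<in> S" for S
      by (rule G.connected_closed_subset) (use ar that in \<open>auto simp: amply_regular_def\<close>)
    show "\<exists>u\<in>pverts G. \<exists>v\<in>pverts G. u \<noteq> v \<and> \<not> G.adjacent u v"
    proof (rule ccontr)
      assume no: "\<not> ?thesis"
      have "parcs G = {(u, v). (u, v) \<in> pverts G \<times> pverts G \<and> u \<noteq> v}"
        using no G.adjacent_verts G.fg.irrefl unfolding G.adjacent_def by auto
      then have "complete_graph G"
        unfolding complete_graph_def complete_digraph_pair_def using G.fg.fin by blast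
      then show False using ar by (simp add: amply_regular_def)
    qed
  qed
qed

theorem theorem1p5:
  fixes G :: "'a pair_pre_digraph" and n d \<alpha> \<beta> :: nat
  assumes "amply_regular G n d \<alpha> \<beta>"
    and "terwilliger G"
    and "\<And>x y. (x, y) \<in> parcs G \<Longrightarrow> LLY_curvature G x y > 0"
  shows "digraph_iso (with_proj G) (with_proj pentagon) \<or>
    digraph_iso (with_proj G) (with_proj icosahedron) \<or>
    digraph_iso (with_proj G) (with_proj (line_graph petersen)) \<or>
    digraph_iso (with_proj G) (with_proj (line_graph hoffman_singleton)) \<or>
    (\<exists>H :: nat pair_pre_digraph. strongly_regular H 3250 57 0 1 \<and>
       digraph_iso (with_proj G) (with_proj (line_graph H)))"
proof -
  have pg: "pair_graph G" using assms(1) by (simp add: amply_regular_def)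
  interpret G: pair_graph G by (rule pg)
  interpret T: terwilliger_graph "pverts G" G.adjacent d \<alpha> \<beta>
    by (rule amply_regular_terwilliger_graph[OF assms(1,2)])
  have conn: "Digraph_Component.connected (with_proj G)" using assms(1) by (simp add: amply_regular_def)
  have curv: "(\<Sum>u\<in>G.fg.nb x. f u) - (\<Sum>u\<in>G.fg.nb y. f u) < real d"
    if xy: "x \<in> pverts G" "y \<in> pverts G" "G.adjacent x y"
      and lip: "\<And>u v. u \<in> pverts G \<Longrightarrow> v \<in> pverts G \<Longrightarrow> G.adjacent u v \<Longrightarrow> f u - f v \<le> (1::real)"
      and f1: "f x - f y = 1" for x y f
  proof -
    have "LLY_curvature G x y \<le> 1 - ((\<Sum>v\<in>G.fg.nb x. f v) - (\<Sum>v\<in>G.fg.nb y. f v)) / real d"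
      by (rule G.LLY_curvature_le[OF conn xy(3) T.deg[OF xy(1)] T.deg[OF xy(2)] _ f1])
        (use lip G.adjacent_verts in blast)
    moreover have "LLY_curvature G x y > 0" using assms(3) xy(3) by (simp add: G.adjacent_def)
    ultimately have "((\<Sum>v\<in>G.fg.nb x. f v) - (\<Sum>v\<in>G.fg.nb y. f v)) / real d < 1" by linarith
    moreover have "real d > 0" using T.alpha_less by simp
    ultimately show ?thesis by (simp add: divide_less_eq)
  qed
  then have lb: "T.lipschitz_bound" unfolding T.lipschitz_bound_def by blast
  have small: "d \<le> 2 * Suc \<alpha>" by (rule T.degree_le[OF lb])
  show ?thesis
  proof (cases "\<beta> \<ge> 2")
    case True
    obtain g where g: "bij_betw g icosahedron_verts (pverts G)"
        "\<And>w w'. w \<in> icosahedron_verts \<Longrightarrow> w' \<in> icosahedron_verts \<Longrightarrow>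
           G.adjacent (g w) (g w') \<longleftrightarrow> icosahedron_adj w w'"
      using T.icosahedron_iso[OF T.locally_pentagon[OF True small]] by blast
    have "digraph_iso (with_proj G) (with_proj icosahedron)"
    proof (rule pair_digraph_isoI[of G icosahedron g])
      show "pair_wf_digraph G" by unfold_locales
      show "pair_wf_digraph icosahedron"
        using icosahedron_adj_verts by (intro pair_wf_digraphI) (simp only: icosahedron_parcs)
      show "bij_betw g (pverts icosahedron) (pverts G)" using g(1) by (simp only: icosahedron_parcs(1))
      show "(g u, g v) \<in> parcs G \<longleftrightarrow> (u, v) \<in> parcs icosahedron"
        if "u \<in> pverts icosahedron" "v \<in> pverts icosahedron" for u v
        using g(2)[of u v] that unfolding icosahedron_parcs G.adjacent_def by blast
    qed
    then show ?thesis by blast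
  next
    case False
    then have b1: "\<beta> = 1" using T.beta_pos by simp
    have TL: "terwilliger_lines (pverts G) G.adjacent d \<alpha> \<beta>"
    proof unfold_locales
      show "\<exists>w\<in>G.fg.nb y - G.fg.cnb x. G.fg.nb z \<inter> G.fg.nb w \<noteq> {}"
        if "x \<in> pverts G" "y \<in> pverts G" "G.adjacent x y" "d = 2 * Suc \<alpha>" "z \<in> G.fg.nb x - G.fg.cnb y" for x y z
        by (rule T.capped_distance_sum(2)[OF lb that])
    qed (use b1 small in auto)
    interpret TL: terwilliger_lines "pverts G" G.adjacent d \<alpha> \<beta> by (rule TL)
    interpret M: moore TL.lines TL.meet "\<alpha> + 2" by (rule TL.lines_moore)
    note iso = line_graph_iso[OF pg TL]
    consider "\<alpha> + 2 = 2" | "\<alpha> + 2 = 3" | "\<alpha> + 2 = 7" | "\<alpha> + 2 = 57" using M.moore_degree by blast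
    then show ?thesis
    proof cases
      case 1
      interpret MW: local_terwilliger TL.lines TL.meet "\<alpha> + 2" 1 by (rule M.moore_local_terwilliger)
      obtain p where p: "TL.lg.pentagon_labelling p" "range p = TL.lines"
        using MW.pentagon_labelling_exists[OF 1] M.card_V 1 by auto
      have "digraph_iso (with_proj G) (with_proj (line_graph pentagon))"
      proof (rule iso[of pentagon p])
        show "pair_wf_digraph pentagon" by (rule pair_wf_digraphI) (auto simp: pentagon_parcs)
        show "bij_betw p (pverts pentagon) TL.lines"
          unfolding bij_betw_def
        proof
          show "inj_on p (pverts pentagon)"
            using M.pentagonD(2)[OF p(1)] by (auto simp: inj_on_def pentagon_parcs)
          have "p i \<in> p ` {..<5}" for i
            using M.pentagonD(2)[OF p(1), of i "i mod 5"] by (metis image_eqI lessThan_iff mod_less_divisor mod_mod_trivial zero_less_numeral)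
          then show "p ` pverts pentagon = TL.lines" unfolding pentagon_parcs(1) p(2)[symmetric] by blast
        qed
        show "TL.meet (p u) (p v) \<longleftrightarrow> (u, v) \<in> parcs pentagon" if "u \<in> pverts pentagon" "v \<in> pverts pentagon" for u v
          using that M.pentagonD(3)[OF p(1), of u v] by (simp add: pentagon_parcs)
      qed
      then have "digraph_iso (with_proj G) (with_proj pentagon)"
        using digraph_iso_trans line_graph_pentagon_iso by blast
      then show ?thesis by blast
    next
      case 2
      obtain g where g: "bij_betw g ({0, 1} \<times> {..<5}) TL.lines"
          "\<And>w w'. w \<in> {0, 1} \<times> {..<5} \<Longrightarrow> w' \<in> {0, 1} \<times> {..<5} \<Longrightarrow> TL.meet (g w) (g w') \<longleftrightarrow> petersen_adj w w'"
        using M.petersen_unique[OF 2] by blast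
      define h where "h = inv_into ({0, 1} \<times> {..<5}) petersen_label"
      have h: "bij_betw h (pverts petersen) ({0, 1} \<times> {..<5})"
        unfolding h_def by (rule bij_betw_inv_into[OF petersen_label_iso(1)])
      have lh: "petersen_label (h S) = S" if "S \<in> pverts petersen" for S
        unfolding h_def using bij_betw_inv_into_right[OF petersen_label_iso(1) that] .
      have "digraph_iso (with_proj G) (with_proj (line_graph petersen))"
      proof (rule iso[of petersen "g \<circ> h"])
        show "pair_wf_digraph petersen" by (rule pair_wf_digraphI) (auto simp: petersen_def)
        show "bij_betw (g \<circ> h) (pverts petersen) TL.lines" by (rule bij_betw_trans[OF h g(1)])
        show "TL.meet ((g \<circ> h) S) ((g \<circ> h) S') \<longleftrightarrow> (S, S') \<in> parcs petersen"
          if S: "S \<in> pverts petersen" "S' \<in> pverts petersen" for S S'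
        proof -
          have hS: "h S \<in> {0, 1} \<times> {..<5}" "h S' \<in> {0, 1} \<times> {..<5}" using bij_betwE[OF h] S by blast+
          show ?thesis using g(2)[OF hS] petersen_label_iso(2)[OF hS] lh S by simp
        qed
      qed
      then show ?thesis by blast
    next
      case 3
      obtain g where g: "bij_betw g hoffman_singleton_verts TL.lines"
          "\<And>w w'. w \<in> hoffman_singleton_verts \<Longrightarrow> w' \<in> hoffman_singleton_verts \<Longrightarrow>
             TL.meet (g w) (g w') \<longleftrightarrow> hoffman_singleton_adj w w'"
        using M.hoffman_singleton_unique[OF 3] by blast
      have "digraph_iso (with_proj G) (with_proj (line_graph hoffman_singleton))"
      proof (rule iso[of hoffman_singleton g])
        show "pair_wf_digraph hoffman_singleton"
          using hoffman_singleton_adj_verts by (intro pair_wf_digraphI) (simp only: hoffman_singleton_parcs)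
        show "bij_betw g (pverts hoffman_singleton) TL.lines" using g(1) by (simp only: hoffman_singleton_parcs(1))
        show "TL.meet (g u) (g v) \<longleftrightarrow> (u, v) \<in> parcs hoffman_singleton"
          if "u \<in> pverts hoffman_singleton" "v \<in> pverts hoffman_singleton" for u v
          using g(2)[of u v] that unfolding hoffman_singleton_parcs by blast
      qed
      then show ?thesis by blast
    next
      case 4
      have c: "card TL.lines = 3250" using M.card_V 4 by simp
      obtain g where "bij_betw g {0..<card TL.lines} TL.lines"
        using ex_bij_betw_nat_finite[OF TL.lg.fin] by blast
      then have g: "bij_betw g {..<3250::nat} TL.lines" by (simp add: c atLeast0LessThan)
      \<comment> \<open>A copy of the graph of lines on natural numbers; 3250 = 57 * 57 + 1.\<close>
      define K :: "nat pair_pre_digraph" where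
        "K = \<lparr>pverts = {..<3250}, parcs = {(i, j). i < 3250 \<and> j < 3250 \<and> TL.meet (g i) (g j)}\<rparr>"
      have K: "pverts K = {..<3250}" "\<And>i j. (i, j) \<in> parcs K \<longleftrightarrow> i < 3250 \<and> j < 3250 \<and> TL.meet (g i) (g j)"
        by (auto simp: K_def)
      have "parcs K \<subseteq> {..<3250} \<times> {..<3250}" using K(2) by auto
      then have finK: "finite (parcs K)" by (rule finite_subset) simp
      have pgK: "pair_graph K"
      proof
        show "symmetric (with_proj K)" using K(2) TL.lg.sym by (auto simp: symmetric_def sym_def)
        show "fst e \<noteq> snd e" if "e \<in> parcs K" for e using K(2)[of "fst e" "snd e"] that TL.lg.irrefl by auto
      qed (use K finK in auto)
      have "moore (pverts K) (\<lambda>u v. (u, v) \<in> parcs K) 57"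
        using moore_transfer[OF TL.lines_moore g, of "\<lambda>u v. (u, v) \<in> parcs K"] 4 K by auto
      then have "strongly_regular K 3250 57 0 1" using moore_strongly_regular[OF pgK, of 57] by simp
      moreover have "digraph_iso (with_proj G) (with_proj (line_graph K))"
      proof (rule iso[of K g])
        show "pair_wf_digraph K" by (rule pair_wf_digraphI) (auto simp: K)
        show "bij_betw g (pverts K) TL.lines" using g by (simp only: K(1))
        show "TL.meet (g u) (g v) \<longleftrightarrow> (u, v) \<in> parcs K" if "u \<in> pverts K" "v \<in> pverts K" for u v
          using that by (simp add: K)
      qed
      ultimately show ?thesis by blast
    qed
  qed
qed

end
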